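(* Let $c\in\mathbb{R}$ and let $\omega\ge1$ be an integer. Assume $\hat\lambda_{c,\omega}<0$. Then for any $\varepsilon>0$ there exists a solution $\gamma:\mathbb{S}^1\times[0,T)\to\mathbb{R}^2$ of $$\partial_t\gamma=-(k_{ss}+ck^3)N,\qquad\gamma(\cdot,0)=\gamma_0,$$ with turning number $\omega$ such that $K_{\mathrm{osc}}(\gamma_0)\le\varepsilon$ and such that $K_{\mathrm{osc}}(\gamma(\cdot,t))$ is strictly increasing on a time interval $[0,t_0)$ for some $t_0\in(0,T]$.
   Context: Solutions are smooth one-parameter families of smooth immersed closed planar curves. Here $s$ denotes arclength, $N$ is the unit normal obtained by rotating the unit tangent $\gamma_s$ by $\pi/2$ counterclockwise, $k=\langle\gamma_{ss},N\rangle$ is the curvature, $L(\gamma)$ the length, and the turning number is $\frac1{2\pi}\int_\gamma k\,ds$. For a curve of turning number $\omega>0$, $$K_{\mathrm{osc}}(\gamma):=L(\gamma)\int_\gamma(k-\bar k)^2\,ds,\qquad \bar k:=\frac1{L(\gamma)}\int_\gamma k\,ds=\frac{2\pi\omega}{L(\gamma)}.$$ Define $$p_c(x):=2x^4-(6c+2)x^2+8c,\qquad \hat\lambda_{c,\omega}:=\min_{n\in\mathbb{Z}\setminus\{0,\pm\omega\}}p_c\left(\frac n\omega\right).$$ For any smooth initial curve the flow is known to have a unique smooth solution up to a maximal existence time. *)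

theory Defs
  imports "HOL-Analysis.Analysis"
begin

text \<open>
  The plane is \<^typ>\<open>complex\<close> with its Euclidean inner product; the counterclockwise rotation
  by \<open>\<pi>/2\<close> is multiplication by \<open>\<i>\<close>. The circle is \<open>\<real> / 2\<pi>\<int>\<close>, so closed curves
  are \<open>2\<pi>\<close>-periodic maps \<open>\<real> \<rightarrow> \<complex>\<close> and integrals over a curve are taken over
  one period.
\<close>

section \<open>Geometry of a single curve\<close>

definition speed :: "(real \<Rightarrow> complex) \<Rightarrow> real \<Rightarrow> real" where
  "speed \<gamma> u = norm (vector_derivative \<gamma> (at u))"

definition arc_deriv :: "(real \<Rightarrow> complex) \<Rightarrow> (real \<Rightarrow> 'a::real_normed_vector) \<Rightarrow> real \<Rightarrow> 'a" where
  "arc_deriv \<gamma> f u = (1 / speed \<gamma> u) *\<^sub>R vector_derivative f (at u)"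

definition unit_normal :: "(real \<Rightarrow> complex) \<Rightarrow> real \<Rightarrow> complex" where
  "unit_normal \<gamma> u = \<i> * arc_deriv \<gamma> \<gamma> u"

definition curvature :: "(real \<Rightarrow> complex) \<Rightarrow> real \<Rightarrow> real" where
  "curvature \<gamma> u = arc_deriv \<gamma> (arc_deriv \<gamma> \<gamma>) u \<bullet> unit_normal \<gamma> u"

definition arc_integral :: "(real \<Rightarrow> complex) \<Rightarrow> (real \<Rightarrow> real) \<Rightarrow> real" where
  "arc_integral \<gamma> f = integral {0..2 * pi} (\<lambda>u. f u * speed \<gamma> u)"

definition curve_length :: "(real \<Rightarrow> complex) \<Rightarrow> real" where
  "curve_length \<gamma> = arc_integral \<gamma> (\<lambda>u. 1)"

definition turning_number :: "(real \<Rightarrow> complex) \<Rightarrow> real" where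
  "turning_number \<gamma> = 1 / (2 * pi) * arc_integral \<gamma> (curvature \<gamma>)"

definition mean_curvature :: "(real \<Rightarrow> complex) \<Rightarrow> real" where
  "mean_curvature \<gamma> = 1 / curve_length \<gamma> * arc_integral \<gamma> (curvature \<gamma>)"

definition K_osc :: "(real \<Rightarrow> complex) \<Rightarrow> real" where
  "K_osc \<gamma> = curve_length \<gamma> *
     arc_integral \<gamma> (\<lambda>u. (curvature \<gamma> u - mean_curvature \<gamma>)\<^sup>2)"

section \<open>Solutions of the flow\<close>

text \<open>The half-open interval \<open>[0,T)\<close>, where \<open>T = \<infinity>\<close> is allowed.\<close>

definition time_interval :: "ereal \<Rightarrow> real set" where
  "time_interval T = {t. 0 \<le> t \<and> ereal t < T}"

text \<open>
  Smoothness on \<open>\<real> \<times> [0,T)\<close> up to and including \<open>t = 0\<close>: \<open>D i j\<close> is the mixed partial derivative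
  of order \<open>i\<close> in \<open>u\<close> and \<open>j\<close> in \<open>t\<close> (one-sided at \<open>t = 0\<close>), and all of these are jointly
  continuous.
\<close>

definition smooth_family :: "ereal \<Rightarrow> (real \<Rightarrow> real \<Rightarrow> complex) \<Rightarrow> bool" where
  "smooth_family T \<gamma> \<longleftrightarrow>
     (\<exists>D :: nat \<Rightarrow> nat \<Rightarrow> real \<Rightarrow> real \<Rightarrow> complex.
        D 0 0 = \<gamma> \<and>
        (\<forall>i j. continuous_on (UNIV \<times> time_interval T) (\<lambda>(u, t). D i j u t) \<and>
           (\<forall>u. \<forall>t\<in>time_interval T.
              ((\<lambda>v. D i j v t) has_vector_derivative D (Suc i) j u t) (at u) \<and>
              ((\<lambda>r. D i j u r) has_vector_derivative D i (Suc j) u t)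
                (at t within time_interval T))))"

definition immersed_closed_family :: "ereal \<Rightarrow> (real \<Rightarrow> real \<Rightarrow> complex) \<Rightarrow> bool" where
  "immersed_closed_family T \<gamma> \<longleftrightarrow>
     smooth_family T \<gamma> \<and>
     (\<forall>u. \<forall>t\<in>time_interval T.
        \<gamma> (u + 2 * pi) t = \<gamma> u t \<and> vector_derivative (\<lambda>v. \<gamma> v t) (at u) \<noteq> 0)"

definition flow_solution ::
  "real \<Rightarrow> ereal \<Rightarrow> (real \<Rightarrow> complex) \<Rightarrow> (real \<Rightarrow> real \<Rightarrow> complex) \<Rightarrow> bool" where
  "flow_solution c T \<gamma>\<^sub>0 \<gamma> \<longleftrightarrow>
     0 < T \<and> immersed_closed_family T \<gamma> \<and> (\<forall>u. \<gamma> u 0 = \<gamma>\<^sub>0 u) \<and>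
     (\<forall>u. \<forall>t\<in>time_interval T.
        let \<Gamma> = (\<lambda>v. \<gamma> v t); k = curvature \<Gamma> in
        ((\<lambda>r. \<gamma> u r) has_vector_derivative
           - ((arc_deriv \<Gamma> (arc_deriv \<Gamma> k) u + c * k u ^ 3) *\<^sub>R unit_normal \<Gamma> u))
          (at t within time_interval T))"

section \<open>The spectral quantity\<close>

definition p_poly :: "real \<Rightarrow> real \<Rightarrow> real" where
  "p_poly c x = 2 * x ^ 4 - (6 * c + 2) * x\<^sup>2 + 8 * c"

text \<open>\<^const>\<open>Least\<close> is the minimum when it exists, which is shown below.\<close>

definition lambda_hat :: "real \<Rightarrow> int \<Rightarrow> real" where
  "lambda_hat c \<omega> =
     (LEAST y. \<exists>n\<in>UNIV - {0, \<omega>, - \<omega>}. y = p_poly c (real_of_int n / real_of_int \<omega>))"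

lemma lambda_hat_minimum:
  assumes "\<omega> \<ge> 1"
  shows "\<exists>n\<in>UNIV - {0, \<omega>, - \<omega>}. lambda_hat c \<omega> = p_poly c (real_of_int n / real_of_int \<omega>)"
    and "n \<in> UNIV - {0, \<omega>, - \<omega>} \<Longrightarrow> lambda_hat c \<omega> \<le> p_poly c (real_of_int n / real_of_int \<omega>)"
proof -
  define S where "S = UNIV - {0, \<omega>, - \<omega>}"
  define f where "f n = p_poly c (real_of_int n / real_of_int \<omega>)" for n
  define K where "K = \<bar>f (2 * \<omega>) - 8 * c\<bar> + \<bar>3 * c + 1\<bar> + 1"
  have "\<bar>n\<bar> \<le> \<omega> * \<lceil>K\<rceil>" if "f n \<le> f (2 * \<omega>)" for n
  proof (rule ccontr)
    define x where "x = real_of_int n / real_of_int \<omega>"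
    assume "\<not> \<bar>n\<bar> \<le> \<omega> * \<lceil>K\<rceil>"
    then have "real_of_int \<omega> * real_of_int \<lceil>K\<rceil> < \<bar>real_of_int n\<bar>"
      by (metis not_le of_int_abs of_int_less_iff of_int_mult)
    then have "real_of_int \<lceil>K\<rceil> < \<bar>real_of_int n\<bar> / real_of_int \<omega>"
      using assms by (simp add: pos_less_divide_eq mult.commute)
    also have "\<dots> = \<bar>x\<bar>"
      using assms by (simp add: x_def)
    finally have "K < \<bar>x\<bar>"
      by linarith
    moreover have K1: "1 \<le> K"
      by (simp add: K_def)
    ultimately have "K * 1 \<le> \<bar>x\<bar> * \<bar>x\<bar>"
      by (intro mult_mono) auto
    then have Kx: "K \<le> x\<^sup>2"
      by (simp add: power2_eq_square)
    then have "K * 1 \<le> x\<^sup>2 * (x\<^sup>2 - (3 * c + 1))"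
      using K1 by (intro mult_mono) (auto simp: K_def)
    then have "2 * K \<le> f n - 8 * c"
      by (simp add: f_def p_poly_def x_def [symmetric] algebra_simps power2_eq_square power4_eq_xxxx)
    moreover have "f (2 * \<omega>) - 8 * c + 1 \<le> K"
      using abs_ge_self [of "f (2 * \<omega>) - 8 * c"] abs_ge_zero [of "3 * c + 1"]
      unfolding K_def by linarith
    ultimately show False
      using that K1 by linarith
  qed
  then have "{n \<in> S. f n \<le> f (2 * \<omega>)} \<subseteq> {- (\<omega> * \<lceil>K\<rceil>)..\<omega> * \<lceil>K\<rceil>}"
    by fastforce
  then have fin: "finite {n \<in> S. f n \<le> f (2 * \<omega>)}"
    by (rule finite_subset) simp
  have mem: "2 * \<omega> \<in> {n \<in> S. f n \<le> f (2 * \<omega>)}"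
    using assms by (auto simp: S_def)
  obtain m where m: "m \<in> {n \<in> S. f n \<le> f (2 * \<omega>)}"
      and le: "\<And>n. n \<in> {n \<in> S. f n \<le> f (2 * \<omega>)} \<Longrightarrow> f m \<le> f n"
    using fin mem by (metis (lifting) arg_min_least arg_min_if_finite(1) empty_iff)
  have le': "f m \<le> f n" if "n \<in> S" for n
    using le [of n] le [OF mem] that by fastforce
  have "lambda_hat c \<omega> = f m"
    unfolding lambda_hat_def S_def [symmetric] f_def [symmetric]
    using m le' by (intro Least_equality) auto
  then show "\<exists>n\<in>UNIV - {0, \<omega>, - \<omega>}. lambda_hat c \<omega> = p_poly c (real_of_int n / real_of_int \<omega>)"
    and "n \<in> UNIV - {0, \<omega>, - \<omega>} \<Longrightarrow> lambda_hat c \<omega> \<le> p_poly c (real_of_int n / real_of_int \<omega>)"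
    using m le' by (auto simp: S_def f_def)
qed

end

theory Submission
  imports Defs "HOL-Complex_Analysis.Complex_Analysis"
begin

text \<open>
  A circle covered \<open>\<omega>\<close> times stays a circle under the flow. In the time in which its size is
  constant, a perturbation of its radius of curvature by \<open>cos (n \<theta> / \<omega>)\<close>, with \<open>\<theta>\<close> the tangent angle, grows at the rate
  \<open>- p\<^sub>c (n / \<omega>) / 2\<close>. The modes \<open>n = 0\<close> and \<open>n = \<plusminus>\<omega>\<close> come from dilations and translations and do not
  affect the scale invariant quantity \<open>K\<^sub>o\<^sub>s\<^sub>c\<close>. If the minimum of \<open>p\<^sub>c\<close> over the other modes is negative, then the circle
  has an unstable manifold. A solution on it emanates, in this time, from the circle in the infinite past in the direction of the
  fastest mode. Close to the circle, \<open>K\<^sub>o\<^sub>s\<^sub>c\<close> is to leading order a positive multiple of the square of the amplitude of this mode,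
  so along the solution it starts from zero and increases.

  The unstable manifold also yields the existence of the solution. With \<open>x = n / \<omega>\<close> for
  the fastest mode and its rate \<open>\<mu>\<close>, one looks for the rescaled radius of curvature as a series
  \<open>1 + \<Sum> a\<^sub>j\<^sub>k exp ((j + k) \<mu> \<tau> + \<i> (j - k) x \<theta>)\<close>. The flow determines each coefficient from those of lower degree
  \<open>j + k\<close>, up to division by \<open>(j + k) \<mu>\<close> minus the growth rate at the frequency \<open>(j - k) x\<close>. Since the mode is the
  fastest one, these divisors are positive, and they grow with the fourth power of the frequency (\<open>spectral_gap\<close>).
  Thus the division makes up for the four derivatives in the nonlinearity, and for a
  small amplitude the series converges in weighted \<open>l\<^sup>1\<close> spaces (\<open>bnd_next\<close>, \<open>U_flow\<close>). Resonances could only occur at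
  the frequencies \<open>0\<close> and \<open>\<plusminus>1\<close>. The former is removed by rescaling the curve to mean radius of curvature
  one, the latter is absent from the radius of curvature of any closed curve.

  The sum of the series is holomorphic in angle and time, and integrating it gives a family of closed curves that moves by the
  flow up to a tangential velocity (\<open>base_curve\<close>). Passing to the parametrization that moves normally
  (\<open>angle_flow\<close>) and to physical time (\<open>clock\<close>) means solving two ordinary differential equations with holomorphic right-hand
  sides (\<open>hol2_picard\<close>). Everything extends holomorphically to complex times around the initial time, and
  this gives smoothness up to and including the initial time (\<open>hol2_smooth_family\<close>). Finally \<open>K\<^sub>o\<^sub>s\<^sub>c\<close> is \<open>(2 \<pi> \<omega>)\<^sup>2\<close> times the mean over the angle of the
  rescaled curvature minus one (\<open>slice_geometry\<close>), a power series in \<open>exp (2 \<mu> \<tau>)\<close> that starts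
  with a positive linear term (\<open>E_11\<close>, \<open>mean_E_increasing\<close>).
\<close>

section \<open>Holomorphic functions of two variables\<close>

text \<open>
  Continuity together with holomorphy in each variable. This class contains all the functions that make
  up the solution, and it is closed under partial derivatives, so membership already gives smoothness.
\<close>

definition hol2 :: "(complex \<times> complex \<Rightarrow> complex) \<Rightarrow> (complex \<times> complex) set \<Rightarrow> bool" where
  "hol2 f S \<longleftrightarrow> continuous_on S f \<and>
     (\<forall>(a, b)\<in>S. (\<lambda>z. f (z, b)) field_differentiable at a \<and> (\<lambda>w. f (a, w)) field_differentiable at b)"

definition pd1 :: "(complex \<times> complex \<Rightarrow> complex) \<Rightarrow> complex \<times> complex \<Rightarrow> complex" where
  "pd1 f p = deriv (\<lambda>z. f (z, snd p)) (fst p)"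

definition pd2 :: "(complex \<times> complex \<Rightarrow> complex) \<Rightarrow> complex \<times> complex \<Rightarrow> complex" where
  "pd2 f p = deriv (\<lambda>w. f (fst p, w)) (snd p)"

lemma hol2_has_pd1:
  assumes "hol2 f S" "(a, b) \<in> S"
  shows "((\<lambda>z. f (z, b)) has_field_derivative pd1 f (a, b)) (at a)"
  using assms unfolding hol2_def pd1_def by (auto simp: field_differentiable_derivI)

lemma hol2_has_pd2:
  assumes "hol2 f S" "(a, b) \<in> S"
  shows "((\<lambda>w. f (a, w)) has_field_derivative pd2 f (a, b)) (at b)"
  using assms unfolding hol2_def pd2_def by (auto simp: field_differentiable_derivI)

lemma hol2_swap:
  assumes "hol2 f S"
  shows "hol2 (f \<circ> prod.swap) (prod.swap ` S)"
  unfolding hol2_def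
proof (intro conjI)
  have [simp]: "prod.swap ` (prod.swap ` S) = S" by (auto simp: image_image)
  show "continuous_on (prod.swap ` S) (f \<circ> prod.swap)"
    by (rule continuous_on_compose) (use assms in \<open>auto simp: hol2_def intro!: continuous_intros\<close>)
  show "\<forall>(a, b)\<in>prod.swap ` S. (\<lambda>z. (f \<circ> prod.swap) (z, b)) field_differentiable at a \<and>
           (\<lambda>w. (f \<circ> prod.swap) (a, w)) field_differentiable at b"
    using assms unfolding hol2_def by auto
qed

lemma pd1_swap: "pd1 (f \<circ> prod.swap) = pd2 f \<circ> prod.swap"
  by (auto simp: pd1_def pd2_def fun_eq_iff)

lemma open_swap_image: "open S \<Longrightarrow> open (prod.swap ` (S :: ('a::topological_space \<times> 'b::topological_space) set))"
proof -
  assume "open S"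
  have "prod.swap ` S = prod.swap -` S" by (force simp: image_iff)
  moreover have "open (prod.swap -` S)"
    by (rule open_vimage[OF \<open>open S\<close>]) (auto intro!: continuous_intros simp: prod.swap_def)
  ultimately show ?thesis by simp
qed

lemma open_contains_bidisc:
  assumes "open S" "(a, b) \<in> (S :: (complex \<times> complex) set)"
  obtains r where "r > 0" "cball a r \<times> cball b r \<subseteq> S"
proof -
  obtain A B where AB: "open A" "open B" "a \<in> A" "b \<in> B" "A \<times> B \<subseteq> S"
    using assms by (metis open_prod_elim mem_Sigma_iff)
  obtain r1 where "r1 > 0" "cball a r1 \<subseteq> A" using AB open_contains_cball by metis
  moreover obtain r2 where "r2 > 0" "cball b r2 \<subseteq> B" using AB open_contains_cball by metis
  ultimately have "cball a (min r1 r2) \<times> cball b (min r1 r2) \<subseteq> S" "min r1 r2 > 0"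
    using AB by (fastforce simp: subset_iff)+
  then show ?thesis using that by blast
qed

lemma Cauchy_derivative_parametrized:
  assumes "continuous_on (cball z r) f" "f holomorphic_on ball z r" "w \<in> ball z r"
  shows "deriv f w = integral {0..1} (\<lambda>s. f (z + r * exp (2 * pi * \<i> * of_real s)) *
     (r * exp (2 * pi * \<i> * of_real s) / (z + r * exp (2 * pi * \<i> * of_real s) - w)\<^sup>2))"
proof -
  let ?e = "\<lambda>s. r * exp (2 * pi * \<i> * of_real s)"
  have "deriv f w = (1 / (2 * of_real pi * \<i>) * contour_integral (circlepath z r) (\<lambda>u. f u / (u-w)^2))"
    by (rule DERIV_imp_deriv[OF Cauchy_derivative_integral_circlepath(2)[OF assms]])
  also have "contour_integral (circlepath z r) (\<lambda>u. f u / (u-w)^2) =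
    integral {0..1} (\<lambda>s. f (circlepath z r s) / (circlepath z r s - w)^2 * vector_derivative (circlepath z r) (at s))"
    by (simp add: contour_integral_integral)
  also have "\<dots> = integral {0..1} (\<lambda>s. (2 * of_real pi * \<i>) * (f (z + ?e s) * (?e s / (z + ?e s - w)\<^sup>2)))"
    by (rule integral_cong, subst vector_derivative_circlepath) (simp add: circlepath mult_ac)
  also have "\<dots> = (2 * of_real pi * \<i>) * integral {0..1} (\<lambda>s. (f (z + ?e s) * (?e s / (z + ?e s - w)\<^sup>2)))"
    by (rule integral_mult_right)
  finally show ?thesis by simp
qed

lemma circle_point_in_cball: "r > 0 \<Longrightarrow> a + of_real r * exp (2 * of_real pi * \<i> * of_real s) \<in> cball a r"
  by (simp add: dist_norm norm_mult)

lemma circle_point_ne: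
  assumes "r > 0" "w \<in> ball a r"
  shows "a + of_real r * exp (2 * of_real pi * \<i> * of_real s) - w \<noteq> 0"
proof
  assume "a + of_real r * exp (2 * of_real pi * \<i> * of_real s) - w = 0"
  then have "w = a + of_real r * exp (2 * of_real pi * \<i> * of_real s)" by simp
  then have "dist a w = r" using assms(1) by (simp add: dist_norm norm_mult)
  with assms show False by simp
qed

lemma hol2_slice1:
  assumes "hol2 f S" "cball a r \<times> cball b r \<subseteq> S" "y \<in> cball b r"
  shows "continuous_on (cball a r) (\<lambda>z. f (z, y))" "(\<lambda>z. f (z, y)) holomorphic_on ball a r"
proof -
  show "continuous_on (cball a r) (\<lambda>z. f (z, y))"
    by (rule continuous_on_compose2[of S f]) (use assms in \<open>auto simp: hol2_def intro!: continuous_intros\<close>)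
  show "(\<lambda>z. f (z, y)) holomorphic_on ball a r"
    unfolding holomorphic_on_def
    using assms hol2_has_pd1[OF assms(1)]
    by (meson SigmaI ball_subset_cball field_differentiable_at_within field_differentiable_def in_mono)
qed

text \<open>
  Cauchy's formula for the derivative expresses \<^term>\<open>pd1 f\<close> by values of \<^term>\<open>f\<close> on a fixed circle, so that continuity
  and differentiability in the other variable can be read off from those of \<^term>\<open>f\<close> under the integral sign.
\<close>

lemma pd1_Cauchy:
  assumes "hol2 f S" "r > 0" "cball a r \<times> cball b r \<subseteq> S" "x \<in> ball a r" "y \<in> cball b r"
  shows "pd1 f (x, y) = integral (cbox 0 1) (\<lambda>s. f (a + r * exp (2 * pi * \<i> * of_real s), y) *
     (r * exp (2 * pi * \<i> * of_real s) / (a + r * exp (2 * pi * \<i> * of_real s) - x)\<^sup>2))"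
  unfolding pd1_def fst_conv snd_conv box_real
  using Cauchy_derivative_parametrized[OF hol2_slice1[OF assms(1,3,5)] assms(4)] by simp

lemma continuous_on_pd1:
  assumes "open S" "hol2 f S"
  shows "continuous_on S (pd1 f)"
proof -
  have "isCont (pd1 f) (a, b)" if ab: "(a, b) \<in> S" for a b
  proof -
    obtain r where r: "r > 0" "cball a r \<times> cball b r \<subseteq> S"
      using open_contains_bidisc[OF assms(1) ab] .
    let ?e = "\<lambda>s. of_real r * exp (2 * of_real pi * \<i> * of_real s)"
    let ?g = "\<lambda>p (s::real). f (a + ?e s, snd p) * (?e s / (a + ?e s - fst p)\<^sup>2)"
    have "continuous_on (ball a r \<times> ball b r) (\<lambda>p. integral (cbox 0 1) (?g p))"
    proof (rule integral_continuous_on_param)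
      have *: "continuous_on ((ball a r \<times> ball b r) \<times> cbox 0 1) (\<lambda>q. f (a + ?e (snd q), snd (fst q)))"
        by (rule continuous_on_compose2[of S f])
          (use assms r circle_point_in_cball[OF r(1)] in
            \<open>fastforce simp: hol2_def intro!: continuous_intros\<close>)+
      have "(a + ?e (snd q) - fst (fst q)) \<noteq> 0" if "q \<in> (ball a r \<times> ball b r) \<times> cbox 0 1" for q
        using that by (intro circle_point_ne) (use r in auto)
      then show "continuous_on ((ball a r \<times> ball b r) \<times> cbox 0 1) (\<lambda>(p, s). ?g p s)"
        unfolding case_prod_unfold
        by (intro continuous_on_mult[OF *] continuous_intros) (fastforce simp: add_diff_eq)+
    qed
    moreover have "pd1 f p = integral (cbox 0 1) (?g p)" if "p \<in> ball a r \<times> ball b r" for p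
      using pd1_Cauchy[OF assms(2) r, of "fst p" "snd p"] that by auto
    ultimately have "continuous_on (ball a r \<times> ball b r) (pd1 f)"
      by (metis (no_types, lifting) continuous_on_cong)
    moreover have "open (ball a r \<times> ball b r)" "(a, b) \<in> ball a r \<times> ball b r"
      using r by (auto intro: open_Times)
    ultimately show ?thesis
      using continuous_on_eq_continuous_at by blast
  qed
  then show ?thesis
    by (auto intro!: continuous_at_imp_continuous_on)
qed

lemma continuous_on_pd2:
  assumes "open S" "hol2 f S"
  shows "continuous_on S (pd2 f)"
proof -
  have "continuous_on (prod.swap ` S) (pd2 f \<circ> prod.swap)"
    using continuous_on_pd1[OF open_swap_image[OF assms(1)] hol2_swap[OF assms(2)]]
    by (simp add: pd1_swap)
  then have "continuous_on S (\<lambda>p. (pd2 f \<circ> prod.swap) (prod.swap p))"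
    by (rule continuous_on_compose2) (auto intro!: continuous_intros)
  then show ?thesis by simp
qed

text \<open>
  The right-hand side is Cauchy's formula for \<^term>\<open>pd1 (pd2 f)\<close>; besides closing the class under \<^const>\<open>pd1\<close>
  this identifies the two mixed derivatives.
\<close>

lemma pd1_has_pd2:
  assumes "open S" "hol2 f S" "r > 0" "cball a r \<times> cball b r \<subseteq> S" "x \<in> ball a r" "y \<in> ball b r"
  shows "((\<lambda>w. pd1 f (x, w)) has_field_derivative
     integral (cbox 0 1) (\<lambda>s. pd2 f (a + r * exp (2 * pi * \<i> * of_real s), y) *
     (r * exp (2 * pi * \<i> * of_real s) / (a + r * exp (2 * pi * \<i> * of_real s) - x)\<^sup>2))) (at y)"
proof -
  let ?e = "\<lambda>s. of_real r * exp (2 * of_real pi * \<i> * of_real s)"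
  have ne: "(a + ?e s - x) \<noteq> 0" for s
    by (intro circle_point_ne) (use assms in auto)
  have cont: "continuous_on (ball b r \<times> cbox 0 1) (\<lambda>q. g (a + ?e (snd q), fst q))" if "continuous_on S g" for g :: "complex \<times> complex \<Rightarrow> complex"
    by (rule continuous_on_compose2[OF that])
      (use assms circle_point_in_cball[OF assms(3)] in
        \<open>fastforce simp: hol2_def intro!: continuous_intros\<close>)+
  have "((\<lambda>w. integral (cbox 0 1) (\<lambda>s. f (a + ?e s, w) * (?e s / (a + ?e s - x)\<^sup>2))) has_field_derivative
     integral (cbox 0 1) (\<lambda>s. pd2 f (a + ?e s, y) * (?e s / (a + ?e s - x)\<^sup>2))) (at y within ball b r)"
  proof (rule leibniz_rule_field_derivative)
    fix w and s :: real assume w: "w \<in> ball b r"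
    show "((\<lambda>w. f (a + ?e s, w) * (?e s / (a + ?e s - x)\<^sup>2)) has_field_derivative
        pd2 f (a + ?e s, w) * (?e s / (a + ?e s - x)\<^sup>2)) (at w within ball b r)"
      apply (intro DERIV_cmult_right has_field_derivative_at_within[OF hol2_has_pd2[OF assms(2)]])
      using assms(4) w circle_point_in_cball[OF assms(3)] by auto
  next
    fix w assume w: "w \<in> ball b r"
    have "continuous_on (cbox 0 1) (\<lambda>s. f (a + ?e s, w))"
      using continuous_on_compose2[OF cont[of f], of "cbox 0 1" "\<lambda>s. (w, s)"] assms(2) w
      by (simp add: hol2_def continuous_on_Pair image_subset_iff)
    then show "(\<lambda>s. f (a + ?e s, w) * (?e s / (a + ?e s - x)\<^sup>2)) integrable_on cbox 0 1"
      by (intro integrable_continuous continuous_on_mult continuous_intros) (use ne in \<open>auto simp: add_diff_eq\<close>)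
  next
    show "continuous_on (ball b r \<times> cbox 0 1) (\<lambda>(w, s). pd2 f (a + ?e s, w) * (?e s / (a + ?e s - x)\<^sup>2))"
      unfolding case_prod_unfold
      by (intro continuous_on_mult[OF cont[OF continuous_on_pd2[OF assms(1,2)]]] continuous_intros) (use ne in \<open>auto simp: add_diff_eq\<close>)
  qed (use assms in auto)
  then have "((\<lambda>w. integral (cbox 0 1) (\<lambda>s. f (a + ?e s, w) * (?e s / (a + ?e s - x)\<^sup>2))) has_field_derivative
     integral (cbox 0 1) (\<lambda>s. pd2 f (a + ?e s, y) * (?e s / (a + ?e s - x)\<^sup>2))) (at y)"
    by (simp only: at_within_open[OF assms(6) open_ball])
  then show ?thesis
  proof (rule DERIV_cong_ev[THEN iffD1, rotated 3])
    have "\<forall>\<^sub>F w in nhds y. w \<in> ball b r" using assms(6) by (simp only: eventually_nhds_in_open open_ball)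
    then show "\<forall>\<^sub>F w in nhds y. integral (cbox 0 1) (\<lambda>s. f (a + ?e s, w) * (?e s / (a + ?e s - x)\<^sup>2)) = pd1 f (x, w)"
      by eventually_elim (subst pd1_Cauchy[OF assms(2-5)], auto)
  qed auto
qed

lemma hol2_pd1:
  assumes "open S" "hol2 f S"
  shows "hol2 (pd1 f) S"
  unfolding hol2_def
proof (intro conjI, rule continuous_on_pd1[OF assms], clarsimp, intro conjI)
  fix a b assume ab: "(a, b) \<in> S"
  obtain r where r: "r > 0" "cball a r \<times> cball b r \<subseteq> S"
    using open_contains_bidisc[OF assms(1) ab] .
  show "(\<lambda>w. pd1 f (a, w)) field_differentiable at b"
    using pd1_has_pd2[OF assms r, of a b] r field_differentiable_def by fastforce
  have "(\<lambda>z. f (z, b)) holomorphic_on ball a r" using hol2_slice1(2)[OF assms(2) r(2)] r by simp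
  then have "deriv (\<lambda>z. f (z, b)) holomorphic_on ball a r"
    by (rule holomorphic_deriv) auto
  then show "(\<lambda>z. pd1 f (z, b)) field_differentiable at a"
    unfolding pd1_def using r by (simp add: holomorphic_on_imp_differentiable_at)
qed

lemma hol2_pd2:
  assumes "open S" "hol2 f S"
  shows "hol2 (pd2 f) S"
proof -
  have "hol2 (pd2 f \<circ> prod.swap) (prod.swap ` S)"
    using hol2_pd1[OF open_swap_image[OF assms(1)] hol2_swap[OF assms(2)]] by (simp add: pd1_swap)
  from hol2_swap[OF this] show ?thesis by (simp add: o_def image_image)
qed

lemma pd2_pd1_commute:
  assumes "open S" "hol2 f S" "p \<in> S"
  shows "pd2 (pd1 f) p = pd1 (pd2 f) p"
proof -
  obtain a b where ab: "p = (a, b)" by force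
  obtain r where r: "r > 0" "cball a r \<times> cball b r \<subseteq> S"
    using open_contains_bidisc[OF assms(1), of a b] assms ab by auto
  have "pd2 (pd1 f) (a, b) = integral (cbox 0 1) (\<lambda>s. pd2 f (a + r * exp (2 * pi * \<i> * of_real s), b) *
     (r * exp (2 * pi * \<i> * of_real s) / (a + r * exp (2 * pi * \<i> * of_real s) - a)\<^sup>2))"
    using DERIV_imp_deriv[OF pd1_has_pd2[OF assms(1,2) r, of a b]] r by (simp add: pd2_def)
  also have "\<dots> = pd1 (pd2 f) (a, b)"
    by (rule pd1_Cauchy[OF hol2_pd2[OF assms(1,2)] r, symmetric]) (use r in auto)
  finally show ?thesis using ab by simp
qed

lemma hol2_subset: "hol2 f S \<Longrightarrow> T \<subseteq> S \<Longrightarrow> hol2 f T"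
  unfolding hol2_def by (auto intro: continuous_on_subset)

text \<open>
  Values on an open set determine the partial derivatives there.
\<close>

lemma pd_cong:
  assumes "open S" "\<And>p. p \<in> S \<Longrightarrow> f p = g p" "p \<in> S"
  shows "pd1 f p = pd1 g p" "pd2 f p = pd2 g p"
proof -
  obtain a b where ab: "p = (a, b)" by force
  obtain r where r: "r > 0" "cball a r \<times> cball b r \<subseteq> S"
    using open_contains_bidisc[OF assms(1), of a b] assms ab by auto
  have "\<forall>\<^sub>F w in nhds a. w \<in> ball a r" "\<forall>\<^sub>F w in nhds b. w \<in> ball b r"
    using r by (simp_all only: eventually_nhds_in_open open_ball centre_in_ball)
  then show "pd1 f p = pd1 g p" "pd2 f p = pd2 g p"
    unfolding pd1_def pd2_def ab using r
    by (auto intro!: deriv_cong_ev assms(2) elim!: eventually_mono)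
qed

text \<open>
  The partial derivatives are continuous, hence the function is differentiable jointly; this is what
  makes the chain rule available.
\<close>

lemma hol2_has_derivative:
  assumes "open S" "hol2 f S" "(a, b) \<in> S"
  shows "(f has_derivative (\<lambda>(s, t). pd1 f (a, b) * s + pd2 f (a, b) * t)) (at (a, b))"
proof -
  obtain r where r: "r > 0" "cball a r \<times> cball b r \<subseteq> S"
    using open_contains_bidisc[OF assms(1) assms(3)] .
  have in_S: "(x, y) \<in> S" if "x \<in> ball a r" "y \<in> ball b r" for x y
    using that r by (auto simp: subset_iff)
  have ab: "a \<in> ball a r" "b \<in> ball b r" using r by auto
  have "((\<lambda>(x, y). f (x, y)) has_derivative (\<lambda>(s, t). pd1 f (a, b) * s + blinfun_mult_right (pd2 f (a, b)) t))
      (at (a, b) within ball a r \<times> ball b r)"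
  proof (rule has_derivative_partialsI)
    show "((\<lambda>x. f (x, b)) has_derivative (*) (pd1 f (a, b))) (at a within ball a r)"
      using hol2_has_pd1[OF assms(2,3)]
      by (simp add: has_field_derivative_def has_derivative_at_withinI)
    show "((\<lambda>y. f (x, y)) has_derivative blinfun_apply (blinfun_mult_right (pd2 f (x, y)))) (at y within ball b r)"
      if "x \<in> ball a r" "y \<in> ball b r" for x y
      using hol2_has_pd2[OF assms(2) in_S[OF that]]
      by (simp add: has_field_derivative_def has_derivative_at_withinI)
    have "continuous_on (ball a r \<times> ball b r) (\<lambda>p. pd2 f p)"
      by (rule continuous_on_subset[OF continuous_on_pd2[OF assms(1,2)]]) (use in_S in auto)
    then have "continuous_on (ball a r \<times> ball b r) (\<lambda>p. blinfun_mult_right (pd2 f p))"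
      by (intro continuous_intros)
    then show "continuous (at (a, b) within ball a r \<times> ball b r) (\<lambda>(x, y). blinfun_mult_right (pd2 f (x, y)))"
      using ab by (simp add: continuous_on_eq_continuous_within case_prod_unfold)
  qed (use ab in auto)
  moreover have "open (ball a r \<times> ball b r)" "(a, b) \<in> ball a r \<times> ball b r"
    using r by (auto intro: open_Times)
  ultimately show ?thesis
    using at_within_open[of "(a, b)" "ball a r \<times> ball b r"] by (simp add: case_prod_unfold)
qed

lemma hol2_chain:
  assumes "open S" "hol2 f S" "(g z, h z) \<in> S"
    and g: "(g has_field_derivative g') (at z within X)" and h: "(h has_field_derivative h') (at z within X)"
  shows "((\<lambda>z. f (g z, h z)) has_field_derivative (pd1 f (g z, h z) * g' + pd2 f (g z, h z) * h')) (at z within X)"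
proof -
  have "((\<lambda>z. (g z, h z)) has_derivative (\<lambda>s. (g' * s, h' * s))) (at z within X)"
    using g h unfolding has_field_derivative_def by (intro has_derivative_Pair)
  from diff_chain_within[OF this has_derivative_at_withinI[OF hol2_has_derivative[OF assms(1-3)]]]
  show ?thesis
    unfolding has_field_derivative_def o_def
    by (rule has_derivative_eq_rhs) (simp add: fun_eq_iff ring_distribs mult_ac)
qed

lemma hol2_compose:
  assumes "open S" "hol2 f S" "hol2 g S'" "hol2 h S'" "\<And>p. p \<in> S' \<Longrightarrow> (g p, h p) \<in> S"
  shows "hol2 (\<lambda>p. f (g p, h p)) S'"
  unfolding hol2_def
proof (intro conjI)
  show "continuous_on S' (\<lambda>p. f (g p, h p))"
    by (rule continuous_on_compose2[of S f]) (use assms in \<open>auto simp: hol2_def intro!: continuous_intros\<close>)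
  show "\<forall>(a, b)\<in>S'. (\<lambda>z. f (g (z, b), h (z, b))) field_differentiable at a \<and>
     (\<lambda>w. f (g (a, w), h (a, w))) field_differentiable at b"
  proof (clarify, intro conjI)
    fix a b assume ab: "(a, b) \<in> S'"
    show "(\<lambda>z. f (g (z, b), h (z, b))) field_differentiable at a"
      unfolding field_differentiable_def
      using hol2_chain[OF assms(1,2) assms(5)[OF ab] hol2_has_pd1[OF assms(3) ab] hol2_has_pd1[OF assms(4) ab]] by blast
    show "(\<lambda>w. f (g (a, w), h (a, w))) field_differentiable at b"
      unfolding field_differentiable_def
      using hol2_chain[OF assms(1,2) assms(5)[OF ab] hol2_has_pd2[OF assms(3) ab] hol2_has_pd2[OF assms(4) ab]] by blast
  qed
qed

lemma hol2_fst: "hol2 fst S" and hol2_snd: "hol2 snd S" and hol2_const: "hol2 (\<lambda>_. k) S"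
  by (auto simp: hol2_def intro!: continuous_intros derivative_intros)

lemma hol2_holomorphic_compose:
  assumes "open X" "f holomorphic_on X" "hol2 g S" "\<And>p. p \<in> S \<Longrightarrow> g p \<in> X"
  shows "hol2 (\<lambda>p. f (g p)) S"
proof -
  have d: "f field_differentiable at z" if "z \<in> X" for z using assms that holomorphic_on_imp_differentiable_at by blast
  show ?thesis
    unfolding hol2_def
  proof (intro conjI)
    show "continuous_on S (\<lambda>p. f (g p))"
      by (rule continuous_on_compose2[OF holomorphic_on_imp_continuous_on[OF assms(2)]])
        (use assms in \<open>auto simp: hol2_def\<close>)
    show "\<forall>(a, b)\<in>S. (\<lambda>z. f (g (z, b))) field_differentiable at a \<and> (\<lambda>w. f (g (a, w))) field_differentiable at b"
      using assms(3,4) d field_differentiable_compose[of "\<lambda>z. g (z, _)" _ f] field_differentiable_compose[of "\<lambda>z. g (_, z)" _ f]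
      by (fastforce simp: hol2_def o_def)
  qed
qed

lemma hol2_add: "hol2 f S \<Longrightarrow> hol2 g S \<Longrightarrow> hol2 (\<lambda>p. f p + g p) S"
  and hol2_mult: "hol2 f S \<Longrightarrow> hol2 g S \<Longrightarrow> hol2 (\<lambda>p. f p * g p) S"
  and hol2_minus: "hol2 f S \<Longrightarrow> hol2 (\<lambda>p. - f p) S"
  by (auto simp: hol2_def intro!: continuous_intros derivative_intros)

lemma hol2_inverse: "hol2 f S \<Longrightarrow> (\<And>p. p \<in> S \<Longrightarrow> f p \<noteq> 0) \<Longrightarrow> hol2 (\<lambda>p. inverse (f p)) S"
  by (auto simp: hol2_def intro!: continuous_intros derivative_intros)

lemma hol2_exp: "hol2 f S \<Longrightarrow> hol2 (\<lambda>p. exp (f p)) S"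
  by (rule hol2_holomorphic_compose[of UNIV]) (auto intro!: holomorphic_intros)

lemmas hol2_intros = hol2_fst hol2_snd hol2_const hol2_add hol2_mult hol2_minus hol2_exp

lemma hol2_funpow: "open S \<Longrightarrow> hol2 f S \<Longrightarrow> hol2 ((pd1 ^^ i) ((pd2 ^^ j) f)) S"
proof -
  assume S: "open S" "hol2 f S"
  have "hol2 ((pd2 ^^ j) f) S" by (induction j) (use S hol2_pd2 in auto)
  then show ?thesis by (induction i) (use S hol2_pd1 in auto)
qed

lemma pd2_funpow_pd1:
  assumes "open S" "hol2 f S" "p \<in> S"
  shows "pd2 ((pd1 ^^ i) f) p = (pd1 ^^ i) (pd2 f) p"
  using assms(3)
proof (induction i arbitrary: p)
  case (Suc i)
  have h: "hol2 ((pd1 ^^ i) f) S" using hol2_funpow[OF assms(1,2), of i 0] by simp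
  have "pd2 ((pd1 ^^ Suc i) f) p = pd1 (pd2 ((pd1 ^^ i) f)) p"
    using pd2_pd1_commute[OF assms(1) h Suc.prems] by simp
  also have "\<dots> = pd1 ((pd1 ^^ i) (pd2 f)) p"
    by (rule pd_cong[OF assms(1) Suc.IH Suc.prems])
  finally show ?case by simp
qed auto

lemma has_field_derivative_of_real_within:
  assumes "(f has_field_derivative D) (at (complex_of_real x))"
  shows "((\<lambda>v. f (complex_of_real v)) has_vector_derivative D) (at x within X)"
proof -
  have "(complex_of_real has_vector_derivative 1) (at x within X)"
    using has_vector_derivative_of_real[OF DERIV_ident] by simp
  from field_vector_diff_chain_within[OF this has_field_derivative_at_within[OF assms]]
  show ?thesis by (simp add: o_def)
qed

text \<open>
  The real restriction of a function of the class is smooth up to the initial time, because the initial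
  time is an interior point of the complex domain.
\<close>

lemma hol2_smooth_family:
  assumes "open S" "hol2 f S" "\<And>u t. t \<in> time_interval T \<Longrightarrow> (complex_of_real u, complex_of_real t) \<in> S"
  shows "smooth_family T (\<lambda>u t. f (of_real u, of_real t))"
  unfolding smooth_family_def
proof (intro exI[of _ "\<lambda>i j u t. (pd1 ^^ i) ((pd2 ^^ j) f) (of_real u, of_real t)"] conjI allI ballI)
  fix i j
  show "continuous_on (UNIV \<times> time_interval T) (\<lambda>(u, t). (pd1 ^^ i) ((pd2 ^^ j) f) (complex_of_real u, complex_of_real t))"
    unfolding case_prod_unfold
    by (rule continuous_on_compose2[of S "(pd1 ^^ i) ((pd2 ^^ j) f)"])
      (use hol2_funpow[OF assms(1,2)] assms(3) in \<open>auto simp: hol2_def intro!: continuous_intros\<close>)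
  fix u t assume t: "t \<in> time_interval T"
  note h = hol2_funpow[OF assms(1,2), of i j]
  show "((\<lambda>v. (pd1 ^^ i) ((pd2 ^^ j) f) (complex_of_real v, complex_of_real t)) has_vector_derivative
        (pd1 ^^ Suc i) ((pd2 ^^ j) f) (complex_of_real u, complex_of_real t)) (at u)"
    using has_field_derivative_of_real_within[OF hol2_has_pd1[OF h assms(3)[OF t]]] by simp
  have "hol2 ((pd2 ^^ j) f) S" using hol2_funpow[OF assms(1,2), of 0 j] by simp
  from pd2_funpow_pd1[OF assms(1) this assms(3)[OF t], of i u]
  show "((\<lambda>r. (pd1 ^^ i) ((pd2 ^^ j) f) (complex_of_real u, complex_of_real r)) has_vector_derivative
        (pd1 ^^ i) ((pd2 ^^ Suc j) f) (complex_of_real u, complex_of_real t)) (at t within time_interval T)"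
    using has_field_derivative_of_real_within[OF hol2_has_pd2[OF h assms(3)[OF t, of u]]] by simp
qed simp

section \<open>Holomorphic ordinary differential equations\<close>

text \<open>
  By Cauchy's estimate, uniform limits commute with the partial derivatives. The filter is general since
  the lemma serves both the Picard iterates and the unordered sums of a double series.
\<close>

lemma hol2_uniform_limit:
  assumes "open S" "\<And>n. hol2 (f n) S" "uniform_limit S f g F" "F \<noteq> bot"
  shows "hol2 g S"
    and "p \<in> S \<Longrightarrow> ((\<lambda>n. pd1 (f n) p) \<longlongrightarrow> pd1 g p) F"
    and "p \<in> S \<Longrightarrow> ((\<lambda>n. pd2 (f n) p) \<longlongrightarrow> pd2 g p) F"
proof -
  have slice: "((\<lambda>z. g (z, b)) has_field_derivative pd1 g (a, b)) (at a) \<and> ((\<lambda>n. pd1 (f n) (a, b)) \<longlongrightarrow> pd1 g (a, b)) F \<and>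
      ((\<lambda>w. g (a, w)) has_field_derivative pd2 g (a, b)) (at b) \<and> ((\<lambda>n. pd2 (f n) (a, b)) \<longlongrightarrow> pd2 g (a, b)) F"
    if ab: "(a, b) \<in> S" for a b
  proof -
    obtain r where r: "r > 0" "cball a r \<times> cball b r \<subseteq> S"
      using open_contains_bidisc[OF assms(1) ab] .
    have in_S: "(z, w) \<in> S" if "z \<in> cball a r" "w \<in> cball b r" for z w
      using that r by auto
    have cont: "continuous_on S (f n)" for n using assms(2) by (auto simp: hol2_def)
    obtain g1 where g1: "\<And>w. w \<in> ball a r \<Longrightarrow> ((\<lambda>z. g (z, b)) has_field_derivative (g1 w)) (at w) \<and> ((\<lambda>n. pd1 (f n) (w, b)) \<longlongrightarrow> g1 w) F"
    proof (rule has_complex_derivative_uniform_limit[of a r "\<lambda>n z. f n (z, b)" "\<lambda>n z. pd1 (f n) (z, b)" F "\<lambda>z. g (z, b)"])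
      show "\<forall>\<^sub>F n in F. continuous_on (cball a r) (\<lambda>z. f n (z, b)) \<and>
         (\<forall>w\<in>ball a r. ((\<lambda>z. f n (z, b)) has_field_derivative pd1 (f n) (w, b)) (at w))"
        using hol2_slice1(1)[OF assms(2) r(2), of b] hol2_has_pd1[OF assms(2) in_S, of _ b] r(1) by (intro always_eventually) auto
      show "uniform_limit (cball a r) (\<lambda>n z. f n (z, b)) (\<lambda>z. g (z, b)) F"
        using assms(3) in_S[of _ b] r(1) unfolding uniform_limit_iff by (auto elim!: all_forward eventually_mono)
    qed (use assms r in auto)
    obtain g2 where g2: "\<And>w. w \<in> ball b r \<Longrightarrow> ((\<lambda>z. g (a, z)) has_field_derivative (g2 w)) (at w) \<and> ((\<lambda>n. pd2 (f n) (a, w)) \<longlongrightarrow> g2 w) F"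
    proof (rule has_complex_derivative_uniform_limit[of b r "\<lambda>n z. f n (a, z)" "\<lambda>n z. pd2 (f n) (a, z)" F "\<lambda>z. g (a, z)"])
      have "continuous_on (cball b r) (\<lambda>z. f n (a, z))" for n
        by (rule continuous_on_compose2[OF cont]) (use in_S[of a] r(1) in \<open>auto intro!: continuous_intros\<close>)
      then show "\<forall>\<^sub>F n in F. continuous_on (cball b r) (\<lambda>z. f n (a, z)) \<and>
         (\<forall>w\<in>ball b r. ((\<lambda>z. f n (a, z)) has_field_derivative pd2 (f n) (a, w)) (at w))"
        using hol2_has_pd2[OF assms(2) in_S, of a] r(1) by (intro always_eventually) auto
      show "uniform_limit (cball b r) (\<lambda>n z. f n (a, z)) (\<lambda>z. g (a, z)) F"
        using assms(3) in_S[of a] r(1) unfolding uniform_limit_iff by (auto elim!: all_forward eventually_mono)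
    qed (use assms r in auto)
    have "g1 a = pd1 g (a, b)" "g2 b = pd2 g (a, b)"
      using g1[of a] g2[of b] r(1) by (auto simp: pd1_def pd2_def DERIV_imp_deriv)
    then show ?thesis using g1[of a] g2[of b] r(1) by auto
  qed
  have "continuous_on S g"
    by (rule uniform_limit_theorem[OF _ assms(3,4)])
      (use assms(2) in \<open>auto simp: hol2_def\<close>)
  then show "hol2 g S" using slice unfolding hol2_def field_differentiable_def by blast
  show "p \<in> S \<Longrightarrow> ((\<lambda>n. pd1 (f n) p) \<longlongrightarrow> pd1 g p) F" using slice by (cases p) auto
  show "p \<in> S \<Longrightarrow> ((\<lambda>n. pd2 (f n) p) \<longlongrightarrow> pd2 g p) F" using slice by (cases p) auto
qed

text \<open>
  The integral of \<^term>\<open>g (x, s)\<close> over the segment from \<^term>\<open>t\<^sub>0\<close> to \<^term>\<open>t\<close>, pulled back to \<open>[0,1]\<close> so that the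
  dependence on the endpoint \<^term>\<open>t\<close> sits in the integrand.
\<close>

definition time_integral :: "complex \<Rightarrow> (complex \<times> complex \<Rightarrow> complex) \<Rightarrow> complex \<times> complex \<Rightarrow> complex" where
  "time_integral t\<^sub>0 g p = integral {0..1} (\<lambda>s::real. g (fst p, t\<^sub>0 + of_real s * (snd p - t\<^sub>0)) * (snd p - t\<^sub>0))"

lemma segment_in_ball:
  assumes "t \<in> ball t0 \<delta>" "s \<in> {0..1::real}"
  shows "t0 + of_real s * (t - t0) \<in> ball (t0::complex) \<delta>"
proof -
  have "norm (of_real s * (t - t0)) \<le> 1 * norm (t - t0)"
    unfolding norm_mult by (rule mult_right_mono) (use assms(2) in auto)
  then show ?thesis using assms(1) by (simp add: dist_norm norm_minus_commute)
qed

lemma continuous_on_segment: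
  fixes t t0 :: complex and g :: "complex \<times> complex \<Rightarrow> complex"
  assumes "continuous_on (X \<times> ball t0 \<delta>) g" "x \<in> X" "t \<in> ball t0 \<delta>"
  shows "continuous_on {0..1} (\<lambda>s::real. g (x, t0 + of_real s * (t - t0)) * (t - t0))"
  by (intro continuous_on_mult continuous_on_compose2[OF assms(1)] continuous_intros)
    (use assms(2) segment_in_ball[OF assms(3)] in auto)

lemma hol2_time_integral:
  assumes "open X" "hol2 g (X \<times> ball t0 \<delta>)"
  shows "hol2 (time_integral t0 g) (X \<times> ball t0 \<delta>)" (is ?th1)
    and "x \<in> X \<Longrightarrow> t \<in> ball t0 \<delta> \<Longrightarrow>
      ((\<lambda>s. time_integral t0 g (x, s)) has_field_derivative g (x, t)) (at t)"
proof -
  have opS: "open (X \<times> ball t0 \<delta>)" using assms(1) by (intro open_Times) auto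
  have contg: "continuous_on (X \<times> ball t0 \<delta>) g" using assms(2) by (simp add: hol2_def)
  have dt: "((\<lambda>s. time_integral t0 g (x, s)) has_field_derivative g (x, t)) (at t)"
    if x: "x \<in> X" and t: "t \<in> ball t0 \<delta>" for x t
  proof -
    \<comment> \<open>the time derivative comes from a primitive in \<open>s\<close>, which exists on the disc\<close>
    have "(\<lambda>s. g (x, s)) holomorphic_on ball t0 \<delta>"
      using hol2_has_pd2[OF assms(2), of x] x unfolding holomorphic_on_open[OF open_ball] by blast
    then obtain G where G: "\<And>s. s \<in> ball t0 \<delta> \<Longrightarrow> (G has_field_derivative g (x, s)) (at s within ball t0 \<delta>)"
      using holomorphic_convex_primitive'[of "ball t0 \<delta>" "\<lambda>s. g (x, s)"] by auto
    have G: "(G has_field_derivative g (x, s)) (at s)" if "s \<in> ball t0 \<delta>" for s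
      using G[OF that] by (simp only: at_within_open[OF that open_ball])
    have eq: "time_integral t0 g (x, s) = G s - G t0" if s: "s \<in> ball t0 \<delta>" for s
    proof -
      have "((\<lambda>v::real. g (x, t0 + of_real v * (s - t0)) * (s - t0)) has_integral
         G (t0 + of_real 1 * (s - t0)) - G (t0 + of_real 0 * (s - t0))) {0..1}"
      proof (rule fundamental_theorem_of_calculus)
        fix v :: real assume v: "v \<in> {0..1}"
        have "((\<lambda>v. G (t0 + v * (s - t0))) has_field_derivative g (x, t0 + of_real v * (s - t0)) * (s - t0)) (at (of_real v))"
          by (rule DERIV_chain2[where f = G and g = "\<lambda>v. t0 + v * (s - t0)", OF G[OF segment_in_ball[OF s v]]]) (auto intro!: derivative_eq_intros)
        then show "((\<lambda>v::real. G (t0 + of_real v * (s - t0))) has_vector_derivative g (x, t0 + of_real v * (s - t0)) * (s - t0)) (at v within {0..1})"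
          by (rule has_field_derivative_of_real_within)
      qed auto
      from integral_unique[OF this] show ?thesis unfolding time_integral_def fst_conv snd_conv by simp
    qed
    have "((\<lambda>s. G s - G t0) has_field_derivative g (x, t)) (at t)"
      using G[OF t] by (auto intro!: derivative_eq_intros)
    then show ?thesis
      by (rule has_field_derivative_transform_within_open[OF _ open_ball t]) (simp add: eq)
  qed
  then show "x \<in> X \<Longrightarrow> t \<in> ball t0 \<delta> \<Longrightarrow> ((\<lambda>s. time_integral t0 g (x, s)) has_field_derivative g (x, t)) (at t)" .
  have dx: "(\<lambda>z. time_integral t0 g (z, t)) field_differentiable at x"
    if x: "x \<in> X" and t: "t \<in> ball t0 \<delta>" for x t
  proof -
    obtain r where r: "r > 0" "ball x r \<subseteq> X" using assms(1) x openE by blast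
    have "((\<lambda>z. integral (cbox 0 1) (\<lambda>s::real. g (z, t0 + of_real s * (t - t0)) * (t - t0))) has_field_derivative
       integral (cbox 0 1) (\<lambda>s::real. pd1 g (x, t0 + of_real s * (t - t0)) * (t - t0))) (at x within ball x r)"
    proof (rule leibniz_rule_field_derivative)
      fix z and s :: real assume z: "z \<in> ball x r" and s: "s \<in> cbox 0 1"
      show "((\<lambda>z. g (z, t0 + of_real s * (t - t0)) * (t - t0)) has_field_derivative pd1 g (z, t0 + of_real s * (t - t0)) * (t - t0)) (at z within ball x r)"
        by (intro DERIV_cmult_right has_field_derivative_at_within[OF hol2_has_pd1[OF assms(2)]])
          (use segment_in_ball[OF t] z s r in auto)
    next
      fix z assume z: "z \<in> ball x r"
      show "(\<lambda>s::real. g (z, t0 + of_real s * (t - t0)) * (t - t0)) integrable_on cbox 0 1"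
        unfolding box_real
        by (rule integrable_continuous_real[OF continuous_on_segment[OF contg _ t]]) (use z r in auto)
    next
      show "continuous_on (ball x r \<times> cbox 0 1) (\<lambda>(z, s::real). pd1 g (z, t0 + of_real s * (t - t0)) * (t - t0))"
        unfolding case_prod_unfold
        by (intro continuous_on_mult continuous_on_compose2[OF continuous_on_pd1[OF opS assms(2)]] continuous_intros)
          (use segment_in_ball[OF t] r in auto)
    qed (use r in auto)
    then show ?thesis
      using at_within_open[of x "ball x r"] r unfolding time_integral_def fst_conv snd_conv box_real
      by (auto simp: field_differentiable_def)
  qed
  have "continuous_on (X \<times> ball t0 \<delta>) (\<lambda>p. integral (cbox 0 1) (\<lambda>s::real. g (fst p, t0 + of_real s * (snd p - t0)) * (snd p - t0)))"
  proof (rule integral_continuous_on_param)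
    show "continuous_on ((X \<times> ball t0 \<delta>) \<times> cbox 0 1) (\<lambda>(p, s::real). g (fst p, t0 + of_real s * (snd p - t0)) * (snd p - t0))"
      unfolding case_prod_unfold
      by (intro continuous_on_mult continuous_on_compose2[OF contg] continuous_intros)
        (use segment_in_ball in \<open>auto simp del: mem_ball\<close>)
  qed
  then have cont: "continuous_on (X \<times> ball t0 \<delta>) (time_integral t0 g)"
    unfolding time_integral_def box_real by simp
  show ?th1
    unfolding hol2_def using cont dx dt field_differentiable_def by blast
qed

lemma time_integral_diff_bound:
  assumes "continuous_on (X \<times> ball t0 \<delta>) g" "continuous_on (X \<times> ball t0 \<delta>) h" "x \<in> X" "t \<in> ball t0 \<delta>"
    and "\<And>s. s \<in> ball t0 \<delta> \<Longrightarrow> norm (g (x, s) - h (x, s)) \<le> B"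
  shows "norm (time_integral t0 g (x, t) - time_integral t0 h (x, t)) \<le> B * norm (t - t0)"
proof -
  note c = continuous_on_segment[OF assms(1,3,4)] continuous_on_segment[OF assms(2,3,4)]
  have "time_integral t0 g (x, t) - time_integral t0 h (x, t) =
      integral {0..1} (\<lambda>s::real. g (x, t0 + of_real s * (t - t0)) * (t - t0) - h (x, t0 + of_real s * (t - t0)) * (t - t0))"
    unfolding time_integral_def fst_conv snd_conv
    by (rule integral_diff[symmetric]; rule integrable_continuous_real; rule c)
  also have "norm \<dots> \<le> (B * norm (t - t0)) * (1 - 0)"
  proof (rule integral_bound)
    show "norm (g (x, t0 + of_real s * (t - t0)) * (t - t0) - h (x, t0 + of_real s * (t - t0)) * (t - t0)) \<le> B * norm (t - t0)"
      if "s \<in> {0..1}" for s :: real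
      unfolding left_diff_distrib[symmetric] norm_mult
      by (rule mult_right_mono[OF assms(5)[OF segment_in_ball[OF assms(4) that]]]) simp
  qed (auto intro!: continuous_on_diff c)
  finally show ?thesis by simp
qed

lemma time_integral_Reals:
  assumes "continuous_on (X \<times> ball t0 \<delta>) g" "x \<in> X" "t \<in> ball t0 \<delta>" "t0 \<in> \<real>" "t \<in> \<real>"
    and "\<And>s. s \<in> ball t0 \<delta> \<Longrightarrow> s \<in> \<real> \<Longrightarrow> g (x, s) \<in> \<real>"
  shows "time_integral t0 g (x, t) \<in> \<real>"
proof -
  let ?h = "\<lambda>s::real. g (x, t0 + of_real s * (t - t0)) * (t - t0)"
  have "?h integrable_on {0..1}"
    by (rule integrable_continuous_real[OF continuous_on_segment[OF assms(1-3)]])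
  then have "Im (integral {0..1} ?h) = integral {0..1} (Im \<circ> ?h)"
    by (rule integral_linear[symmetric]) (rule bounded_linear_Im)
  also have "\<dots> = integral {0..1} (\<lambda>_::real. 0)"
  proof (rule integral_cong)
    fix s :: real assume "s \<in> {0..1}"
    then have "?h s \<in> \<real>"
      using assms segment_in_ball[OF assms(3)] by (intro Reals_mult assms(6)) auto
    then show "(Im \<circ> ?h) s = 0" by (simp add: complex_is_Real_iff)
  qed
  finally show ?thesis by (simp add: time_integral_def complex_is_Real_iff)
qed

text \<open>
  Cauchy's estimate on a disc of radius \<^term>\<open>d\<close> turns the bound on \<^term>\<open>f\<close> into a Lipschitz constant.
\<close>

lemma picard_Lipschitz:
  assumes "hol2 f (P \<times> T)" "t \<in> T" "cball x (2 * d) \<subseteq> P" "0 < d"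
    and bound: "\<And>p. p \<in> P \<times> T \<Longrightarrow> norm (f p) \<le> M"
    and "u \<in> cball x d" "v \<in> cball x d"
  shows "norm (f (u, t) - f (v, t)) \<le> M / d * norm (u - v)"
proof (rule field_differentiable_bound[of "cball x d" "\<lambda>z. f (z, t)" "\<lambda>z. pd1 f (z, t)"])
  fix w assume w: "w \<in> cball x d"
  have sub: "cball w d \<subseteq> P"
  proof
    fix z assume "z \<in> cball w d"
    then have "dist x z \<le> 2 * d" using w dist_triangle[of x z w] by auto
    then show "z \<in> P" using assms(3) by auto
  qed
  have d1: "((\<lambda>z. f (z, t)) has_field_derivative pd1 f (z, t)) (at z)" if "z \<in> P" for z
    using hol2_has_pd1[OF assms(1), of z t] that assms(2) by auto
  have "w \<in> P" using sub assms(4) by auto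
  then show "((\<lambda>z. f (z, t)) has_field_derivative pd1 f (w, t)) (at w within cball x d)"
    by (rule has_field_derivative_at_within[OF d1])
  have hol: "(\<lambda>z. f (z, t)) holomorphic_on cball w d"
    unfolding holomorphic_on_def field_differentiable_def
    using d1 sub by (blast intro: has_field_derivative_at_within)
  have "norm ((deriv ^^ 1) (\<lambda>z. f (z, t)) w) \<le> fact 1 * M / d ^ 1"
    by (rule Cauchy_inequality)
      (use hol holomorphic_on_imp_continuous_on[OF hol] holomorphic_on_subset[OF hol ball_subset_cball] assms sub
        in \<open>auto intro!: bound simp: dist_norm subset_iff\<close>)
  then show "norm (pd1 f (w, t)) \<le> M / d" by (simp add: pd1_def)
qed (use assms in auto)

text \<open>
  Picard iteration from the identity stays within distance \<^term>\<open>d\<close> of the initial value and contracts by the factor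
  \<open>1/2\<close> once the time disc has radius at most \<open>d / (2 M)\<close>. All iterates are in the class, hence so is
  the limit: the flow depends holomorphically on time and initial value at once. The last two conclusions hold for every
  iterate and pass to the limit; they will give a real closed curve.
\<close>

lemma hol2_picard:
  fixes f :: "complex \<times> complex \<Rightarrow> complex"
  assumes "open P" "open X" and f: "hol2 f (P \<times> ball t0 \<eta>)" and pos: "0 < \<eta>" "0 < d" "0 < M"
    and sub: "\<And>x. x \<in> X \<Longrightarrow> cball x (2 * d) \<subseteq> P"
    and bound: "\<And>p. p \<in> P \<times> ball t0 \<eta> \<Longrightarrow> norm (f p) \<le> M"
  obtains \<delta> \<phi> where "0 < \<delta>" "\<delta> \<le> \<eta>" "hol2 \<phi> (X \<times> ball t0 \<delta>)"
    and "\<And>x. x \<in> X \<Longrightarrow> \<phi> (x, t0) = x"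
    and "\<And>x t. x \<in> X \<Longrightarrow> t \<in> ball t0 \<delta> \<Longrightarrow> norm (\<phi> (x, t) - x) \<le> M * norm (t - t0)"
    and "\<And>x t. x \<in> X \<Longrightarrow> t \<in> ball t0 \<delta> \<Longrightarrow> \<phi> (x, t) \<in> cball x d"
    and "\<And>x t. x \<in> X \<Longrightarrow> t \<in> ball t0 \<delta> \<Longrightarrow>
        ((\<lambda>s. \<phi> (x, s)) has_field_derivative f (\<phi> (x, t), t)) (at t)"
    and "\<And>q x t. (\<And>x t. x \<in> P \<Longrightarrow> t \<in> ball t0 \<eta> \<Longrightarrow> f (x + q, t) = f (x, t)) \<Longrightarrow>
        x \<in> X \<Longrightarrow> x + q \<in> X \<Longrightarrow> t \<in> ball t0 \<delta> \<Longrightarrow> \<phi> (x + q, t) = \<phi> (x, t) + q"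
    and "\<And>x t. (\<And>x t. x \<in> P \<Longrightarrow> t \<in> ball t0 \<eta> \<Longrightarrow> x \<in> \<real> \<Longrightarrow> t \<in> \<real> \<Longrightarrow> f (x, t) \<in> \<real>) \<Longrightarrow>
        t0 \<in> \<real> \<Longrightarrow> x \<in> X \<Longrightarrow> x \<in> \<real> \<Longrightarrow> t \<in> ball t0 \<delta> \<Longrightarrow> t \<in> \<real> \<Longrightarrow> \<phi> (x, t) \<in> \<real>"
proof -
  define \<delta> where "\<delta> = min \<eta> (d / (2 * M))"
  have \<delta>: "0 < \<delta>" "\<delta> \<le> \<eta>" "\<delta> \<le> d / (2 * M)" using pos by (auto simp: \<delta>_def)
  let ?B = "ball t0 \<delta>"
  have BB: "?B \<subseteq> ball t0 \<eta>" using \<delta> by auto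
  have M\<delta>: "M * norm (t - t0) \<le> d / 2" if "t \<in> ?B" for t
  proof -
    have "norm (t - t0) \<le> d / (2 * M)" using that \<delta> by (simp add: dist_norm norm_minus_commute)
    then show ?thesis using pos by (simp add: field_simps)
  qed
  define F where "F \<psi> p = f (\<psi> p, snd p)" for \<psi> and p :: "complex \<times> complex"
  define T where "T \<psi> p = fst p + time_integral t0 (F \<psi>) p" for \<psi> p
  define adm where "adm \<psi> \<longleftrightarrow> hol2 \<psi> (X \<times> ?B) \<and> (\<forall>x\<in>X. \<forall>t\<in>?B. \<psi> (x, t) \<in> cball x d)" for \<psi>
  have inP: "\<psi> (x, t) \<in> P" if "adm \<psi>" "x \<in> X" "t \<in> ?B" for \<psi> x t
  proof -
    have "cball x d \<subseteq> cball x (2 * d)" using pos by auto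
    moreover have "\<psi> (x, t) \<in> cball x d" using that unfolding adm_def by blast
    ultimately show ?thesis using that sub[of x] by blast
  qed
  have F_hol: "hol2 (F \<psi>) (X \<times> ?B)" if "adm \<psi>" for \<psi>
    unfolding F_def
    by (rule hol2_compose[OF _ f])
      (use that inP[OF that] BB assms(1) in \<open>auto simp: adm_def open_Times intro!: hol2_snd\<close>)
  note F_cont = F_hol[unfolded hol2_def, THEN conjunct1]
  have T_dist: "norm (T \<psi> (x, t) - x) \<le> M * norm (t - t0)" if "adm \<psi>" "x \<in> X" "t \<in> ?B" for \<psi> x t
  proof -
    have "norm (time_integral t0 (F \<psi>) (x, t) - time_integral t0 (\<lambda>_. 0) (x, t)) \<le> M * norm (t - t0)"
      by (rule time_integral_diff_bound[OF F_cont[OF that(1)] _ that(2,3)])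
        (use bound inP[OF that(1,2)] BB in \<open>auto simp: F_def\<close>)
    then show ?thesis by (simp add: T_def time_integral_def)
  qed
  have T_adm: "adm (T \<psi>)" if "adm \<psi>" for \<psi>
  proof -
    have "T \<psi> (x, t) \<in> cball x d" if "x \<in> X" "t \<in> ?B" for x t
      using T_dist[OF \<open>adm \<psi>\<close> that] M\<delta>[OF that(2)] pos by (simp add: dist_norm norm_minus_commute)
    moreover have "hol2 (T \<psi>) (X \<times> ?B)"
      unfolding T_def by (intro hol2_intros hol2_time_integral(1)[OF assms(2) F_hol[OF that]])
    ultimately show ?thesis by (auto simp: adm_def)
  qed
  have T_diff: "norm (T \<psi> p - T \<psi>' p) \<le> e / 2"
    if a: "adm \<psi>" "adm \<psi>'" and e: "\<And>p. p \<in> X \<times> ?B \<Longrightarrow> norm (\<psi> p - \<psi>' p) \<le> e" and p: "p \<in> X \<times> ?B" for \<psi> \<psi>' e p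
  proof -
    obtain x t where xt: "p = (x, t)" "x \<in> X" "t \<in> ?B" using p by auto
    have e0: "0 \<le> e" using e[OF p] norm_ge_zero order_trans by blast
    have "norm (time_integral t0 (F \<psi>) (x, t) - time_integral t0 (F \<psi>') (x, t)) \<le> (M / d * e) * norm (t - t0)"
    proof (rule time_integral_diff_bound[OF F_cont[OF a(1)] F_cont[OF a(2)] xt(2,3)])
      fix s assume s: "s \<in> ?B"
      have "norm (F \<psi> (x, s) - F \<psi>' (x, s)) \<le> M / d * norm (\<psi> (x, s) - \<psi>' (x, s))"
        unfolding F_def snd_conv
        by (rule picard_Lipschitz[OF f _ sub[OF xt(2)] pos(2) bound]) (use a xt s BB in \<open>auto simp: adm_def\<close>)
      also have "\<dots> \<le> M / d * e" using e[of "(x, s)"] xt(2) s pos by (intro mult_left_mono) auto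
      finally show "norm (F \<psi> (x, s) - F \<psi>' (x, s)) \<le> M / d * e" .
    qed
    also have "\<dots> = (M * norm (t - t0)) * (e / d)" using pos by simp
    also have "\<dots> \<le> (d / 2) * (e / d)" by (rule mult_right_mono[OF M\<delta>[OF xt(3)]]) (use pos e0 in auto)
    also have "\<dots> = e / 2" using pos by simp
    finally show ?thesis by (simp add: T_def xt)
  qed
  define \<psi> where "\<psi> n = (T ^^ n) fst" for n
  have \<psi>0: "\<psi> 0 = fst" and \<psi>S: "\<psi> (Suc n) = T (\<psi> n)" for n by (auto simp: \<psi>_def)
  have adm: "adm (\<psi> n)" for n
  proof (induction n)
    case 0 show ?case using pos by (simp add: \<psi>0 adm_def hol2_fst)
  qed (simp add: \<psi>S T_adm)
  have step: "norm (\<psi> (Suc n) p - \<psi> n p) \<le> d * (1 / 2) ^ n" if "p \<in> X \<times> ?B" for n p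
    using that
  proof (induction n arbitrary: p)
    case 0
    then show ?case using T_dist[OF adm[of 0]] M\<delta> pos by (fastforce simp: \<psi>S \<psi>0)
  next
    case (Suc n)
    from T_diff[OF adm adm Suc.IH Suc.prems] show ?case by (simp add: \<psi>S)
  qed
  define \<phi> where "\<phi> p = fst p + (\<Sum>n. \<psi> (Suc n) p - \<psi> n p)" for p
  have "uniform_limit (X \<times> ?B) (\<lambda>n p. \<Sum>i<n. \<psi> (Suc i) p - \<psi> i p) (\<lambda>p. \<Sum>n. \<psi> (Suc n) p - \<psi> n p) sequentially"
    by (rule Weierstrass_m_test[OF step]) auto
  then have "uniform_limit (X \<times> ?B) (\<lambda>n p. fst p + (\<Sum>i<n. \<psi> (Suc i) p - \<psi> i p)) \<phi> sequentially"
    unfolding \<phi>_def by (intro uniform_limit_intros)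
  then have lim: "uniform_limit (X \<times> ?B) \<psi> \<phi> sequentially"
  proof -
    have "fst p + (\<Sum>i<n. \<psi> (Suc i) p - \<psi> i p) = \<psi> n p" for n p
      by (induction n) (simp_all add: \<psi>0 algebra_simps)
    then show ?thesis using \<open>uniform_limit _ (\<lambda>n p. fst p + _ n p) _ _\<close> by (simp only:)
  qed
  have ptlim: "(\<lambda>n. \<psi> n p) \<longlonglongrightarrow> \<phi> p" if "p \<in> X \<times> ?B" for p
    by (rule tendsto_uniform_limitI[OF lim that])
  have opS: "open (X \<times> ?B)" using assms(2) by (intro open_Times) auto
  have \<phi>_adm: "adm \<phi>"
  proof -
    have "\<phi> (x, t) \<in> cball x d" if "x \<in> X" "t \<in> ?B" for x t
      by (rule Lim_in_closed_set[OF _ _ _ ptlim]) (use adm that in \<open>auto simp: adm_def\<close>)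
    moreover have "hol2 \<phi> (X \<times> ?B)"
      by (rule hol2_uniform_limit(1)[OF opS _ lim]) (use adm in \<open>auto simp: adm_def\<close>)
    ultimately show ?thesis by (auto simp: adm_def)
  qed
  have fixed_point: "\<phi> p = T \<phi> p" if p: "p \<in> X \<times> ?B" for p
  proof (rule LIMSEQ_unique)
    show "(\<lambda>n. \<psi> (Suc n) p) \<longlonglongrightarrow> \<phi> p" using ptlim[OF p] by (rule LIMSEQ_Suc)
    show "(\<lambda>n. \<psi> (Suc n) p) \<longlonglongrightarrow> T \<phi> p"
    proof (rule tendstoI)
      fix e :: real assume "e > 0"
      then have "\<forall>\<^sub>F n in sequentially. \<forall>p\<in>X \<times> ?B. dist (\<psi> n p) (\<phi> p) < e"
        using lim by (simp add: uniform_limit_iff)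
      then show "\<forall>\<^sub>F n in sequentially. dist (\<psi> (Suc n) p) (T \<phi> p) < e"
      proof eventually_elim
        case (elim n)
        have "norm (T (\<psi> n) p - T \<phi> p) \<le> e / 2"
          by (rule T_diff[OF adm \<phi>_adm _ p]) (use elim in \<open>force simp: dist_norm\<close>)
        then show ?case using \<open>e > 0\<close> by (simp add: \<psi>S dist_norm)
      qed
    qed
  qed
  show ?thesis
  proof (rule that[of \<delta> \<phi>])
    show "hol2 \<phi> (X \<times> ?B)" using \<phi>_adm by (simp add: adm_def)
    show dist_x: "norm (\<phi> (x, t) - x) \<le> M * norm (t - t0)" if "x \<in> X" "t \<in> ?B" for x t
      using T_dist[OF \<phi>_adm that] fixed_point[of "(x, t)"] that by simp
    show "\<phi> (x, t0) = x" if "x \<in> X" for x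
      using dist_x[OF that, of t0] \<delta> by simp
    show "\<phi> (x, t) \<in> cball x d" if "x \<in> X" "t \<in> ?B" for x t
      using \<phi>_adm that by (simp add: adm_def)
    show "((\<lambda>s. \<phi> (x, s)) has_field_derivative f (\<phi> (x, t), t)) (at t)" if "x \<in> X" "t \<in> ?B" for x t
    proof -
      have "((\<lambda>s. T \<phi> (x, s)) has_field_derivative F \<phi> (x, t)) (at t)"
        unfolding T_def using hol2_time_integral(2)[OF assms(2) F_hol[OF \<phi>_adm] that]
        by (auto intro!: derivative_eq_intros)
      then have "((\<lambda>s. \<phi> (x, s)) has_field_derivative F \<phi> (x, t)) (at t)"
        by (rule has_field_derivative_transform_within_open[OF _ open_ball that(2)])
          (use fixed_point that(1) in auto)
      then show ?thesis by (simp add: F_def)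
    qed
    show "\<phi> (x + q, t) = \<phi> (x, t) + q"
      if per: "\<And>x t. x \<in> P \<Longrightarrow> t \<in> ball t0 \<eta> \<Longrightarrow> f (x + q, t) = f (x, t)"
        and x: "x \<in> X" "x + q \<in> X" and t: "t \<in> ?B" for q x t
    proof (rule LIMSEQ_unique)
      have "\<psi> n (x + q, t) = \<psi> n (x, t) + q" if "t \<in> ?B" for n t
        using that
      proof (induction n arbitrary: t)
        case (Suc n)
        have "time_integral t0 (F (\<psi> n)) (x + q, t) = time_integral t0 (F (\<psi> n)) (x, t)"
          unfolding time_integral_def fst_conv snd_conv
        proof (rule integral_cong)
          fix s :: real assume "s \<in> {0..1}"
          note s = segment_in_ball[OF Suc.prems this]
          then show "F (\<psi> n) (x + q, t0 + of_real s * (t - t0)) * (t - t0) = F (\<psi> n) (x, t0 + of_real s * (t - t0)) * (t - t0)"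
            using Suc.IH[OF s] per inP[OF adm x(1) s] BB by (auto simp: F_def)
        qed
        then show ?case by (simp add: \<psi>S T_def)
      qed (simp add: \<psi>0)
      then show "(\<lambda>n. \<psi> n (x + q, t)) \<longlonglongrightarrow> \<phi> (x, t) + q"
        using t x by (auto intro!: tendsto_intros ptlim)
      show "(\<lambda>n. \<psi> n (x + q, t)) \<longlonglongrightarrow> \<phi> (x + q, t)" using t x by (intro ptlim) auto
    qed
    show "\<phi> (x, t) \<in> \<real>"
      if real: "\<And>x t. x \<in> P \<Longrightarrow> t \<in> ball t0 \<eta> \<Longrightarrow> x \<in> \<real> \<Longrightarrow> t \<in> \<real> \<Longrightarrow> f (x, t) \<in> \<real>"
        and t0: "t0 \<in> \<real>" and x: "x \<in> X" "x \<in> \<real>" and t: "t \<in> ?B" "t \<in> \<real>" for x t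
    proof (rule Lim_in_closed_set[OF closed_complex_Reals])
      have "\<psi> n (x, t) \<in> \<real>" if "t \<in> ?B" "t \<in> \<real>" for n t
        using that
      proof (induction n arbitrary: t)
        case (Suc n)
        have "time_integral t0 (F (\<psi> n)) (x, t) \<in> \<real>"
          by (rule time_integral_Reals[OF F_cont[OF adm] x(1) Suc.prems(1) t0 Suc.prems(2)])
            (use Suc.IH real inP[OF adm x(1)] BB in \<open>auto simp: F_def\<close>)
        then show ?case using x(2) by (simp add: \<psi>S T_def)
      qed (use x in \<open>simp add: \<psi>0\<close>)
      then show "\<forall>\<^sub>F n in sequentially. \<psi> n (x, t) \<in> \<real>" using t by simp
      show "(\<lambda>n. \<psi> n (x, t)) \<longlonglongrightarrow> \<phi> (x, t)" using t x by (intro ptlim) auto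
    qed auto
  qed (use \<delta> in auto)
qed

section \<open>The unstable manifold as a formal series\<close>

text \<open>
  The growth rate of the perturbation \<open>cos (y \<theta>)\<close> of the radius of curvature of a circle, in the time in which
  the circle has constant size.
\<close>

definition growth :: "real \<Rightarrow> real \<Rightarrow> real" where
  "growth c y = - (y ^ 4) + (3 * c + 1) * y\<^sup>2 - 4 * c"

text \<open>
  The series \<open>a\<close> stands for the sum of \<open>a (j, k) * exp ((j + k) \<mu> \<tau> + \<i> (j - k) x \<theta>)\<close>, a power series in the two
  waves with exponents \<open>\<mu> \<tau> + \<i> x \<theta>\<close> and \<open>\<mu> \<tau> - \<i> x \<theta>\<close>. Products of functions become convolutions. Indices are
  treated as atoms, hence the two rules are taken out of the simplifier.
\<close>

type_synonym series = "nat \<times> nat \<Rightarrow> complex"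

declare split_paired_All [simp del] split_paired_Ex [simp del]

definition deg :: "nat \<times> nat \<Rightarrow> nat" where "deg i = fst i + snd i"

definition conv :: "series \<Rightarrow> series \<Rightarrow> series" where
  "conv a b i = (\<Sum>(p, q) | p + q = i. a p * b q)"

definition agree :: "nat \<Rightarrow> series \<Rightarrow> series \<Rightarrow> bool" where
  "agree m a b \<longleftrightarrow> (\<forall>i. deg i < m \<longrightarrow> a i = b i)"

text \<open>
  The series with real sums at real \<open>\<theta>\<close> and \<open>\<tau>\<close>.
\<close>

definition hermitian :: "series \<Rightarrow> bool" where
  "hermitian a \<longleftrightarrow> (\<forall>i. a (prod.swap i) = cnj (a i))"

lemma deg_add: "deg (p + q) = deg p + deg q" by (simp add: deg_def)

lemma deg_eq_0_iff: "deg i = 0 \<longleftrightarrow> i = 0" by (cases i) (auto simp: deg_def zero_prod_def)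

lemma finite_splittings: "finite {(p, q). p + q = (i :: nat \<times> nat)}"
proof (rule finite_subset)
  show "{(p, q). p + q = i} \<subseteq> ({..fst i} \<times> {..snd i}) \<times> ({..fst i} \<times> {..snd i})" by auto
qed auto

lemma agreeD: "agree m a b \<Longrightarrow> deg i < m \<Longrightarrow> a i = b i" by (simp add: agree_def)

lemma agree_conv: "agree m a a' \<Longrightarrow> agree m b b' \<Longrightarrow> agree m (conv a b) (conv a' b')"
  unfolding agree_def[of m "conv a b"] conv_def
proof (intro allI impI sum.cong)
  fix i z assume *: "agree m a a'" "agree m b b'" and i: "deg i < m" and z: "z \<in> {(p, q). p + q = i}"
  obtain p q where pq: "z = (p, q)" "p + q = i" using z by auto
  then show "(case z of (p, q) \<Rightarrow> a p * b q) = (case z of (p, q) \<Rightarrow> a' p * b' q)"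
    using i agreeD[OF *(1), of p] agreeD[OF *(2), of q] by (simp add: deg_add[of p q, unfolded pq(2)])
qed auto

text \<open>
  Without constant terms, the coefficients of degree \<^term>\<open>m\<close> of a product only involve coefficients of smaller
  degree. This is why the equation for the series can be solved degree by degree.
\<close>

lemma agree_Suc_conv:
  assumes "agree m a a'" "agree m b b'" "a 0 = 0" "a' 0 = 0" "b 0 = 0" "b' 0 = 0"
  shows "agree (Suc m) (conv a b) (conv a' b')"
  unfolding agree_def conv_def
proof (intro allI impI sum.cong)
  fix i z assume i: "deg i < Suc m" and z: "z \<in> {(p, q). p + q = i}"
  obtain p q where pq: "z = (p, q)" "p + q = i" using z by auto
  consider "p = 0" | "q = 0" | "deg p < m" "deg q < m"
    using i pq deg_eq_0_iff[of p] deg_eq_0_iff[of q] by (auto simp: deg_add[of p q, unfolded pq(2)])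
  then show "(case z of (p, q) \<Rightarrow> a p * b q) = (case z of (p, q) \<Rightarrow> a' p * b' q)"
    by cases (use assms agreeD[OF assms(1), of p] agreeD[OF assms(2), of q] pq in simp_all)
qed auto

lemma conv_0: "conv a b 0 = a 0 * b 0"
proof -
  have "{(p, q). p + q = (0 :: nat \<times> nat)} = {(0, 0)}" by (auto simp: zero_prod_def)
  then show ?thesis by (simp add: conv_def)
qed

lemma conv_commute: "conv a b i = conv b a i"
  unfolding conv_def by (rule sum.reindex_bij_witness[of _ prod.swap prod.swap]) (auto simp: add.commute)

lemma hermitian_conv: "hermitian a \<Longrightarrow> hermitian b \<Longrightarrow> hermitian (conv a b)"
  unfolding hermitian_def
proof
  fix i :: "nat \<times> nat" assume h: "\<forall>i. a (prod.swap i) = cnj (a i)" "\<forall>i. b (prod.swap i) = cnj (b i)"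
  obtain j k where i: "i = (j, k)" by force
  have "conv a b (prod.swap i) = (\<Sum>(p, q) | p + q = i. a (prod.swap p) * b (prod.swap q))"
    unfolding conv_def
    by (rule sum.reindex_bij_witness[of _ "\<lambda>(p, q). (prod.swap p, prod.swap q)" "\<lambda>(p, q). (prod.swap p, prod.swap q)"])
      (auto simp: i)
  then show "conv a b (prod.swap i) = cnj (conv a b i)"
    using h by (simp add: conv_def case_prod_unfold)
qed

text \<open>
  The mode \<open>cos (x \<theta>)\<close> grows at the rate \<^term>\<open>\<mu>\<close>. The gap condition holds when no multiple of \<^term>\<open>x\<close> other than the
  frequencies \<open>0\<close> and \<open>\<plusminus>1\<close> grows faster than \<^term>\<open>x\<close> itself. It excludes resonances in degree two or more, and as
  \<^const>\<open>growth\<close> decreases like the fourth power of the frequency, dividing by the gap regains the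
  four derivatives in the flow. The frequencies \<open>0\<close> and \<open>\<plusminus>1\<close> belong to dilations and translations.
\<close>

locale unstable_mode =
  fixes c x \<mu> \<kappa> :: real
  assumes x_generic: "x \<notin> {0, 1, -1}"
    and \<mu>_eq: "\<mu> = growth c x" and \<mu>_pos: "0 < \<mu>" and \<kappa>_pos: "0 < \<kappa>"
    and gap: "\<And>j k :: nat. 2 \<le> j + k \<Longrightarrow> (real j - real k) * x \<notin> {0, 1, -1} \<Longrightarrow>
       \<kappa> * (1 + \<bar>(real j - real k) * x\<bar>) ^ 4 \<le> real (j + k) * \<mu> - growth c ((real j - real k) * x)"
begin

subsection \<open>The equation for the radius of curvature\<close>

text \<open>
  Let \<open>r = 1 + U\<close> be the radius of curvature as a function of the tangent angle \<open>\<theta>\<close>, for the curve rescaled so that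
  \<open>r\<close> has mean \<open>1\<close>, and let \<open>1 / r = 1 + E\<close> be the curvature. The normal speed \<open>k\<^sub>s\<^sub>s + c k\<^sup>3\<close> becomes
  \<open>G = k (c k\<^sup>2 + (k\<^sup>2)'' / 2)\<close> with \<open>k = 1 + E\<close>, and the flow in the rescaled time is
  \<open>r' = G + G'' - <G> r\<close>, where \<open><G>\<close> is the mean, the prime on the left is the time derivative and those on \<open>G\<close> are
  angle derivatives. A term \<open>G + G''\<close> has no frequency \<open>\<plusminus>1\<close>, so it is consistent
  to exclude these frequencies from \<open>U\<close>; this says that the curve closes up.

  Separating linear and quadratic terms, \<open>G = c - J U + G2\<close> with \<open>J a = 3 c a + a''\<close>, and with
  \<open>H a = c a + a'' / 2\<close> the remainder \<open>G2\<close> is as below; \<open>B\<close> is what is left of the right-hand side of the flow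
  after the linear part, which acts on each frequency as multiplication by \<^const>\<open>growth\<close>.
\<close>

definition frq :: "nat \<times> nat \<Rightarrow> real" where "frq i = (real (fst i) - real (snd i)) * x"

text \<open>
  The weighted \<open>l\<^sup>1\<close> norm of \<^term>\<open>a\<close> is at most \<^term>\<open>K\<close>. The weight is submultiplicative in the frequency, so
  these norms are submultiplicative for convolution, and a derivative in \<open>\<theta>\<close> costs one power of it.
\<close>

definition bnd :: "nat \<Rightarrow> series \<Rightarrow> real \<Rightarrow> bool" where
  "bnd s a K \<longleftrightarrow> (\<forall>F. finite F \<longrightarrow> (\<Sum>i\<in>F. norm (a i) * (1 + \<bar>frq i\<bar>) ^ s) \<le> K)"

definition J :: "series \<Rightarrow> series" where "J a i = of_real (3 * c - (frq i)\<^sup>2) * a i"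
definition H :: "series \<Rightarrow> series" where "H a i = of_real (c - (frq i)\<^sup>2 / 2) * a i"
definition mean :: "series \<Rightarrow> series" where "mean a i = (if frq i = 0 then a i else 0)"

definition G2 :: "series \<Rightarrow> series \<Rightarrow> series" where
  "G2 U E i = - J (conv U E) i + H (conv E E) i + conv E (H (\<lambda>i. 2 * E i + conv E E i)) i"

definition B :: "series \<Rightarrow> series \<Rightarrow> series" where
  "B U E i = of_real (1 - (frq i)\<^sup>2) * G2 U E i - mean (G2 U E) i - conv (mean (G2 U E)) U i"

text \<open>
  \<^term>\<open>K0\<close> bounds the multipliers of \<^const>\<open>J\<close> and \<^const>\<open>H\<close> against the squared weight. The number \<open>216\<close> in the
  smallness condition is three times the constant \<open>72\<close> in the quadratic estimate of \<^const>\<open>G2\<close> in the lemma \<open>bnd_B\<close>,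
  and \<^term>\<open>amp\<close> is chosen such that the linear part has norm exactly \<^term>\<open>\<eta>\<close>.
\<close>

definition K0 :: real where "K0 = 3 * \<bar>c\<bar> + 1"
definition \<eta> :: real where "\<eta> = min (1 / 4) (\<kappa> / (216 * K0))"
definition amp :: real where "amp = \<eta> / (2 * (1 + \<bar>x\<bar>) ^ 4)"

text \<open>
  The solution of \<open>(deg \<mu> - growth) U = R\<close>. In degree one the operator vanishes on the unstable mode, whose amplitude is
  prescribed instead.
\<close>

definition resolvent :: "series \<Rightarrow> series" where
  "resolvent R i = (if frq i \<in> {0, 1, -1} then 0 else if deg i \<le> 1 then of_real amp
     else R i / of_real (real (deg i) * \<mu> - growth c (frq i)))"

text \<open>
  One step of the fixed point iteration: \<open>U\<close> from the flow, \<open>E\<close> from \<open>(1 + U) (1 + E) = 1\<close>.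
\<close>

definition nextU :: "series \<Rightarrow> series \<Rightarrow> series" where "nextU U E = resolvent (B U E)"
definition nextE :: "series \<Rightarrow> series \<Rightarrow> series" where "nextE U E i = - nextU U E i - conv (nextU U E) E i"

fun iter :: "nat \<Rightarrow> series \<times> series" where
  "iter 0 = (\<lambda>_. 0, \<lambda>_. 0)"
| "iter (Suc n) = (nextU (fst (iter n)) (snd (iter n)), nextE (fst (iter n)) (snd (iter n)))"

subsection \<open>Weighted estimates\<close>

lemma frq_add: "frq (p + q) = frq p + frq q" by (simp add: frq_def algebra_simps)
lemma frq_0: "frq 0 = 0" by (simp add: frq_def)
lemma frq_swap: "frq (prod.swap i) = - frq i" by (simp add: frq_def algebra_simps)
lemma deg_swap: "deg (prod.swap i) = deg i" by (simp add: deg_def)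

lemma abs_frq_le: "\<bar>frq i\<bar> \<le> real (deg i) * \<bar>x\<bar>"
  unfolding frq_def deg_def abs_mult by (rule mult_right_mono) auto

lemma bndI: "(\<And>F. finite F \<Longrightarrow> (\<Sum>i\<in>F. norm (a i) * (1 + \<bar>frq i\<bar>) ^ s) \<le> K) \<Longrightarrow> bnd s a K"
  by (simp add: bnd_def)

lemma bndD: "bnd s a K \<Longrightarrow> finite F \<Longrightarrow> (\<Sum>i\<in>F. norm (a i) * (1 + \<bar>frq i\<bar>) ^ s) \<le> K"
  by (simp add: bnd_def)

lemma bnd_nonneg: "bnd s a K \<Longrightarrow> 0 \<le> K" using bndD[of s a K "{}"] by simp

lemma bnd_mono: "bnd s a K \<Longrightarrow> K \<le> L \<Longrightarrow> bnd s a L"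
  unfolding bnd_def by (meson order_trans)

lemma bnd_transfer:
  assumes "bnd s a K" "0 \<le> C" "\<And>i. norm (b i) * (1 + \<bar>frq i\<bar>) ^ t \<le> C * (norm (a i) * (1 + \<bar>frq i\<bar>) ^ s)"
  shows "bnd t b (C * K)"
proof (rule bndI)
  fix F :: "(nat \<times> nat) set" assume "finite F"
  have "(\<Sum>i\<in>F. norm (b i) * (1 + \<bar>frq i\<bar>) ^ t) \<le> C * (\<Sum>i\<in>F. norm (a i) * (1 + \<bar>frq i\<bar>) ^ s)"
    unfolding sum_distrib_left by (rule sum_mono) (rule assms)
  also have "\<dots> \<le> C * K" using bndD[OF assms(1) \<open>finite F\<close>] assms(2) by (rule mult_left_mono)
  finally show "(\<Sum>i\<in>F. norm (b i) * (1 + \<bar>frq i\<bar>) ^ t) \<le> C * K" .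
qed

lemma bnd_add: "bnd s a K \<Longrightarrow> bnd s b L \<Longrightarrow> bnd s (\<lambda>i. a i + b i) (K + L)"
proof (rule bndI)
  fix F :: "(nat \<times> nat) set" assume *: "bnd s a K" "bnd s b L" "finite F"
  have "(\<Sum>i\<in>F. norm (a i + b i) * (1 + \<bar>frq i\<bar>) ^ s) \<le> (\<Sum>i\<in>F. norm (a i) * (1 + \<bar>frq i\<bar>) ^ s + norm (b i) * (1 + \<bar>frq i\<bar>) ^ s)"
    by (rule sum_mono, subst distrib_right[symmetric], rule mult_right_mono) (auto intro: norm_triangle_ineq)
  then show "(\<Sum>i\<in>F. norm (a i + b i) * (1 + \<bar>frq i\<bar>) ^ s) \<le> K + L"
    using bndD[OF *(1,3)] bndD[OF *(2,3)] by (simp add: sum.distrib)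
qed

lemma bnd_lower: "bnd s a K \<Longrightarrow> t \<le> s \<Longrightarrow> bnd t a K"
  using bnd_transfer[of s a K 1 a t, OF _ _ mult_left_mono[OF power_increasing, of t s, THEN order_trans]] by simp

lemma bnd_cong_norm: "bnd s a K \<Longrightarrow> (\<And>i. norm (b i) \<le> norm (a i)) \<Longrightarrow> bnd s b K"
  using bnd_transfer[of s a K 1 b s] by (auto intro!: mult_right_mono)

lemma bnd_cmult: "bnd s a K \<Longrightarrow> bnd s (\<lambda>i. k * a i) (norm k * K)"
  by (rule bnd_transfer) (auto simp: norm_mult)

text \<open>
  Peetre's inequality \<open>1 + \<bar>y + z\<bar> \<le> (1 + \<bar>y\<bar>) (1 + \<bar>z\<bar>)\<close> distributes the weight over the factors.
\<close>

lemma bnd_conv: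
  assumes "bnd s a K" "bnd s b L"
  shows "bnd s (conv a b) (K * L)"
proof (rule bndI)
  let ?w = "\<lambda>i. (1 + \<bar>frq i\<bar>) ^ s"
  let ?A = "\<lambda>p. norm (a p) * ?w p" and ?B = "\<lambda>p. norm (b p) * ?w p"
  fix F :: "(nat \<times> nat) set" assume F: "finite F"
  let ?S = "SIGMA i:F. {(p, q). p + q = i}"
  have fS: "finite ?S" using F finite_splittings by (intro finite_SigmaI)
  let ?P = "(\<lambda>z. fst (snd z)) ` ?S" and ?Q = "(\<lambda>z. snd (snd z)) ` ?S"
  have "norm (conv a b i) * ?w i \<le> (\<Sum>(p, q) | p + q = i. ?A p * ?B q)" for i
  proof -
    have "norm (conv a b i) * ?w i \<le> (\<Sum>(p, q) | p + q = i. norm (a p * b q)) * ?w i"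
      unfolding conv_def by (intro mult_right_mono) (auto intro!: order_trans[OF norm_sum] sum_mono)
    also have "\<dots> = (\<Sum>(p, q) | p + q = i. norm (a p) * norm (b q) * ?w i)"
      by (simp add: sum_distrib_right case_prod_unfold norm_mult)
    also have "\<dots> \<le> (\<Sum>(p, q) | p + q = i. ?A p * ?B q)"
    proof (intro sum_mono, clarify)
      fix p q assume i: "i = p + q"
      have "1 + \<bar>frq (p + q)\<bar> \<le> (1 + \<bar>frq p\<bar>) * (1 + \<bar>frq q\<bar>)"
      proof -
        have "(1 + \<bar>frq p\<bar>) * (1 + \<bar>frq q\<bar>) = 1 + \<bar>frq p\<bar> + \<bar>frq q\<bar> + \<bar>frq p\<bar> * \<bar>frq q\<bar>"
          by (simp add: algebra_simps)
        moreover have "0 \<le> \<bar>frq p\<bar> * \<bar>frq q\<bar>" by simp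
        ultimately show ?thesis unfolding frq_add using abs_triangle_ineq[of "frq p" "frq q"] by linarith
      qed
      then have "?w (p + q) \<le> ?w p * ?w q"
        unfolding power_mult_distrib[symmetric] by (intro power_mono) auto
      then have "norm (a p) * norm (b q) * ?w (p + q) \<le> norm (a p) * norm (b q) * (?w p * ?w q)"
        by (intro mult_left_mono) auto
      then show "norm (a p) * norm (b q) * ?w (p + q) \<le> ?A p * ?B q" by (simp add: mult_ac)
    qed
    finally show ?thesis .
  qed
  then have "(\<Sum>i\<in>F. norm (conv a b i) * ?w i) \<le> (\<Sum>i\<in>F. \<Sum>(p, q) | p + q = i. ?A p * ?B q)"
    by (intro sum_mono)
  also have "\<dots> = (\<Sum>z\<in>?S. ?A (fst (snd z)) * ?B (snd (snd z)))"
    by (subst sum.Sigma) (use F finite_splittings in \<open>auto simp: case_prod_unfold\<close>)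
  also have "\<dots> = (\<Sum>z\<in>snd ` ?S. ?A (fst z) * ?B (snd z))"
    by (subst sum.reindex) (auto simp: inj_on_def)
  also have "\<dots> \<le> (\<Sum>z\<in>?P \<times> ?Q. ?A (fst z) * ?B (snd z))"
  proof (rule sum_mono2)
    show "snd ` ?S \<subseteq> ?P \<times> ?Q"
    proof
      fix z assume "z \<in> snd ` ?S"
      then obtain w where "w \<in> ?S" "z = snd w" by blast
      then have "fst z \<in> ?P" "snd z \<in> ?Q" by (auto intro: rev_image_eqI)
      then show "z \<in> ?P \<times> ?Q" by (simp add: mem_Times_iff)
    qed
  qed (use fS in simp_all)
  also have "\<dots> = (\<Sum>p\<in>?P. ?A p) * (\<Sum>q\<in>?Q. ?B q)"
    by (simp add: sum_product sum.cartesian_product case_prod_unfold)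
  also have "\<dots> \<le> K * L"
    by (rule mult_mono) (use bndD[OF assms(1)] bndD[OF assms(2)] fS bnd_nonneg[OF assms(1)] in \<open>auto intro!: sum_nonneg\<close>)
  finally show "(\<Sum>i\<in>F. norm (conv a b i) * ?w i) \<le> K * L" .
qed

text \<open>
  Bounds on all finite partial sums survive a limit in which each coefficient becomes stationary.
\<close>

lemma bnd_limit:
  fixes a :: "nat \<Rightarrow> series"
  assumes "\<And>n. bnd s (a n) K" "\<And>i. \<exists>N. \<forall>n\<ge>N. a n i = b i"
  shows "bnd s b K"
proof (rule bndI)
  fix F :: "(nat \<times> nat) set" assume F: "finite F"
  obtain N where N: "\<And>i n. n \<ge> N i \<Longrightarrow> a n i = b i" using assms(2) by metis
  have "a (Max (N ` F)) i = b i" if "i \<in> F" for i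
    using that F by (intro N) simp
  then show "(\<Sum>i\<in>F. norm (b i) * (1 + \<bar>frq i\<bar>) ^ s) \<le> K"
    using bndD[OF assms(1)[of "Max (N ` F)"] F] by simp
qed

lemma K0_pos: "0 < K0" by (simp add: K0_def)

lemma bnd_multiplier:
  assumes "bnd 4 a K" "\<And>i. \<bar>m i\<bar> \<le> K0 * (1 + \<bar>frq i\<bar>)\<^sup>2"
  shows "bnd 2 (\<lambda>i. of_real (m i) * a i) (K0 * K)"
proof (rule bnd_transfer[OF assms(1)])
  fix i
  have "\<bar>m i\<bar> * (norm (a i) * (1 + \<bar>frq i\<bar>)\<^sup>2) \<le> (K0 * (1 + \<bar>frq i\<bar>)\<^sup>2) * (norm (a i) * (1 + \<bar>frq i\<bar>)\<^sup>2)"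
    by (rule mult_right_mono[OF assms(2)]) auto
  then show "norm (of_real (m i) * a i) * (1 + \<bar>frq i\<bar>)\<^sup>2 \<le> K0 * (norm (a i) * (1 + \<bar>frq i\<bar>) ^ 4)"
    by (simp add: norm_mult power2_eq_square power4_eq_xxxx mult_ac)
qed (use K0_pos in auto)

lemma multiplier_bounds:
  "\<bar>3 * c - y\<^sup>2\<bar> \<le> K0 * (1 + \<bar>y\<bar>)\<^sup>2" "\<bar>c - y\<^sup>2 / 2\<bar> \<le> K0 * (1 + \<bar>y\<bar>)\<^sup>2" "\<bar>1 - y\<^sup>2\<bar> \<le> (1 + \<bar>y\<bar>)\<^sup>2"
proof -
  have e: "(1 + \<bar>y\<bar>)\<^sup>2 = 1 + 2 * \<bar>y\<bar> + y\<^sup>2" by (simp add: power2_eq_square algebra_simps)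
  have "3 * \<bar>c\<bar> * 1 \<le> 3 * \<bar>c\<bar> * (1 + \<bar>y\<bar>)\<^sup>2"
    by (rule mult_left_mono) (auto simp: e)
  then have k: "3 * \<bar>c\<bar> + (1 + 2 * \<bar>y\<bar> + y\<^sup>2) \<le> K0 * (1 + \<bar>y\<bar>)\<^sup>2"
    unfolding K0_def distrib_right by (simp add: e)
  have y: "0 \<le> y\<^sup>2" by simp
  show "\<bar>3 * c - y\<^sup>2\<bar> \<le> K0 * (1 + \<bar>y\<bar>)\<^sup>2" "\<bar>c - y\<^sup>2 / 2\<bar> \<le> K0 * (1 + \<bar>y\<bar>)\<^sup>2"
    using k y by linarith+
  show "\<bar>1 - y\<^sup>2\<bar> \<le> (1 + \<bar>y\<bar>)\<^sup>2" unfolding e using y by linarith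
qed

lemma bnd_J: "bnd 4 a K \<Longrightarrow> bnd 2 (J a) (K0 * K)" and bnd_H: "bnd 4 a K \<Longrightarrow> bnd 2 (H a) (K0 * K)"
  using bnd_multiplier[of a K "\<lambda>i. 3 * c - (frq i)\<^sup>2"] bnd_multiplier[of a K "\<lambda>i. c - (frq i)\<^sup>2 / 2"]
    multiplier_bounds
  unfolding J_def[abs_def] H_def[abs_def] by blast+

lemma bnd_mean: "bnd s a K \<Longrightarrow> bnd s (mean a) K"
  by (rule bnd_cong_norm) (auto simp: mean_def)

lemma bnd_uminus: "bnd s a K \<Longrightarrow> bnd s (\<lambda>i. - a i) K"
  by (rule bnd_cong_norm) auto

lemma bnd_G2:
  assumes "bnd 4 U Ku" "bnd 4 E Ke"
  shows "bnd 2 (G2 U E) (K0 * (Ku * Ke) + K0 * (Ke * Ke) + Ke * (K0 * (2 * Ke + Ke * Ke)))"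
  unfolding G2_def[abs_def]
proof (intro bnd_add bnd_uminus bnd_J bnd_H bnd_conv assms)
  show "bnd 2 E Ke" by (rule bnd_lower[OF assms(2)]) simp
  show "bnd 4 (\<lambda>i. 2 * E i) (2 * Ke)" using bnd_cmult[OF assms(2), of 2] by simp
qed

lemma \<eta>_pos: "0 < \<eta>" and \<eta>_le: "\<eta> \<le> 1 / 4" "216 * K0 * \<eta> \<le> \<kappa>"
proof -
  show "0 < \<eta>" "\<eta> \<le> 1 / 4" using \<kappa>_pos K0_pos by (auto simp: \<eta>_def)
  have "\<eta> \<le> \<kappa> / (216 * K0)" by (simp add: \<eta>_def)
  then show "216 * K0 * \<eta> \<le> \<kappa>" using K0_pos by (simp add: field_simps)
qed

lemma amp_pos: "0 < amp" using \<eta>_pos by (simp add: amp_def)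

lemma bnd_B:
  assumes U: "bnd 4 U (2 * \<eta>)" and E: "bnd 4 E (4 * \<eta>)"
  shows "bnd 0 (B U E) (216 * K0 * \<eta> * \<eta>)"
proof -
  let ?g = "72 * K0 * \<eta> * \<eta>"
  have pos: "0 \<le> K0 * \<eta> * \<eta>" using K0_pos \<eta>_pos by simp
  have g: "bnd 2 (G2 U E) ?g"
  proof (rule bnd_mono[OF bnd_G2[OF U E]])
    have "K0 * \<eta> * \<eta> * \<eta> \<le> K0 * \<eta> * \<eta> * (1 / 4)" by (rule mult_left_mono[OF \<eta>_le(1) pos])
    then show "K0 * (2 * \<eta> * (4 * \<eta>)) + K0 * (4 * \<eta> * (4 * \<eta>)) + 4 * \<eta> * (K0 * (2 * (4 * \<eta>) + 4 * \<eta> * (4 * \<eta>))) \<le> ?g"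
      by (simp add: algebra_simps)
  qed
  have 1: "bnd 0 (\<lambda>i. of_real (1 - (frq i)\<^sup>2) * G2 U E i) (1 * ?g)"
  proof (rule bnd_transfer[OF g])
    show "norm (of_real (1 - (frq i)\<^sup>2) * G2 U E i) * (1 + \<bar>frq i\<bar>) ^ 0 \<le> 1 * (norm (G2 U E i) * (1 + \<bar>frq i\<bar>)\<^sup>2)" for i
      using mult_right_mono[OF multiplier_bounds(3)[of "frq i"], of "norm (G2 U E i)"]
      unfolding norm_mult norm_of_real by (simp add: mult_ac)
  qed auto
  have 2: "bnd 0 (mean (G2 U E)) ?g" by (rule bnd_lower[OF bnd_mean[OF g]]) simp
  have 3: "bnd 0 (conv (mean (G2 U E)) U) (?g * (2 * \<eta>))"
    by (rule bnd_conv[OF 2 bnd_lower[OF U]]) simp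
  have "?g * (2 * \<eta>) \<le> ?g * 1" using \<eta>_le(1) pos by (intro mult_left_mono) auto
  with bnd_add[OF bnd_add[OF 1 bnd_uminus[OF 2]] bnd_uminus[OF 3]]
  show ?thesis unfolding B_def[abs_def] by (auto elim: bnd_mono)
qed

lemma deg_1_iff: "deg i = 1 \<longleftrightarrow> i = (1, 0) \<or> i = (0, 1)"
  by (cases i) (auto simp: deg_def)

text \<open>
  The gap condition trades the division for four powers of the weight.
\<close>

lemma bnd_resolvent:
  assumes "bnd 0 R L"
  shows "bnd 4 (resolvent R) (\<eta> + L / \<kappa>)"
proof -
  let ?lin = "\<lambda>i. if i = (1, 0) \<or> i = (0, 1) then of_real amp else 0 :: complex"
  let ?rest = "\<lambda>i. if frq i \<in> {0, 1, -1} \<or> deg i \<le> 1 then 0 else R i / of_real (real (deg i) * \<mu> - growth c (frq i))"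
  have lin: "bnd 4 ?lin \<eta>"
  proof (rule bndI)
    fix F :: "(nat \<times> nat) set" assume F: "finite F"
    have "(\<Sum>i\<in>F. norm (?lin i) * (1 + \<bar>frq i\<bar>) ^ 4) \<le> (\<Sum>i\<in>F \<union> {(1, 0), (0, 1)}. norm (?lin i) * (1 + \<bar>frq i\<bar>) ^ 4)"
      using F by (intro sum_mono2) auto
    also have "\<dots> = (\<Sum>i\<in>{(1, 0), (0, 1)}. norm (?lin i) * (1 + \<bar>frq i\<bar>) ^ 4)"
      using F by (intro sum.mono_neutral_right) auto
    also have "\<dots> = 2 * (amp * (1 + \<bar>x\<bar>) ^ 4)" using amp_pos by (simp add: frq_def)
    also have "\<dots> = \<eta>" unfolding amp_def by (simp add: add_nonneg_eq_0_iff)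
    finally show "(\<Sum>i\<in>F. norm (?lin i) * (1 + \<bar>frq i\<bar>) ^ 4) \<le> \<eta>" .
  qed
  have "bnd 4 ?rest (1 / \<kappa> * L)"
  proof (rule bnd_transfer[OF assms])
    fix i
    show "norm (?rest i) * (1 + \<bar>frq i\<bar>) ^ 4 \<le> 1 / \<kappa> * (norm (R i) * (1 + \<bar>frq i\<bar>) ^ 0)"
    proof (cases "frq i \<in> {0, 1, -1} \<or> deg i \<le> 1")
      case False
      define d where "d = real (deg i) * \<mu> - growth c (frq i)"
      have d: "\<kappa> * (1 + \<bar>frq i\<bar>) ^ 4 \<le> d" unfolding d_def
        using gap[of "fst i" "snd i"] False by (auto simp: frq_def deg_def)
      have dp: "0 < \<kappa> * (1 + \<bar>frq i\<bar>) ^ 4" using \<kappa>_pos by (intro mult_pos_pos zero_less_power) auto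
      have "norm (?rest i) * (1 + \<bar>frq i\<bar>) ^ 4 = norm (R i) * ((1 + \<bar>frq i\<bar>) ^ 4 / d)"
        using False d dp unfolding d_def[symmetric] by (simp add: norm_divide)
      also have "\<dots> \<le> norm (R i) * (1 / \<kappa>)"
      proof (rule mult_left_mono)
        have "0 < d" using d dp by linarith
        then show "(1 + \<bar>frq i\<bar>) ^ 4 / d \<le> 1 / \<kappa>" using d \<kappa>_pos by (simp add: field_simps)
      qed simp
      finally show ?thesis by simp
    qed (use \<kappa>_pos in auto)
  qed (use \<kappa>_pos in auto)
  from bnd_add[OF lin this] have "bnd 4 (\<lambda>i. ?lin i + ?rest i) (\<eta> + L / \<kappa>)" by simp
  then show ?thesis
  proof (rule bnd_cong_norm)
    show "norm (resolvent R i) \<le> norm (?lin i + ?rest i)" for i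
      using deg_1_iff[of i] deg_eq_0_iff[of i] frq_0 by (auto simp: resolvent_def deg_def)
  qed
qed

text \<open>
  The balls of radius \<open>2 \<eta>\<close> and \<open>4 \<eta>\<close> are invariant because the nonlinearity is quadratic and \<^term>\<open>\<eta>\<close> is small.
\<close>

lemma bnd_next:
  assumes U: "bnd 4 U (2 * \<eta>)" and E: "bnd 4 E (4 * \<eta>)"
  shows "bnd 4 (nextU U E) (2 * \<eta>)" "bnd 4 (nextE U E) (4 * \<eta>)"
proof -
  have "216 * K0 * \<eta> * \<eta> \<le> \<kappa> * \<eta>" using \<eta>_le(2) \<eta>_pos by (intro mult_right_mono) auto
  then have "216 * K0 * \<eta> * \<eta> / \<kappa> \<le> \<eta>" using \<kappa>_pos by (simp add: field_simps)
  then show U': "bnd 4 (nextU U E) (2 * \<eta>)"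
    unfolding nextU_def by (intro bnd_mono[OF bnd_resolvent[OF bnd_B[OF U E]]]) simp
  have "2 * \<eta> * (4 * \<eta>) \<le> 2 * \<eta> * 1" using \<eta>_pos \<eta>_le(1) by (intro mult_left_mono) auto
  then show "bnd 4 (nextE U E) (4 * \<eta>)"
    using bnd_add[OF bnd_uminus[OF U'] bnd_uminus[OF bnd_conv[OF U' E]]]
    unfolding nextE_def[abs_def] by (auto elim!: bnd_mono)
qed

lemma bnd_iter: "bnd 4 (fst (iter n)) (2 * \<eta>)" "bnd 4 (snd (iter n)) (4 * \<eta>)"
proof (induction n)
  case 0
  have "bnd 4 (\<lambda>_. 0) K" if "0 \<le> K" for K using that by (simp add: bnd_def)
  then show "bnd 4 (fst (iter 0)) (2 * \<eta>)" "bnd 4 (snd (iter 0)) (4 * \<eta>)" using \<eta>_pos by auto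
qed (use bnd_next in auto)

subsection \<open>The fixed point\<close>

lemma next_0: "nextU U E 0 = 0" "nextE U E 0 = 0"
  by (auto simp: nextE_def nextU_def resolvent_def frq_0 conv_0)

lemma iter_0: "fst (iter n) 0 = 0" "snd (iter n) 0 = 0"
  by (cases n; simp add: next_0)+

text \<open>
  One step fixes one more degree, so the iteration becomes stationary in each coefficient.
\<close>

lemma agree_next:
  assumes "agree m U U'" "agree m E E'" "U 0 = 0" "U' 0 = 0" "E 0 = 0" "E' 0 = 0"
  shows "agree (Suc m) (nextU U E) (nextU U' E')" "agree (Suc m) (nextE U E) (nextE U' E')"
proof -
  have J: "agree n (J a) (J b)" "agree n (H a) (H b)" "agree n (mean a) (mean b)" if "agree n a b" for n a b
    using that by (auto simp: agree_def J_def H_def mean_def)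
  have EE: "agree m (\<lambda>i. 2 * E i + conv E E i) (\<lambda>i. 2 * E' i + conv E' E' i)"
    using agree_conv[OF assms(2,2)] assms(2) by (auto simp: agree_def)
  have G: "agree (Suc m) (G2 U E) (G2 U' E')"
    using agreeD[OF J(1)[OF agree_Suc_conv[OF assms(1,2,3,4,5,6)]]]
      agreeD[OF J(2)[OF agree_Suc_conv[OF assms(2,2,5,6,5,6)]]]
      agreeD[OF agree_Suc_conv[OF assms(2) J(2)[OF EE] assms(5,6)]] assms
    by (auto simp: agree_def G2_def H_def conv_0)
  then have G': "agree m (G2 U E) (G2 U' E')" by (auto simp: agree_def)
  have G0: "G2 U E 0 = 0" "G2 U' E' 0 = 0" using assms by (auto simp: G2_def J_def H_def conv_0)
  have "agree (Suc m) (conv (mean (G2 U E)) U) (conv (mean (G2 U' E')) U')"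
    by (rule agree_Suc_conv[OF J(3)[OF G'] assms(1)]) (use G0 assms in \<open>auto simp: mean_def\<close>)
  then have "agree (Suc m) (B U E) (B U' E')"
    using G J(3)[OF G] by (auto simp: agree_def B_def)
  then show U': "agree (Suc m) (nextU U E) (nextU U' E')"
    by (auto simp: agree_def nextU_def resolvent_def)
  then have "agree m (nextU U E) (nextU U' E')" by (auto simp: agree_def)
  from agree_Suc_conv[OF this assms(2)] U' assms
  show "agree (Suc m) (nextE U E) (nextE U' E')"
    by (auto simp: agree_def nextE_def next_0)
qed

lemma agree_iter: "agree n (fst (iter n)) (fst (iter (n + k))) \<and> agree n (snd (iter n)) (snd (iter (n + k)))"
proof (induction n)
  case 0 show ?case by (simp add: agree_def)
next
  case (Suc n)
  then show ?case using agree_next[of n "fst (iter n)" "fst (iter (n + k))" "snd (iter n)" "snd (iter (n + k))"]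
    by (simp add: iter_0)
qed

text \<open>
  A coefficient of degree \<open>d\<close> no longer changes after \<open>d + 1\<close> steps.
\<close>

definition U :: series where "U i = fst (iter (Suc (deg i))) i"
definition E :: series where "E i = snd (iter (Suc (deg i))) i"

lemma iter_limit: "deg i < n \<Longrightarrow> fst (iter n) i = U i" "deg i < n \<Longrightarrow> snd (iter n) i = E i"
  using agree_iter[of "Suc (deg i)" "n - Suc (deg i)"] by (auto simp: agree_def U_def E_def simp del: iter.simps)

lemma bnd_U: "bnd 4 U (2 * \<eta>)" and bnd_E: "bnd 4 E (4 * \<eta>)"
  using bnd_limit[OF bnd_iter(1), where b = U] bnd_limit[OF bnd_iter(2), where b = E] iter_limit by (meson Suc_le_lessD)+

lemma UE_0: "U 0 = 0" "E 0 = 0" by (auto simp: U_def E_def iter_0 next_0)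

lemma UE_fixed: "nextU U E = U" "nextE U E = E"
proof -
  have "nextU U E i = U i \<and> nextE U E i = E i" for i
  proof -
    have "agree (deg i) U (fst (iter (deg i)))" "agree (deg i) E (snd (iter (deg i)))"
      by (auto simp: agree_def iter_limit)
    from agree_next[OF this(1) this(2) UE_0(1) iter_0(1) UE_0(2) iter_0(2)]
    show ?thesis by (auto simp: agree_def U_def[of i] E_def[of i])
  qed
  then show "nextU U E = U" "nextE U E = E" by auto
qed

lemma hermitian_multipliers: "hermitian a \<Longrightarrow> hermitian (J a)" "hermitian a \<Longrightarrow> hermitian (H a)" "hermitian a \<Longrightarrow> hermitian (mean a)"
  by (auto simp: hermitian_def J_def H_def mean_def frq_swap)

lemma hermitian_G2:
  assumes "hermitian V" "hermitian W"
  shows "hermitian (G2 V W)"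
proof -
  have "hermitian (\<lambda>i. 2 * W i + conv W W i)" using assms hermitian_conv[OF assms(2,2)] by (auto simp: hermitian_def)
  from hermitian_conv[OF assms(2) hermitian_multipliers(2)[OF this]] hermitian_multipliers(1)[OF hermitian_conv[OF assms]]
    hermitian_multipliers(2)[OF hermitian_conv[OF assms(2,2)]]
  show ?thesis by (auto simp: hermitian_def G2_def)
qed

lemma hermitian_next:
  assumes "hermitian V" "hermitian W"
  shows "hermitian (nextU V W)" "hermitian (nextE V W)"
proof -
  note G = hermitian_G2[OF assms]
  from G hermitian_multipliers(3)[OF G] hermitian_conv[OF hermitian_multipliers(3)[OF G] assms(1)]
  have "hermitian (B V W)" by (auto simp: hermitian_def B_def frq_swap)
  moreover have "growth c (- y) = growth c y" for y by (simp add: growth_def)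
  ultimately show U: "hermitian (nextU V W)"
    by (auto simp: hermitian_def nextU_def resolvent_def frq_swap deg_swap)
  from this hermitian_conv[OF U assms(2)] show "hermitian (nextE V W)" by (auto simp: hermitian_def nextE_def)
qed

lemma hermitian_UE: "hermitian U" "hermitian E"
proof -
  have "hermitian (fst (iter n)) \<and> hermitian (snd (iter n))" for n
    by (induction n) (use hermitian_next in \<open>auto simp: hermitian_def[of "\<lambda>_. 0"]\<close>)
  then show "hermitian U" "hermitian E" by (auto simp: hermitian_def U_def E_def deg_swap simp del: iter.simps)
qed

definition G :: series where "G i = (if i = 0 then of_real c else 0) - J U i + G2 U E i"

lemma U_excluded: "frq i \<in> {0, 1, -1} \<Longrightarrow> U i = 0"
  using UE_fixed(1) by (metis nextU_def resolvent_def)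

text \<open>
  Multiplication by a function of time alone keeps frequencies, hence the excluded ones stay absent.
\<close>

lemma conv_mean_excluded:
  assumes "frq i \<in> {0, 1, -1}"
  shows "conv (mean a) U i = 0"
  unfolding conv_def
proof (rule sum.neutral, rule ballI)
  fix z assume "z \<in> {(p, q). p + q = i}"
  then obtain p q where pq: "z = (p, q)" and "p + q = i" by auto
  then have "frq i = frq p + frq q" using frq_add by metis
  then show "(case z of (p, q) \<Rightarrow> mean a p * U q) = 0" using U_excluded[of q] assms by (auto simp: mean_def pq)
qed

lemma G2_0: "G2 U E 0 = 0"
  by (simp add: G2_def J_def H_def conv_0 UE_0)

lemma low_degree_B: "deg i \<le> 1 \<Longrightarrow> B U E i = 0"
proof -
  assume i: "deg i \<le> 1"
  have cv: "conv a b i = 0" if "a 0 = 0" "b 0 = 0" for a b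
    unfolding conv_def
  proof (rule sum.neutral, rule ballI)
    fix z assume "z \<in> {(p, q). p + q = i}"
    then obtain p q where pq: "z = (p, q)" and "p + q = i" by auto
    then have "deg p = 0 \<or> deg q = 0" using i by (auto simp: deg_add)
    then show "(case z of (p, q) \<Rightarrow> a p * b q) = 0" using that deg_eq_0_iff[of p] deg_eq_0_iff[of q] by (auto simp: pq)
  qed
  have "G2 U E i = 0" by (simp add: G2_def J_def H_def cv UE_0 conv_0)
  then show ?thesis by (simp add: B_def cv UE_0 mean_def G2_0)
qed

text \<open>
  The flow in the form linear part plus quadratic remainder, at all indices: at the excluded frequencies both sides
  vanish, in degree one the growth rate of the mode is \<^term>\<open>\<mu>\<close> itself.
\<close>

lemma U_equation: "of_real (real (deg i) * \<mu>) * U i = of_real (growth c (frq i)) * U i + B U E i"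
proof (cases "frq i \<in> {0, 1, -1}")
  case True
  have "B U E i = 0"
    using True unfolding B_def conv_mean_excluded[OF True] by (auto simp: mean_def)
  then show ?thesis using U_excluded[OF True] by simp
next
  case False
  show ?thesis
  proof (cases "deg i \<le> 1")
    case True
    then have "deg i = 1" using False frq_0 deg_eq_0_iff[of i] by (cases "deg i = 0") auto
    moreover from this have "growth c (frq i) = \<mu>"
      using deg_1_iff[of i] \<mu>_eq by (auto simp: frq_def growth_def)
    ultimately show ?thesis using low_degree_B[OF True] by simp
  next
    case deg: False
    have "0 < \<kappa> * (1 + \<bar>frq i\<bar>) ^ 4" using \<kappa>_pos by (intro mult_pos_pos zero_less_power) auto
    then have ne: "real (deg i) * \<mu> - growth c (frq i) \<noteq> 0"
      using gap[of "fst i" "snd i"] False deg by (auto simp: frq_def deg_def)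
    have "U i = B U E i / of_real (real (deg i) * \<mu> - growth c (frq i))"
      using UE_fixed(1) False deg by (metis nextU_def resolvent_def)
    then have "U i * of_real (real (deg i) * \<mu> - growth c (frq i)) = B U E i"
      using ne nonzero_eq_divide_eq[of "of_real (real (deg i) * \<mu> - growth c (frq i))" "U i"] of_real_eq_0_iff by blast
    then show ?thesis by (simp add: algebra_simps)
  qed
qed

lemma conv_one: "conv (\<lambda>i. if i = 0 then k else 0) b i = k * b i"
proof -
  have "conv (\<lambda>i. if i = 0 then k else 0) b i = (\<Sum>z\<in>{(0 :: nat \<times> nat, i)}. (case z of (p, q) \<Rightarrow> (if p = 0 then k else 0) * b q))"
    unfolding conv_def by (rule sum.mono_neutral_right[OF finite_splittings]) (auto split: if_splits simp: zero_prod_def)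
  then show ?thesis by simp
qed

lemma conv_add_left: "conv (\<lambda>i. a i + b i) d i = conv a d i + conv b d i"
  by (simp add: conv_def distrib_right sum.distrib case_prod_unfold)

lemma mean_G: "mean G i = (if i = 0 then of_real c else 0) + mean (G2 U E) i"
  using U_excluded[of i] by (auto simp: mean_def G_def J_def frq_0)

text \<open>
  The equation \<open>r' = G + G'' - <G> r\<close> for \<open>r = 1 + U\<close>, coefficient by coefficient.
\<close>

lemma U_flow: "of_real (real (deg i) * \<mu>) * U i = of_real (1 - (frq i)\<^sup>2) * G i - mean G i - conv (mean G) U i"
proof -
  have "conv (mean G) U i = of_real c * U i + conv (mean (G2 U E)) U i"
    unfolding mean_G[abs_def] conv_add_left conv_one by simp
  moreover have "of_real (1 - (frq i)\<^sup>2) * (- J U i) - of_real c * U i = of_real (growth c (frq i)) * U i"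
    by (simp add: J_def growth_def algebra_simps power2_eq_square power4_eq_xxxx)
  moreover have "of_real (1 - (frq i)\<^sup>2) * (if i = 0 then of_real c else 0) = (if i = 0 then of_real c else (0::complex))"
    by (simp add: frq_0)
  ultimately show ?thesis
    unfolding U_equation[of i] B_def G_def[of i] mean_G by (simp add: algebra_simps)
qed

lemma E_equation: "E i = - U i - conv U E i"
  using UE_fixed by (metis nextE_def)

text \<open>
  The first coefficient of the mean of \<open>E\<close> is positive: the mean of \<open>E = - U + U\<^sup>2 - \<dots>\<close> starts with the mean of
  \<open>U\<^sup>2\<close>. It decides that the oscillation of the curvature increases.
\<close>

lemma E_11: "E (1, 1) = of_real (2 * amp\<^sup>2)"
proof -
  have U1: "U (1, 0) = of_real amp" "U (0, 1) = of_real amp"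
    using x_generic by (subst UE_fixed(1)[symmetric], auto simp: nextU_def resolvent_def frq_def deg_def)+
  have split: "{(p, q). p + q = ((1, 0) :: nat \<times> nat)} = {((0, 0), (1, 0)), ((1, 0), (0, 0))}"
    "{(p, q). p + q = ((0, 1) :: nat \<times> nat)} = {((0, 0), (0, 1)), ((0, 1), (0, 0))}"
    "{(p, q). p + q = ((1, 1) :: nat \<times> nat)} = {((0, 0), (1, 1)), ((1, 1), (0, 0)), ((1, 0), (0, 1)), ((0, 1), (1, 0))}"
    by (auto simp: add_is_1)
  have cv: "conv a b (1, 0) = a (0, 0) * b (1, 0) + a (1, 0) * b (0, 0)"
    "conv a b (0, 1) = a (0, 0) * b (0, 1) + a (0, 1) * b (0, 0)"
    "conv a b (1, 1) = a (0, 0) * b (1, 1) + a (1, 1) * b (0, 0) + a (1, 0) * b (0, 1) + a (0, 1) * b (1, 0)" for a b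
    unfolding conv_def split by simp_all
  have z: "U (0, 0) = 0" "E (0, 0) = 0" using UE_0 by (auto simp: zero_prod_def)
  have "E (1, 0) = - of_real amp" "E (0, 1) = - of_real amp"
    by (subst E_equation, simp add: cv[unfolded One_nat_def] z U1[unfolded One_nat_def])+
  moreover have "U (1, 1) = 0" by (rule U_excluded) (simp add: frq_def)
  ultimately show ?thesis
    by (subst E_equation) (simp add: cv[unfolded One_nat_def] z[unfolded One_nat_def] U1[unfolded One_nat_def] power2_eq_square)
qed

end

section \<open>Summation of the series\<close>

context unstable_mode
begin

text \<open>
  Here all the waves are bounded by one.
\<close>

definition \<Omega> :: "(complex \<times> complex) set" where
  "\<Omega> = {p. \<mu> * Re (snd p) + \<bar>x\<bar> * \<bar>Im (fst p)\<bar> < 0}"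

definition wave :: "nat \<times> nat \<Rightarrow> complex \<times> complex \<Rightarrow> complex" where
  "wave i p = exp (of_real (real (deg i) * \<mu>) * snd p + \<i> * of_real (frq i) * fst p)"

definition ev :: "series \<Rightarrow> complex \<times> complex \<Rightarrow> complex" where
  "ev a p = (\<Sum>\<^sub>\<infinity>i. a i * wave i p)"

definition l1 :: "series \<Rightarrow> bool" where "l1 a \<longleftrightarrow> (\<lambda>i. norm (a i)) summable_on UNIV"

definition ddtheta :: "series \<Rightarrow> series" where "ddtheta a i = \<i> * of_real (frq i) * a i"

lemma open_\<Omega>: "open \<Omega>"
  unfolding \<Omega>_def by (intro open_Collect_less continuous_intros)

lemma wave_add: "wave (i + j) p = wave i p * wave j p"
  by (simp add: wave_def deg_add frq_add exp_add[symmetric] algebra_simps)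

lemma norm_wave_le_1: "p \<in> \<Omega> \<Longrightarrow> norm (wave i p) \<le> 1"
proof -
  assume "p \<in> \<Omega>"
  then have p: "\<mu> * Re (snd p) + \<bar>x\<bar> * \<bar>Im (fst p)\<bar> < 0" by (simp add: \<Omega>_def)
  have "- (frq i * Im (fst p)) \<le> \<bar>frq i\<bar> * \<bar>Im (fst p)\<bar>"
    by (metis abs_ge_minus_self abs_mult)
  also have "\<dots> \<le> (real (deg i) * \<bar>x\<bar>) * \<bar>Im (fst p)\<bar>"
    by (rule mult_right_mono[OF abs_frq_le]) simp
  finally have "Re (of_real (real (deg i) * \<mu>) * snd p + \<i> * of_real (frq i) * fst p)
      \<le> real (deg i) * (\<mu> * Re (snd p) + \<bar>x\<bar> * \<bar>Im (fst p)\<bar>)"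
    by (simp add: algebra_simps)
  also have "\<dots> \<le> 0" using p by (intro mult_nonneg_nonpos) auto
  finally show ?thesis by (simp add: wave_def)
qed

lemma bnd_l1: "bnd s a K \<Longrightarrow> l1 a"
proof -
  assume "bnd s a K"
  then have "bnd 0 a K" by (rule bnd_lower) simp
  then have "(\<Sum>i\<in>F. norm (a i)) \<le> K" if "finite F" for F using bndD[of 0 a K F] that by simp
  then show ?thesis unfolding l1_def
    by (intro nonneg_bdd_above_summable_on) (auto intro!: bdd_aboveI)
qed

lemma l1_le:
  assumes "l1 a" "\<And>i. norm (b i) \<le> C * norm (a i)"
  shows "l1 b"
  unfolding l1_def
  by (rule Infinite_Sum.abs_summable_on_comparison_test'[OF summable_on_cmult_right[OF assms(1)[unfolded l1_def]] assms(2)])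

lemma l1_bnd: "l1 a \<Longrightarrow> bnd 0 a (\<Sum>\<^sub>\<infinity>i. norm (a i))"
  unfolding l1_def by (auto intro!: bndI finite_sum_le_infsum)

lemma l1_add: "l1 a \<Longrightarrow> l1 b \<Longrightarrow> l1 (\<lambda>i. a i + b i)"
  by (rule bnd_l1[OF bnd_add[OF l1_bnd l1_bnd]])

lemma l1_cmult: "l1 a \<Longrightarrow> l1 (\<lambda>i. k * a i)"
  by (rule l1_le[of a _ "norm k"]) (auto simp: norm_mult)

lemma l1_one: "l1 (\<lambda>i. if i = 0 then k else 0)"
proof -
  have "bnd 0 (\<lambda>i. if i = 0 then k else 0) (norm k)"
    by (rule bndI) (auto simp: if_distrib[of norm] cong: if_cong)
  then show ?thesis by (rule bnd_l1)
qed

lemma ev_abs_summable: "l1 a \<Longrightarrow> p \<in> \<Omega> \<Longrightarrow> (\<lambda>i. norm (a i * wave i p)) summable_on UNIV"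
  unfolding l1_def
  by (rule Infinite_Sum.abs_summable_on_comparison_test) (auto simp: norm_mult intro!: mult_left_le norm_wave_le_1)

lemma ev_has_sum: "l1 a \<Longrightarrow> p \<in> \<Omega> \<Longrightarrow> ((\<lambda>i. a i * wave i p) has_sum ev a p) UNIV"
  unfolding ev_def by (rule has_sum_infsum[OF abs_summable_summable[OF ev_abs_summable]])

lemma ev_eqI: "((\<lambda>i. a i * wave i p) has_sum s) UNIV \<Longrightarrow> ev a p = s"
  unfolding ev_def by (rule infsumI)

lemma ev_add: "l1 a \<Longrightarrow> l1 b \<Longrightarrow> p \<in> \<Omega> \<Longrightarrow> ev (\<lambda>i. a i + b i) p = ev a p + ev b p"
  by (rule ev_eqI, subst distrib_right, rule has_sum_add) (rule ev_has_sum; assumption)+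

lemma ev_cmult: "ev (\<lambda>i. k * a i) p = k * ev a p"
  unfolding ev_def mult.assoc by (rule infsum_cmult_right')

lemma ev_one: "ev (\<lambda>i. if i = 0 then k else 0) p = k"
proof -
  have "ev (\<lambda>i. if i = 0 then k else 0) p = (\<Sum>\<^sub>\<infinity>i\<in>{0}. k * wave i p)"
    unfolding ev_def by (rule infsum_cong_neutral) auto
  then show ?thesis by (simp add: wave_def deg_def frq_0)
qed

lemma norm_ev_le: "bnd 0 a K \<Longrightarrow> p \<in> \<Omega> \<Longrightarrow> norm (ev a p) \<le> K"
proof -
  assume a: "bnd 0 a K" and p: "p \<in> \<Omega>"
  have s: "l1 a" by (rule bnd_l1[OF a])
  have "norm (ev a p) \<le> (\<Sum>\<^sub>\<infinity>i. norm (a i * wave i p))"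
    unfolding ev_def by (rule norm_infsum_bound[OF ev_abs_summable[OF s p]])
  also have "\<dots> \<le> K"
  proof (rule infsum_le_finite_sums[OF ev_abs_summable[OF s p]])
    fix F :: "(nat \<times> nat) set" assume F: "finite F"
    have "(\<Sum>i\<in>F. norm (a i * wave i p)) \<le> (\<Sum>i\<in>F. norm (a i) * (1 + \<bar>frq i\<bar>) ^ 0)"
      by (intro sum_mono) (use norm_wave_le_1[OF p] in \<open>auto simp: norm_mult intro!: mult_left_le\<close>)
    then show "(\<Sum>i\<in>F. norm (a i * wave i p)) \<le> K" using bndD[OF a F] by simp
  qed
  finally show ?thesis .
qed

text \<open>
  Rearrangement of an absolutely summable product family along the sums of indices.
\<close>

lemma ev_conv:
  assumes "l1 a" "l1 b" "p \<in> \<Omega>"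
  shows "ev (conv a b) p = ev a p * ev b p"
proof -
  let ?f = "\<lambda>i. a i * wave i p" and ?g = "\<lambda>i. b i * wave i p"
  let ?S = "SIGMA i:(UNIV :: (nat \<times> nat) set). {(u, v). u + v = i}"
  have f: "(\<lambda>i. norm (?f i)) summable_on UNIV" and g: "(\<lambda>i. norm (?g i)) summable_on UNIV"
    using ev_abs_summable assms by auto
  have "(\<lambda>z. norm (case z of (u, v) \<Rightarrow> ?f u * ?g v)) summable_on UNIV \<times> UNIV"
    unfolding Infinite_Sum.abs_summable_on_Sigma_iff
  proof (intro conjI ballI)
    show "(\<lambda>v. norm (case (u, v) of (u, v) \<Rightarrow> ?f u * ?g v)) summable_on UNIV" for u
      using summable_on_cmult_right[OF g, of "norm (?f u)"] by (simp add: norm_mult)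
    have "(\<Sum>\<^sub>\<infinity>v. norm (case (u, v) of (u, v) \<Rightarrow> ?f u * ?g v)) = norm (?f u) * (\<Sum>\<^sub>\<infinity>v. norm (?g v))" for u
      unfolding prod.case norm_mult[of "?f u"] by (rule infsum_cmult_right')
    then show "(\<lambda>u. norm (\<Sum>\<^sub>\<infinity>v. norm (case (u, v) of (u, v) \<Rightarrow> ?f u * ?g v))) summable_on UNIV"
      using summable_on_cmult_left[OF f, of "\<bar>\<Sum>\<^sub>\<infinity>v. norm (?g v)\<bar>"] by (simp add: abs_mult)
  qed
  then have fg: "(\<lambda>(u, v). ?f u * ?g v) summable_on UNIV \<times> UNIV"
    by (rule abs_summable_summable)
  have "ev a p * ev b p = (\<Sum>\<^sub>\<infinity>u. ?f u * (\<Sum>\<^sub>\<infinity>v. ?g v))"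
    unfolding ev_def by (rule infsum_cmult_left'[symmetric])
  also have "\<dots> = (\<Sum>\<^sub>\<infinity>u. \<Sum>\<^sub>\<infinity>v. ?f u * ?g v)"
    by (simp only: infsum_cmult_right')
  also have "\<dots> = (\<Sum>\<^sub>\<infinity>(u, v)\<in>UNIV \<times> UNIV. ?f u * ?g v)"
    by (rule infsum_Sigma'_banach[OF fg])
  also have "\<dots> = (\<Sum>\<^sub>\<infinity>(i, z)\<in>?S. case z of (u, v) \<Rightarrow> ?f u * ?g v)"
    by (rule infsum_reindex_bij_witness[of _ snd "\<lambda>z. (fst z + snd z, z)"]) auto
  also have "\<dots> = (\<Sum>\<^sub>\<infinity>i. \<Sum>\<^sub>\<infinity>z\<in>{(u, v). u + v = i}. case z of (u, v) \<Rightarrow> ?f u * ?g v)"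
  proof (rule infsum_Sigma'_banach[symmetric])
    have "((\<lambda>(i, z). case z of (u, v) \<Rightarrow> ?f u * ?g v) summable_on ?S) = ((\<lambda>(u, v). ?f u * ?g v) summable_on UNIV \<times> UNIV)"
      by (rule summable_on_reindex_bij_witness[of _ "\<lambda>z. (fst z + snd z, z)" snd]) auto
    then show "(\<lambda>(i, z). case z of (u, v) \<Rightarrow> ?f u * ?g v) summable_on ?S" using fg by simp
  qed
  also have "\<dots> = (\<Sum>\<^sub>\<infinity>i. conv a b i * wave i p)"
  proof (rule infsum_cong)
    fix i
    have "(\<Sum>\<^sub>\<infinity>z\<in>{(u, v). u + v = i}. case z of (u, v) \<Rightarrow> ?f u * ?g v) = (\<Sum>z\<in>{(u, v). u + v = i}. case z of (u, v) \<Rightarrow> ?f u * ?g v)"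
      by (rule infsum_finite[OF finite_splittings])
    also have "\<dots> = (\<Sum>z\<in>{(u, v). u + v = i}. (case z of (u, v) \<Rightarrow> a u * b v) * wave i p)"
    proof (rule sum.cong)
      fix z assume "z \<in> {(u, v). u + v = i}"
      then obtain u v where "z = (u, v)" "u + v = i" by auto
      then show "(case z of (u, v) \<Rightarrow> ?f u * ?g v) = (case z of (u, v) \<Rightarrow> a u * b v) * wave i p"
        using wave_add[of u v p] by simp
    qed simp
    finally show "(\<Sum>\<^sub>\<infinity>z\<in>{(u, v). u + v = i}. case z of (u, v) \<Rightarrow> ?f u * ?g v) = conv a b i * wave i p"
      by (simp add: conv_def sum_distrib_right)
  qed
  finally show ?thesis by (simp add: ev_def)
qed

lemma l1_conv:
  assumes "l1 a" "l1 b" shows "l1 (conv a b)"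
proof -
  from bnd_conv[OF l1_bnd[OF assms(1)] l1_bnd[OF assms(2)]] show ?thesis by (rule bnd_l1)
qed

text \<open>
  On \<open>\<Omega>\<close> the finite partial sums converge uniformly by the Weierstrass test, so the series may be differentiated
  term by term, even where the differentiated series is not known to be absolutely summable.
\<close>

lemma hol2_wave: "hol2 (\<lambda>p. a * wave i p) S"
  unfolding wave_def by (intro hol2_intros)

lemma hol2_sum: "(\<And>i. i \<in> F \<Longrightarrow> hol2 (f i) S) \<Longrightarrow> hol2 (\<lambda>p. \<Sum>i\<in>F. f i p) S"
  by (induction F rule: infinite_finite_induct) (auto intro!: hol2_intros)

lemma pd_partial_sum:
  "pd1 (\<lambda>p. \<Sum>i\<in>F. a i * wave i p) p = (\<Sum>i\<in>F. ddtheta a i * wave i p)"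
  "pd2 (\<lambda>p. \<Sum>i\<in>F. a i * wave i p) p = (\<Sum>i\<in>F. (of_real (real (deg i) * \<mu>) * a i) * wave i p)"
proof -
  have "((\<lambda>z. a i * wave i (z, snd p)) has_field_derivative ddtheta a i * wave i p) (at (fst p))" for i
    unfolding wave_def ddtheta_def fst_conv snd_conv by (rule derivative_eq_intros | simp)+
  then have "((\<lambda>z. \<Sum>i\<in>F. a i * wave i (z, snd p)) has_field_derivative (\<Sum>i\<in>F. ddtheta a i * wave i p)) (at (fst p))"
    by (intro DERIV_sum)
  then show "pd1 (\<lambda>p. \<Sum>i\<in>F. a i * wave i p) p = (\<Sum>i\<in>F. ddtheta a i * wave i p)"
    unfolding pd1_def by (rule DERIV_imp_deriv)
  have "((\<lambda>z. a i * wave i (fst p, z)) has_field_derivative (of_real (real (deg i) * \<mu>) * a i) * wave i p) (at (snd p))" for i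
    unfolding wave_def fst_conv snd_conv by (rule derivative_eq_intros | simp)+
  then have "((\<lambda>z. \<Sum>i\<in>F. a i * wave i (fst p, z)) has_field_derivative (\<Sum>i\<in>F. (of_real (real (deg i) * \<mu>) * a i) * wave i p)) (at (snd p))"
    by (intro DERIV_sum)
  then show "pd2 (\<lambda>p. \<Sum>i\<in>F. a i * wave i p) p = (\<Sum>i\<in>F. (of_real (real (deg i) * \<mu>) * a i) * wave i p)"
    unfolding pd2_def by (rule DERIV_imp_deriv)
qed

lemma
  assumes a: "l1 a"
  shows hol2_ev: "hol2 (ev a) \<Omega>"
    and pd1_ev: "p \<in> \<Omega> \<Longrightarrow> pd1 (ev a) p = ev (ddtheta a) p"
    and pd2_ev: "p \<in> \<Omega> \<Longrightarrow> pd2 (ev a) p = ev (\<lambda>i. of_real (real (deg i) * \<mu>) * a i) p"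
proof -
  have u: "uniform_limit \<Omega> (\<lambda>F p. \<Sum>i\<in>F. a i * wave i p) (ev a) (finite_subsets_at_top UNIV)"
    unfolding ev_def[abs_def]
    by (rule Weierstrass_m_test_general[where M = "\<lambda>i. norm (a i)"])
      (use a in \<open>auto simp: l1_def norm_mult intro!: mult_left_le norm_wave_le_1\<close>)
  note lim = hol2_uniform_limit[OF open_\<Omega> hol2_sum[OF hol2_wave] u finite_subsets_at_top_neq_bot, unfolded pd_partial_sum]
  show "hol2 (ev a) \<Omega>" by (rule lim(1))
  show "p \<in> \<Omega> \<Longrightarrow> pd1 (ev a) p = ev (ddtheta a) p"
    using lim(2) by (intro ev_eqI[symmetric]) (simp add: has_sum_def)
  show "p \<in> \<Omega> \<Longrightarrow> pd2 (ev a) p = ev (\<lambda>i. of_real (real (deg i) * \<mu>) * a i) p"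
    using lim(3) by (intro ev_eqI[symmetric]) (simp add: has_sum_def)
qed

lemma ev_real:
  assumes "hermitian a" "fst p \<in> \<real>" "snd p \<in> \<real>"
  shows "ev a p \<in> \<real>"
proof -
  have ch: "cnj (wave i p) = wave (prod.swap i) p" for i
    using assms(2,3) unfolding wave_def exp_cnj by (auto simp: frq_swap deg_swap Reals_cnj_iff)
  have "cnj (ev a p) = (\<Sum>\<^sub>\<infinity>i. cnj (a i * wave i p))"
    unfolding ev_def by (rule infsum_cnj[symmetric])
  also have "\<dots> = (\<Sum>\<^sub>\<infinity>i. a (prod.swap i) * wave (prod.swap i) p)"
    using assms(1) by (simp add: ch hermitian_def)
  also have "\<dots> = ev a p"
    unfolding ev_def by (rule infsum_reindex_bij_witness[of _ prod.swap prod.swap]) auto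
  finally show ?thesis by (simp add: Reals_cnj_iff)
qed

lemma ev_periodic:
  assumes "x * q = 2 * pi * of_int n"
  shows "ev a (\<theta> + of_real q, \<tau>) = ev a (\<theta>, \<tau>)"
proof -
  have "wave i (\<theta> + of_real q, \<tau>) = wave i (\<theta>, \<tau>)" for i
  proof -
    have "frq i * q = of_int ((int (fst i) - int (snd i)) * n) * (pi * 2)"
      unfolding frq_def mult.assoc assms by simp
    then have "of_real (frq i) * of_real q = (of_int ((int (fst i) - int (snd i)) * n) * (of_real pi * 2) :: complex)"
      unfolding of_real_mult[symmetric] by simp
    then have "exp (\<i> * of_real (frq i) * of_real q) = (1 :: complex)"
      unfolding mult.assoc by (simp only: exp_2pi_1_int)
    then show ?thesis by (simp add: wave_def exp_add distrib_left)
  qed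
  then show ?thesis by (simp add: ev_def)
qed

end

section \<open>The curve parametrized by its tangent angle\<close>

context unstable_mode
begin

lemma bnd_ddtheta: "bnd (Suc s) a K \<Longrightarrow> bnd s (ddtheta a) K"
proof -
  assume "bnd (Suc s) a K"
  then have "bnd s (ddtheta a) (1 * K)"
  proof (rule bnd_transfer)
    fix i
    have "\<bar>frq i\<bar> * (norm (a i) * (1 + \<bar>frq i\<bar>) ^ s) \<le> (1 + \<bar>frq i\<bar>) * (norm (a i) * (1 + \<bar>frq i\<bar>) ^ s)"
      by (rule mult_right_mono) auto
    then show "norm (ddtheta a i) * (1 + \<bar>frq i\<bar>) ^ s \<le> 1 * (norm (a i) * (1 + \<bar>frq i\<bar>) ^ Suc s)"
      by (simp add: ddtheta_def norm_mult mult_ac)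
  qed simp
  then show ?thesis by simp
qed

lemma pd1_pd1_ev:
  assumes "l1 a" "l1 (ddtheta a)" "p \<in> \<Omega>"
  shows "pd1 (pd1 (ev a)) p = ev (ddtheta (ddtheta a)) p"
  using pd_cong(1)[OF open_\<Omega> pd1_ev[OF assms(1)] assms(3)] pd1_ev[OF assms(2,3)] by simp

text \<open>
  The square of the curvature \<open>1 + E\<close>.
\<close>

definition Q :: series where "Q i = (if i = 0 then 1 else 0) + (2 * E i + conv E E i)"

abbreviation curv :: "complex \<times> complex \<Rightarrow> complex" where "curv p \<equiv> 1 + ev E p"
abbreviation radius :: "complex \<times> complex \<Rightarrow> complex" where "radius p \<equiv> 1 + ev U p"

lemma l1_U: "l1 U" and l1_E: "l1 E"
  using bnd_l1[OF bnd_U] bnd_l1[OF bnd_E] by auto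

lemma l1_G: "l1 G" "l1 (ddtheta G)" "\<exists>K. bnd 0 (ddtheta G) K" "\<exists>K. bnd 2 G K"
proof -
  have "bnd 2 (\<lambda>i. if i = 0 then complex_of_real c else 0) (norm (complex_of_real c))"
    by (rule bndI) (auto simp: if_distrib[of norm] frq_0 if_distrib[of "\<lambda>u. u * _"] cong: if_cong)
  from bnd_add[OF bnd_add[OF this bnd_uminus[OF bnd_J[OF bnd_U]]] bnd_G2[OF bnd_U bnd_E]]
  obtain K where K: "bnd 2 G K" unfolding G_def[abs_def] by auto
  then have dG: "bnd 1 (ddtheta G) K" by (intro bnd_ddtheta) (simp add: numeral_2_eq_2)
  show "l1 G" "l1 (ddtheta G)" "\<exists>K. bnd 0 (ddtheta G) K" "\<exists>K. bnd 2 G K"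
    using bnd_l1[OF K] bnd_l1[OF dG] bnd_lower[OF dG, of 0] K by auto
qed

lemma bnd_2E: "\<exists>K. bnd 4 (\<lambda>i. 2 * E i + conv E E i) K"
  using bnd_add[OF bnd_cmult[OF bnd_E, of 2] bnd_conv[OF bnd_E bnd_E]] by auto

lemma l1_Q: "l1 Q" "l1 (ddtheta Q)" "l1 (ddtheta (ddtheta Q))"
proof -
  have "bnd 4 (\<lambda>i. if i = 0 then 1 else 0) 1"
    by (rule bndI) (auto simp: if_distrib[of norm] frq_0 if_distrib[of "\<lambda>u. u * _"] cong: if_cong)
  then obtain K where K: "bnd 4 Q K" unfolding Q_def[abs_def] using bnd_2E bnd_add by blast
  then have "bnd 3 (ddtheta Q) K" using bnd_ddtheta[of 3 Q K] by simp
  moreover from this have "bnd 2 (ddtheta (ddtheta Q)) K" using bnd_ddtheta[of 2 "ddtheta Q" K] by simp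
  ultimately show "l1 Q" "l1 (ddtheta Q)" "l1 (ddtheta (ddtheta Q))" using K bnd_l1 by auto
qed

lemma ev_Q: "p \<in> \<Omega> \<Longrightarrow> ev Q p = curv p * curv p"
proof -
  assume p: "p \<in> \<Omega>"
  have "ev Q p = 1 + (2 * ev E p + ev E p * ev E p)"
    unfolding Q_def[abs_def]
    by (simp only: ev_add[OF l1_one l1_add[OF l1_cmult[OF l1_E] l1_conv[OF l1_E l1_E]] p]
      ev_add[OF l1_cmult[OF l1_E] l1_conv[OF l1_E l1_E] p] ev_one ev_cmult ev_conv[OF l1_E l1_E p])
  then show ?thesis by (simp add: algebra_simps)
qed

lemma radius_curv: "p \<in> \<Omega> \<Longrightarrow> radius p * curv p = 1"
proof -
  assume p: "p \<in> \<Omega>"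
  have "E = (\<lambda>i. (-1) * U i + (-1) * conv U E i)" using E_equation by (auto simp: fun_eq_iff)
  then have "ev E p = ev (\<lambda>i. (-1) * U i + (-1) * conv U E i) p" by (rule arg_cong)
  also have "\<dots> = - ev U p - ev U p * ev E p"
    unfolding ev_add[OF l1_cmult[OF l1_U] l1_cmult[OF l1_conv[OF l1_U l1_E]] p]
      ev_cmult ev_conv[OF l1_U l1_E p] by simp
  finally show ?thesis by (simp add: algebra_simps)
qed

lemma G_eq:
  fixes h defines "h \<equiv> (\<lambda>i. of_real c * Q i + (1 / 2) * ddtheta (ddtheta Q) i)"
  shows "G i = h i + conv E h i"
proof -
  let ?w = "\<lambda>i. 2 * E i + conv E E i"
  have h: "h = (\<lambda>i. (if i = 0 then of_real c else 0) + H ?w i)"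
    by (auto simp: h_def Q_def ddtheta_def H_def frq_0 fun_eq_iff algebra_simps power2_eq_square)
  have ch: "conv E h i = of_real c * E i + conv E (H ?w) i"
    unfolding conv_commute[of E h] conv_commute[of E "H ?w"] unfolding h by (simp add: conv_add_left conv_one)
  have jE: "J E i = - J U i - J (conv U E) i"
  proof -
    have "U i = - E i - conv U E i" using E_equation[of i] by simp
    then show ?thesis unfolding J_def by (simp only:) (simp add: algebra_simps)
  qed
  have hE: "J E i + H (conv E E) i = of_real c * E i + H ?w i"
    by (simp add: J_def H_def algebra_simps)
  have "G i = (if i = 0 then of_real c else 0) + (J E i + H (conv E E) i) + conv E (H ?w) i"
    unfolding jE by (simp add: G_def G2_def)
  then show ?thesis unfolding hE ch by (simp add: h)
qed

text \<open>
  The normal speed in its geometric form: \<open>k\<^sub>s\<^sub>s = k (k\<^sup>2)'' / 2\<close> when \<open>s\<close> is arclength and the primes are derivatives in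
  the tangent angle.
\<close>

lemma ev_G:
  assumes p: "p \<in> \<Omega>"
  shows "ev G p = curv p * (of_real c * ev Q p + pd1 (pd1 (ev Q)) p / 2)"
proof -
  let ?h = "\<lambda>i. of_real c * Q i + (1 / 2) * ddtheta (ddtheta Q) i"
  have s: "l1 ?h" by (intro l1_add l1_cmult l1_Q)
  have h: "ev ?h p = of_real c * ev Q p + pd1 (pd1 (ev Q)) p / 2"
    by (simp only: ev_add[OF l1_cmult[OF l1_Q(1)] l1_cmult[OF l1_Q(3)] p] ev_cmult pd1_pd1_ev[OF l1_Q(1,2) p])
      simp
  have "ev G p = ev ?h p + ev E p * ev ?h p"
    unfolding G_eq[abs_def] ev_add[OF s l1_conv[OF l1_E s] p] ev_conv[OF l1_E s p] ..
  then show ?thesis unfolding h by (simp add: algebra_simps)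
qed

lemma ev_zero_frequency:
  assumes "\<And>i. frq i \<noteq> 0 \<Longrightarrow> a i = 0"
  shows "ev a (\<theta>, \<tau>) = ev a (0, \<tau>)"
  unfolding ev_def by (rule infsum_cong) (use assms in \<open>force simp: wave_def\<close>)

lemma ev_frequency_minus_one:
  assumes "\<And>i. frq i \<noteq> -1 \<Longrightarrow> a i = 0"
  shows "exp (\<i> * \<theta>) * ev a (\<theta>, \<tau>) = ev a (0, \<tau>)"
  unfolding ev_def infsum_cmult_right'[symmetric]
proof (rule infsum_cong)
  fix i
  show "exp (\<i> * \<theta>) * (a i * wave i (\<theta>, \<tau>)) = a i * wave i (0, \<tau>)"
  proof (cases "frq i = -1")
    case True
    have "exp (\<i> * \<theta>) * wave i (\<theta>, \<tau>) = wave i (0, \<tau>)"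
      unfolding wave_def exp_add[symmetric] by (simp add: True)
    then show ?thesis by (simp add: mult_ac)
  qed (use assms in simp)
qed

text \<open>
  Integrating \<open>A' = - <G> A\<close> termwise in time gives the factor \<open>A\<close> by which the actual curvature exceeds the rescaled
  one; the term \<open>c\<close> of the mean of \<^const>\<open>G\<close> has degree zero and contributes \<open>- c \<tau>\<close>.
\<close>

definition log_scale :: series where
  "log_scale i = (if frq i = 0 \<and> i \<noteq> 0 then G i / of_real (real (deg i) * \<mu>) else 0)"

lemma G_0: "G 0 = of_real c"
  by (simp add: G_def J_def UE_0 G2_0)

lemma l1_log_scale: "l1 log_scale"
proof (rule l1_le[OF l1_G(1)])
  fix i
  show "norm (log_scale i) \<le> (1 / \<mu>) * norm (G i)"
  proof (cases "frq i = 0 \<and> i \<noteq> 0")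
    case True
    then have "1 \<le> real (deg i)" using deg_eq_0_iff[of i] by (cases "deg i") auto
    then have "1 / (real (deg i) * \<mu>) \<le> 1 / \<mu>" using \<mu>_pos by (intro divide_left_mono) auto
    then have "norm (G i) * (1 / (real (deg i) * \<mu>)) \<le> norm (G i) * (1 / \<mu>)" by (rule mult_left_mono) simp
    then show ?thesis using True \<mu>_pos by (simp add: log_scale_def norm_divide norm_mult)
  qed (use \<mu>_pos in \<open>auto simp: log_scale_def\<close>)
qed

lemma l1_mean: "l1 a \<Longrightarrow> l1 (mean a)"
  by (rule l1_le[of a _ 1]) (auto simp: mean_def)

definition scale :: "complex \<times> complex \<Rightarrow> complex" where
  "scale p = exp (- (of_real c * snd p) + - ev log_scale p)"

lemma hol2_scale: "hol2 scale \<Omega>"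
  unfolding scale_def[abs_def] by (intro hol2_intros hol2_ev l1_log_scale)

lemma scale_indep: "scale (\<theta>, \<tau>) = scale (0, \<tau>)"
  unfolding scale_def using ev_zero_frequency[of log_scale \<theta> \<tau>] by (simp add: log_scale_def)

lemma scale_nz: "scale p \<noteq> 0" by (simp add: scale_def)

lemma pd2_scale: "p \<in> \<Omega> \<Longrightarrow> pd2 scale p = - ev (mean G) p * scale p"
proof -
  assume p: "p \<in> \<Omega>"
  have ser: "(\<lambda>i. of_real (real (deg i) * \<mu>) * log_scale i) = (\<lambda>i. mean G i + (-1) * (if i = 0 then of_real c else 0))"
    using deg_eq_0_iff \<mu>_pos by (auto simp: log_scale_def mean_def fun_eq_iff G_0 frq_0)
  have one: "l1 (\<lambda>i. (-1) * (if i = 0 then complex_of_real c else 0))" by (intro l1_cmult l1_one)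
  have e: "pd2 (ev log_scale) p = ev (mean G) p - of_real c"
    unfolding pd2_ev[OF l1_log_scale p] ser ev_add[OF l1_mean[OF l1_G(1)] one p] ev_cmult ev_one by simp
  obtain a b where ab: "p = (a, b)" by force
  have "((\<lambda>w. scale (a, w)) has_field_derivative scale (a, b) * (- of_real c - pd2 (ev log_scale) (a, b))) (at b)"
    unfolding scale_def snd_conv
    by (rule derivative_eq_intros hol2_has_pd2[OF hol2_ev[OF l1_log_scale]] p[unfolded ab] refl | simp)+
  then have "pd2 scale p = scale p * (- of_real c - pd2 (ev log_scale) p)"
    unfolding pd2_def[of scale] ab fst_conv snd_conv by (rule DERIV_imp_deriv)
  then show ?thesis unfolding e by (simp add: algebra_simps)
qed

end

text \<open>
  Now \<open>2 \<pi> \<omega>\<close> is a common period of all the waves in \<open>\<theta>\<close>, which keeps the frequencies away from \<open>-1\<close> unless they are equal to it.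
\<close>

locale unstable_rational_mode = unstable_mode +
  fixes n \<omega> :: int
  assumes x_rational: "x = of_int n / of_int \<omega>" and \<omega>_pos: "1 \<le> \<omega>"
begin

text \<open>
  \<open>exp (\<i> \<theta>) C\<close> is the primitive in \<open>\<theta>\<close> of \<open>exp (\<i> \<theta>) r\<close>, that is, the position on the rescaled curve.
  At the frequency \<open>-1\<close> there is nothing to integrate since \<open>r\<close> has no such part.
\<close>

definition C :: series where
  "C i = (if frq i = -1 then 0 else ((if i = 0 then 1 else 0) + U i) / (\<i> * of_real (1 + frq i)))"

text \<open>
  The part of the motion that \<^const>\<open>C\<close> does not see: a translation of the curve.
\<close>

definition N :: series where "N i = (if frq i = -1 then - (2 * \<i>) * G i else 0)"

lemma l1_N: "l1 N"
  by (rule l1_le[OF l1_G(1), of _ 2]) (auto simp: N_def norm_mult)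

lemma l1_C: "l1 C"
proof (rule l1_le[OF l1_add[OF l1_one[of 1] l1_U], of _ "of_int \<omega>"])
  fix i
  show "norm (C i) \<le> of_int \<omega> * norm ((if i = 0 then 1 else 0) + U i)"
  proof (cases "frq i = -1")
    case False
    define l where "l = \<omega> + (int (fst i) - int (snd i)) * n"
    have l: "1 + frq i = of_int l / of_int \<omega>"
      unfolding frq_def l_def unfolding x_rational using \<omega>_pos by (simp add: field_simps)
    then have "l \<noteq> 0" using False by auto
    then have "1 \<le> \<bar>real_of_int l\<bar>" by linarith
    then have "1 / \<bar>1 + frq i\<bar> \<le> of_int \<omega>" unfolding l using \<omega>_pos by (simp add: field_simps abs_mult)
    then have "norm ((if i = 0 then 1 else 0) + U i) * (1 / \<bar>1 + frq i\<bar>) \<le> norm ((if i = 0 then 1 else 0) + U i) * of_int \<omega>"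
      by (rule mult_left_mono) simp
    then show ?thesis using False by (simp add: C_def norm_divide norm_mult mult.commute del: of_real_add)
  qed (use \<omega>_pos in \<open>simp add: C_def\<close>)
qed

lemma ddtheta_C: "ddtheta C i + \<i> * C i = (if i = 0 then 1 else 0) + U i"
proof (cases "frq i = -1")
  case True
  then show ?thesis using U_excluded[of i] frq_0 by (auto simp: C_def ddtheta_def)
next
  case False
  then have "of_real (1 + frq i) \<noteq> (0 :: complex)" by (simp del: of_real_add)
  moreover have "ddtheta C i + \<i> * C i = \<i> * of_real (1 + frq i) * C i" by (simp add: ddtheta_def algebra_simps)
  ultimately show ?thesis using False by (simp add: C_def del: of_real_add)
qed

lemma l1_ddtheta_C: "l1 (ddtheta C)"
proof -
  have "ddtheta C = (\<lambda>i. ((if i = 0 then 1 else 0) + U i) + (- \<i>) * C i)" using ddtheta_C by (auto simp: fun_eq_iff algebra_simps)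
  then show ?thesis by (simp only:) (intro l1_add l1_one l1_U l1_cmult l1_C)
qed

text \<open>
  The flow integrated once in \<open>\<theta>\<close>: the factor \<open>1 - y\<^sup>2 = (1 + y) (1 - y)\<close> of \<open>G + G''\<close> cancels the denominator
  \<open>1 + y\<close> of \<^const>\<open>C\<close>.
\<close>

lemma C_flow: "of_real (real (deg i) * \<mu>) * C i + conv (mean G) C i = ddtheta G i + (- \<i>) * G i + (-1) * N i"
proof -
  let ?r = "\<lambda>i. (if i = 0 then 1 else 0) + U i"
  have *: "of_real (real (deg i) * \<mu>) * ?r i + conv (mean G) ?r i = of_real (1 - (frq i)\<^sup>2) * G i"
  proof -
    have "conv (mean G) (\<lambda>i. if i = 0 then 1 else 0) i = conv (\<lambda>i. if i = 0 then 1 else 0) (mean G) i"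
      by (rule conv_commute)
    then have "conv (mean G) (\<lambda>i. if i = 0 then 1 else 0) i = mean G i" by (simp add: conv_one)
    moreover have "conv (mean G) ?r i = conv (mean G) (\<lambda>i. if i = 0 then 1 else 0) i + conv (mean G) U i"
      by (simp add: conv_def distrib_left sum.distrib case_prod_unfold)
    ultimately show ?thesis using U_flow[of i] deg_eq_0_iff[of i] by (auto simp: algebra_simps)
  qed
  have cv: "conv (mean G) C i = (if frq i = -1 then 0 else conv (mean G) ?r i / (\<i> * of_real (1 + frq i)))"
  proof -
    have "(case z of (p, q) \<Rightarrow> mean G p * C q) =
       (if frq i = -1 then 0 else (case z of (p, q) \<Rightarrow> mean G p * ?r q) / (\<i> * of_real (1 + frq i)))"
      if "z \<in> {(p, q). p + q = i}" for z
    proof -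
      obtain p q where z: "z = (p, q)" by (metis surj_pair)
      then have "frq i = frq p + frq q" using that frq_add[of p q] by simp
      then show ?thesis by (simp add: mean_def C_def z)
    qed
    then have "conv (mean G) C i = (\<Sum>z\<in>{(p, q). p + q = i}.
       (if frq i = -1 then 0 else (case z of (p, q) \<Rightarrow> mean G p * ?r q) / (\<i> * of_real (1 + frq i))))"
      unfolding conv_def by (rule sum.cong[OF refl])
    then show ?thesis by (simp only: conv_def sum_divide_distrib split: if_split) simp
  qed
  show ?thesis
  proof (cases "frq i = -1")
    case True
    then show ?thesis by (simp add: cv) (simp add: C_def ddtheta_def N_def)
  next
    case False
    then have ne: "of_real (1 + frq i) \<noteq> (0 :: complex)" by (simp del: of_real_add)
    have "of_real (real (deg i) * \<mu>) * C i + conv (mean G) C i = (of_real (real (deg i) * \<mu>) * ?r i + conv (mean G) ?r i) / (\<i> * of_real (1 + frq i))"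
      using False by (simp add: cv C_def add_divide_distrib[symmetric])
    also have "\<dots> = of_real (1 - (frq i)\<^sup>2) * G i / (\<i> * of_real (1 + frq i))" by (simp only: *)
    also have "of_real (1 - (frq i)\<^sup>2) = (of_real (1 + frq i) * of_real (1 - frq i) :: complex)"
      by (simp add: algebra_simps power2_eq_square)
    also have "of_real (1 + frq i) * of_real (1 - frq i) * G i / (\<i> * of_real (1 + frq i)) = - \<i> * of_real (1 - frq i) * G i"
      using ne by (simp add: field_simps del: of_real_add of_real_diff)
    finally show ?thesis using False by (simp add: ddtheta_def N_def algebra_simps)
  qed
qed

lemma pd2_C: "p \<in> \<Omega> \<Longrightarrow> pd2 (ev C) p + ev (mean G) p * ev C p = pd1 (ev G) p - \<i> * ev G p - ev N p"
proof -
  assume p: "p \<in> \<Omega>"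
  have sZC: "l1 (conv (mean G) C)" by (intro l1_conv l1_mean l1_G l1_C)
  have sR: "l1 (\<lambda>i. ddtheta G i + (- \<i>) * G i + (-1) * N i)" by (intro l1_add l1_cmult l1_G l1_N)
  have eq: "(\<lambda>i. of_real (real (deg i) * \<mu>) * C i) = (\<lambda>i. (ddtheta G i + (- \<i>) * G i + (-1) * N i) + (-1) * conv (mean G) C i)"
    using C_flow by (auto simp: fun_eq_iff algebra_simps)
  have "pd2 (ev C) p = ev (ddtheta G) p + (- \<i>) * ev G p + (-1) * ev N p + (-1) * (ev (mean G) p * ev C p)"
    unfolding pd2_ev[OF l1_C p] eq
      ev_add[OF sR l1_cmult[OF sZC] p] ev_add[OF l1_add[OF l1_G(2) l1_cmult[OF l1_G(1)]] l1_cmult[OF l1_N] p]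
      ev_add[OF l1_G(2) l1_cmult[OF l1_G(1)] p] ev_cmult ev_conv[OF l1_mean[OF l1_G(1)] l1_C p] ..
  then show ?thesis by (simp add: pd1_ev[OF l1_G(1) p])
qed

text \<open>
  The curve parametrized by its tangent angle. Its velocity has the normal component \<open>- G / A\<close> of the flow
  (in the rescaled time) and the tangential component \<open>G' / A\<close> that keeps the tangent angle of each point fixed.
\<close>

lemma base_curve:
  obtains \<Gamma> where "hol2 \<Gamma> \<Omega>"
    "\<And>p. p \<in> \<Omega> \<Longrightarrow> pd1 \<Gamma> p = exp (\<i> * fst p) * radius p / scale p"
    "\<And>p. p \<in> \<Omega> \<Longrightarrow> pd2 \<Gamma> p = exp (\<i> * fst p) * (pd1 (ev G) p - \<i> * ev G p) / scale p"
    "\<And>\<theta> \<tau>. \<Gamma> (\<theta> + of_real (2 * pi * of_int \<omega>), \<tau>) = \<Gamma> (\<theta>, \<tau>)"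
proof -
  let ?half = "{\<tau>. Re \<tau> < 0}"
  have half: "(0, \<tau>) \<in> \<Omega>" if "Re \<tau> < 0" for \<tau>
    using that \<mu>_pos by (simp add: \<Omega>_def mult_pos_neg)
  have half': "Re \<tau> < 0" if "(\<theta>, \<tau>) \<in> \<Omega>" for \<theta> \<tau>
  proof (rule ccontr)
    assume "\<not> Re \<tau> < 0"
    then have "0 \<le> \<mu> * Re \<tau>" using \<mu>_pos by simp
    moreover have "0 \<le> \<bar>x\<bar> * \<bar>Im \<theta>\<bar>" by simp
    moreover have "\<mu> * Re \<tau> + \<bar>x\<bar> * \<bar>Im \<theta>\<bar> < 0" using that by (simp add: \<Omega>_def)
    ultimately show False by linarith
  qed
  have op: "open ?half" by (simp add: open_halfspace_Re_lt)
  have "(\<lambda>\<tau>. ev N (0, \<tau>) / scale (0, \<tau>)) field_differentiable at \<tau>" if "Re \<tau> < 0" for \<tau>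
    using hol2_ev[OF l1_N] hol2_scale half[OF that] scale_nz by (intro field_differentiable_divide) (auto simp: hol2_def)
  then have hN: "(\<lambda>\<tau>. ev N (0, \<tau>) / scale (0, \<tau>)) holomorphic_on ?half"
    by (auto simp: holomorphic_on_def intro: field_differentiable_at_within)
  \<comment> \<open>the translation is a primitive in time of the frequency \<open>-1\<close> part\<close>
  obtain b where b: "\<And>\<tau>. \<tau> \<in> ?half \<Longrightarrow> (b has_field_derivative ev N (0, \<tau>) / scale (0, \<tau>)) (at \<tau> within ?half)"
    by (rule holomorphic_convex_primitive'[OF convex_halfspace_Re_lt op hN]) blast
  have b: "(b has_field_derivative ev N (0, \<tau>) / scale (0, \<tau>)) (at \<tau>)" if "Re \<tau> < 0" for \<tau>
    using b[of \<tau>] that at_within_open[OF _ op, of \<tau>] by simp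
  define \<Gamma> where "\<Gamma> p = exp (\<i> * fst p) * ev C p * inverse (scale p) + b (snd p)" for p
  have hb: "hol2 (\<lambda>p. b (snd p)) \<Omega>"
    by (rule hol2_holomorphic_compose[OF op _ hol2_snd])
      (use b half' in \<open>auto simp: holomorphic_on_open[OF op]\<close>)
  have hol: "hol2 \<Gamma> \<Omega>"
    unfolding \<Gamma>_def[abs_def]
    by (intro hol2_intros hol2_inverse hol2_ev l1_C hol2_scale hb scale_nz)
  have d1: "pd1 \<Gamma> p = exp (\<i> * fst p) * radius p / scale p" if p: "p \<in> \<Omega>" for p
  proof -
    obtain \<theta> \<tau> where pp: "p = (\<theta>, \<tau>)" by force
    have e: "((\<lambda>z. exp (\<i> * z)) has_field_derivative \<i> * exp (\<i> * \<theta>)) (at \<theta>)"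
      by (auto intro!: derivative_eq_intros)
    have \<Gamma>_slice: "(\<lambda>z. \<Gamma> (z, \<tau>)) = (\<lambda>z. exp (\<i> * z) * ev C (z, \<tau>) * inverse (scale (0, \<tau>)) + b \<tau>)"
    proof
      fix z show "\<Gamma> (z, \<tau>) = exp (\<i> * z) * ev C (z, \<tau>) * inverse (scale (0, \<tau>)) + b \<tau>"
        unfolding \<Gamma>_def fst_conv snd_conv scale_indep[of z \<tau>] ..
    qed
    have "((\<lambda>z. \<Gamma> (z, \<tau>)) has_field_derivative
        (\<i> * exp (\<i> * \<theta>) * ev C (\<theta>, \<tau>) + pd1 (ev C) (\<theta>, \<tau>) * exp (\<i> * \<theta>)) * inverse (scale (0, \<tau>)) + 0) (at \<theta>)"
      unfolding \<Gamma>_slice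
      by (intro DERIV_add DERIV_const DERIV_cmult_right DERIV_mult e hol2_has_pd1[OF hol2_ev[OF l1_C]] p[unfolded pp])
    then have "pd1 \<Gamma> p = (\<i> * exp (\<i> * \<theta>) * ev C p + pd1 (ev C) p * exp (\<i> * \<theta>)) * inverse (scale (0, \<tau>)) + 0"
      unfolding pd1_def[of \<Gamma>] pp fst_conv snd_conv by (rule DERIV_imp_deriv)
    also have "\<dots> = exp (\<i> * \<theta>) * (\<i> * ev C p + pd1 (ev C) p) * inverse (scale (0, \<tau>))"
      by (simp add: algebra_simps)
    also have "\<i> * ev C p + pd1 (ev C) p = ev (\<lambda>i. ddtheta C i + \<i> * C i) p"
      by (simp add: ev_add[OF l1_ddtheta_C l1_cmult[OF l1_C] p] ev_cmult pd1_ev[OF l1_C p])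
    also have "\<dots> = radius p" unfolding ddtheta_C ev_add[OF l1_one l1_U p] ev_one ..
    finally show ?thesis using scale_indep[of \<theta> \<tau>] by (simp add: pp divide_inverse)
  qed
  have d2: "pd2 \<Gamma> p = exp (\<i> * fst p) * (pd1 (ev G) p - \<i> * ev G p) / scale p" if p: "p \<in> \<Omega>" for p
  proof -
    obtain \<theta> \<tau> where pp: "p = (\<theta>, \<tau>)" by force
    have neg: "Re \<tau> < 0" using half' p pp by simp
    let ?A = "scale p" and ?e = "exp (\<i> * \<theta>)"
    have "((\<lambda>w. \<Gamma> (\<theta>, w)) has_field_derivative
        (?e * pd2 (ev C) (\<theta>, \<tau>)) * inverse (scale (\<theta>, \<tau>)) + (- (pd2 scale (\<theta>, \<tau>) * inverse (scale (\<theta>, \<tau>) ^ Suc (Suc 0)))) * (?e * ev C (\<theta>, \<tau>))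
          + ev N (0, \<tau>) / scale (0, \<tau>)) (at \<tau>)"
      unfolding \<Gamma>_def fst_conv snd_conv
      by (intro DERIV_add DERIV_mult DERIV_cmult DERIV_inverse_fun hol2_has_pd2[OF hol2_ev[OF l1_C]] hol2_has_pd2[OF hol2_scale]
          b[OF neg] p[unfolded pp] scale_nz)
    then have "pd2 \<Gamma> p = (?e * pd2 (ev C) p) * inverse ?A + (- (pd2 scale p * inverse (?A ^ Suc (Suc 0)))) * (?e * ev C p)
          + ev N (0, \<tau>) / scale (0, \<tau>)"
      unfolding pd2_def[of \<Gamma>] pp fst_conv snd_conv by (rule DERIV_imp_deriv)
    also have "ev N (0, \<tau>) = ?e * ev N p"
      using ev_frequency_minus_one[of N \<theta> \<tau>] by (simp add: N_def pp)
    also have "scale (0, \<tau>) = ?A" using scale_indep pp by metis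
    also have "(?e * pd2 (ev C) p) * inverse ?A + (- (pd2 scale p * inverse (?A ^ Suc (Suc 0)))) * (?e * ev C p) + ?e * ev N p / ?A
       = ?e * (pd2 (ev C) p + ev (mean G) p * ev C p + ev N p) / ?A"
      unfolding pd2_scale[OF p] using scale_nz[of p] by (simp add: field_simps)
    also have "\<dots> = ?e * (pd1 (ev G) p - \<i> * ev G p) / ?A" unfolding pd2_C[OF p] by simp
    finally show ?thesis by (simp add: pp)
  qed
  have per: "\<Gamma> (\<theta> + of_real (2 * pi * of_int \<omega>), \<tau>) = \<Gamma> (\<theta>, \<tau>)" for \<theta> \<tau>
  proof -
    have "x * (2 * pi * of_int \<omega>) = 2 * pi * of_int n" using x_rational \<omega>_pos by simp
    note e = ev_periodic[OF this, of C \<theta> \<tau>]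
    have "exp (\<i> * (\<theta> + of_real (2 * pi * of_int \<omega>))) = exp (\<i> * \<theta>) * exp (\<i> * (of_int \<omega> * (of_real pi * 2)))"
      by (simp add: exp_add[symmetric] algebra_simps)
    then have "exp (\<i> * (\<theta> + of_real (2 * pi * of_int \<omega>))) = exp (\<i> * \<theta>)" by (simp only: exp_2pi_1_int mult_1_right)
    then show ?thesis
      unfolding \<Gamma>_def fst_conv snd_conv e scale_indep[of "\<theta> + _" \<tau>] using scale_indep[of \<theta> \<tau>] by simp
  qed
  show ?thesis by (rule that[OF hol d1 d2 per])
qed

end

section \<open>Geometry of a curve in terms of its tangent angle\<close>

text \<open>
  A curve with tangent angle \<open>\<theta> u\<close> whose curvature is a function \<^term>\<open>K\<close> of the tangent angle. Arclength derivatives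
  become \<^term>\<open>K\<close> times angle derivatives, and integrals over the curve reduce to increments of primitives over one period.
\<close>

locale angle_parametrized =
  fixes \<gamma> :: "real \<Rightarrow> complex" and \<theta> \<theta>' K K1 W2 :: "real \<Rightarrow> real"
  assumes \<theta>: "\<And>u. (\<theta> has_real_derivative \<theta>' u) (at u)" and \<theta>'_pos: "\<And>u. 0 < \<theta>' u"
    and K_pos: "\<And>v. 0 < K v"
    and \<gamma>: "\<And>u. (\<gamma> has_vector_derivative (\<theta>' u / K (\<theta> u)) *\<^sub>R cis (\<theta> u)) (at u)"
    and K: "\<And>v. (K has_real_derivative K1 v) (at v)"
    and W: "\<And>v. ((\<lambda>v. K v * K1 v) has_real_derivative W2 v) (at v)"
begin

lemma speed: "speed \<gamma> u = \<theta>' u / K (\<theta> u)"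
  using \<theta>'_pos K_pos by (simp add: speed_def vector_derivative_at[OF \<gamma>] less_imp_le)

lemma speed_pos: "0 < speed \<gamma> u"
  unfolding speed using \<theta>'_pos K_pos by simp

lemma arc_deriv_angle:
  assumes "\<And>v. (g has_real_derivative g' v) (at v)"
  shows "arc_deriv \<gamma> (\<lambda>u. g (\<theta> u)) u = K (\<theta> u) * g' (\<theta> u)"
proof -
  have "((\<lambda>u. g (\<theta> u)) has_real_derivative g' (\<theta> u) * \<theta>' u) (at u)"
    by (rule DERIV_chain2[OF assms \<theta>])
  then have "vector_derivative (\<lambda>u. g (\<theta> u)) (at u) = g' (\<theta> u) * \<theta>' u"
    by (intro vector_derivative_at) (simp add: has_real_derivative_iff_has_vector_derivative)
  then show ?thesis using \<theta>'_pos[of u] by (simp add: arc_deriv_def speed)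
qed

lemma tangent: "arc_deriv \<gamma> \<gamma> u = cis (\<theta> u)"
  using \<theta>'_pos[of u] K_pos[of "\<theta> u"]
  by (simp add: arc_deriv_def vector_derivative_at[OF \<gamma>] speed)

lemma normal: "unit_normal \<gamma> u = \<i> * cis (\<theta> u)"
  by (simp add: unit_normal_def tangent)

lemma curvature: "curvature \<gamma> = (\<lambda>u. K (\<theta> u))"
proof
  fix u
  have T: "arc_deriv \<gamma> \<gamma> = (\<lambda>u. cis (\<theta> u))" by (rule ext) (rule tangent)
  have "((\<lambda>v. cis v) has_vector_derivative \<i> * cis v) (at v)" for v
    unfolding cis_conv_exp
    by (rule has_vector_derivative_real_field) (auto intro!: derivative_eq_intros)
  then have "((cis \<circ> \<theta>) has_vector_derivative \<theta>' u *\<^sub>R (\<i> * cis (\<theta> u))) (at u)"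
    using \<theta>[of u] by (intro vector_diff_chain_at) (auto simp: has_real_derivative_iff_has_vector_derivative)
  then have "vector_derivative (\<lambda>u. cis (\<theta> u)) (at u) = \<theta>' u *\<^sub>R (\<i> * cis (\<theta> u))"
    by (intro vector_derivative_at) (simp add: o_def)
  then have "arc_deriv \<gamma> (arc_deriv \<gamma> \<gamma>) u = K (\<theta> u) *\<^sub>R (\<i> * cis (\<theta> u))"
    using \<theta>'_pos[of u] by (simp add: T arc_deriv_def speed)
  moreover have "(\<i> * cis (\<theta> u)) \<bullet> (\<i> * cis (\<theta> u)) = 1"
    by (simp add: dot_square_norm norm_mult)
  ultimately show "curvature \<gamma> u = K (\<theta> u)" by (simp add: curvature_def normal)
qed

lemma curvature_ss: "arc_deriv \<gamma> (arc_deriv \<gamma> (curvature \<gamma>)) u = K (\<theta> u) * W2 (\<theta> u)"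
proof -
  have "arc_deriv \<gamma> (curvature \<gamma>) = (\<lambda>u. K (\<theta> u) * K1 (\<theta> u))"
    unfolding curvature by (rule ext) (rule arc_deriv_angle[OF K])
  then show ?thesis using arc_deriv_angle[OF W] by simp
qed

lemma arc_integral_angle:
  assumes "\<And>v. (F has_real_derivative g v / K v) (at v)" "\<theta> (2 * pi) = \<theta> 0 + P"
  shows "arc_integral \<gamma> (\<lambda>u. g (\<theta> u)) = F (\<theta> 0 + P) - F (\<theta> 0)"
proof -
  have "((\<lambda>u. g (\<theta> u) * speed \<gamma> u) has_integral F (\<theta> (2 * pi)) - F (\<theta> 0)) {0..2 * pi}"
  proof (rule fundamental_theorem_of_calculus)
    fix u
    have "((\<lambda>u. F (\<theta> u)) has_real_derivative (g (\<theta> u) / K (\<theta> u)) * \<theta>' u) (at u)"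
      by (rule DERIV_chain2[OF assms(1) \<theta>])
    then show "((\<lambda>u. F (\<theta> u)) has_vector_derivative g (\<theta> u) * speed \<gamma> u) (at u within {0..2 * pi})"
      by (simp add: has_real_derivative_iff_has_vector_derivative speed has_vector_derivative_at_within)
  qed simp
  then show ?thesis unfolding arc_integral_def assms(2)[symmetric] by (rule integral_unique)
qed

text \<open>
  The integral of \<open>k ds = d\<theta>\<close> is \<open>2 \<pi> w\<close>, and \<open>L \<integral> (k - k\<^sub>0)\<^sup>2 ds = L \<integral> k\<^sup>2 ds - (\<integral> k ds)\<^sup>2\<close> for the mean \<open>k\<^sub>0\<close>.
\<close>

lemma global_quantities:
  fixes w L P :: real
  assumes "\<theta> (2 * pi) = \<theta> 0 + 2 * pi * w"
    and FL: "\<And>v. (FL has_real_derivative 1 / K v) (at v)" "\<And>v. FL (v + 2 * pi * w) = FL v + L"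
    and FK: "\<And>v. (FK has_real_derivative K v) (at v)" "\<And>v. FK (v + 2 * pi * w) = FK v + P"
    and L: "L \<noteq> 0"
  shows "turning_number \<gamma> = w" "K_osc \<gamma> = L * P - (2 * pi * w)\<^sup>2"
proof -
  have k: "arc_integral \<gamma> (curvature \<gamma>) = 2 * pi * w"
    unfolding curvature
    using arc_integral_angle[of "\<lambda>v. v" K, OF _ assms(1)] K_pos[THEN less_imp_neq] by (auto simp: DERIV_ident)
  then show "turning_number \<gamma> = w" by (simp add: turning_number_def)
  have len: "curve_length \<gamma> = L"
    unfolding curve_length_def using arc_integral_angle[of FL "\<lambda>_. 1", OF FL(1) assms(1)] FL(2) by simp
  define m where "m = 2 * pi * w / L"
  have m: "mean_curvature \<gamma> = m" by (simp add: mean_curvature_def k len m_def)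
  have "arc_integral \<gamma> (\<lambda>u. (K (\<theta> u) - m)\<^sup>2) = P - 2 * m * (2 * pi * w) + m\<^sup>2 * L"
  proof -
    have "((\<lambda>v. FK v - 2 * m * v + m\<^sup>2 * FL v) has_real_derivative (K v - m)\<^sup>2 / K v) (at v)" for v
    proof -
      have "((\<lambda>v. FK v - 2 * m * v + m\<^sup>2 * FL v) has_real_derivative (K v - 2 * m * 1 + m\<^sup>2 * (1 / K v))) (at v)"
        by (intro DERIV_add DERIV_diff DERIV_cmult FK(1) FL(1) DERIV_ident)
      moreover have "K v - 2 * m * 1 + m\<^sup>2 * (1 / K v) = (K v - m)\<^sup>2 / K v"
        using K_pos[of v] by (simp add: field_simps power2_eq_square)
      ultimately show ?thesis by simp
    qed
    from arc_integral_angle[of _ "\<lambda>v. (K v - m)\<^sup>2", OF this assms(1)]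
    show ?thesis unfolding FL(2) FK(2) by (simp add: algebra_simps)
  qed
  then have "K_osc \<gamma> = L * (P - 2 * m * (2 * pi * w) + m\<^sup>2 * L)"
    by (simp add: K_osc_def len m curvature)
  also have "\<dots> = L * P - (2 * pi * w)\<^sup>2"
    using L by (simp add: m_def field_simps power2_eq_square)
  finally show "K_osc \<gamma> = L * P - (2 * pi * w)\<^sup>2" .
qed

end

lemma Re_has_real_derivative:
  assumes "(f has_field_derivative f') (at (complex_of_real v))"
  shows "((\<lambda>v. Re (f (of_real v))) has_real_derivative Re f') (at v)"
  using bounded_linear.has_vector_derivative[OF bounded_linear_Re has_field_derivative_of_real_within[OF assms, of UNIV]]
  by (simp add: has_real_derivative_iff_has_vector_derivative)

section \<open>Normal motion and physical time\<close>

context unstable_rational_mode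
begin

lemma period: "x * (2 * pi * of_int \<omega>) = 2 * pi * of_int n"
  using x_rational \<omega>_pos by simp

lemma ev_period: "ev a (\<theta> + of_real (2 * pi * of_int \<omega>), \<tau>) = ev a (\<theta>, \<tau>)"
  by (rule ev_periodic[OF period])

lemma swap_eq_0_iff: "prod.swap i = 0 \<longleftrightarrow> i = (0 :: nat \<times> nat)"
  by (cases i) (auto simp: zero_prod_def)

lemma hermitian_G: "hermitian G"
proof -
  show ?thesis
    using hermitian_G2[OF hermitian_UE] hermitian_multipliers(1)[OF hermitian_UE(1)] swap_eq_0_iff by (auto simp: hermitian_def G_def)
qed

lemma hermitian_ddtheta: "hermitian a \<Longrightarrow> hermitian (ddtheta a)" by (auto simp: hermitian_def ddtheta_def frq_swap)

lemma hermitian_log_scale: "hermitian log_scale"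
  using hermitian_G swap_eq_0_iff by (auto simp: hermitian_def log_scale_def frq_swap deg_swap)

text \<open>
  The points that move normally to the curve change their tangent angle at the rate \<open>- k G'\<close>: this cancels the
  tangential velocity in the lemma \<open>base_curve\<close>. The initial angles fill a strip around the real line, and the derivative in
  the initial angle remains positive because \<open>\<phi> (z, \<tau>) - z\<close> is small on discs of a fixed radius \<open>d\<close>.
\<close>

lemma angle_flow:
  fixes s0 :: real
  assumes "s0 < 0"
  obtains \<delta> X \<phi> where "0 < \<delta>" "open X" "\<And>u. complex_of_real u \<in> X"
    "hol2 \<phi> (X \<times> ball (of_real s0) \<delta>)"
    "\<And>z \<tau>. z \<in> X \<Longrightarrow> \<tau> \<in> ball (of_real s0) \<delta> \<Longrightarrow> (\<phi> (z, \<tau>), \<tau>) \<in> \<Omega>"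
    "\<And>z \<tau>. z \<in> X \<Longrightarrow> \<tau> \<in> ball (of_real s0) \<delta> \<Longrightarrow>
        pd2 \<phi> (z, \<tau>) = - curv (\<phi> (z, \<tau>), \<tau>) * pd1 (ev G) (\<phi> (z, \<tau>), \<tau>)"
    "\<And>u \<tau>. \<tau> \<in> ball (of_real s0) \<delta> \<Longrightarrow> \<phi> (of_real (u + 2 * pi * of_int \<omega>), \<tau>) = \<phi> (of_real u, \<tau>) + of_real (2 * pi * of_int \<omega>)"
    "\<And>u s. of_real s \<in> ball (complex_of_real s0) \<delta> \<Longrightarrow> \<phi> (of_real u, of_real s) \<in> \<real>"
    "\<And>u \<tau>. \<tau> \<in> ball (of_real s0) \<delta> \<Longrightarrow> 0 < Re (pd1 \<phi> (of_real u, \<tau>))"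
proof -
  define d where "d = \<mu> * (- s0) / (16 * (\<bar>x\<bar> + 1))"
  define \<eta>' where "\<eta>' = - s0 / 2"
  have d: "0 < d" unfolding d_def using assms \<mu>_pos by (intro divide_pos_pos mult_pos_pos) auto
  have \<eta>': "0 < \<eta>'" using assms by (simp add: \<eta>'_def)
  let ?t0 = "complex_of_real s0"
  \<comment> \<open>strips nested with margins \<open>2 d\<close>, all inside the domain of the series for \<open>\<tau>\<close> near \<open>s0\<close>\<close>
  define P where "P = {z. \<bar>Im z\<bar> < 4 * d}"
  define X where "X = {z. \<bar>Im z\<bar> < 2 * d}"
  have open_strip: "open {z. \<bar>Im z\<bar> < r}" for r by (intro open_Collect_less continuous_intros)
  have P\<Omega>: "(z, \<tau>) \<in> \<Omega>" if "z \<in> P" "\<tau> \<in> ball ?t0 \<eta>'" for z \<tau>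
  proof -
    have "\<bar>Re (\<tau> - ?t0)\<bar> < \<eta>'" using that(2) abs_Re_le_cmod[of "\<tau> - ?t0"] by (simp add: dist_norm norm_minus_commute)
    then have "Re \<tau> < s0 / 2" unfolding \<eta>'_def by simp
    then have 1: "\<mu> * Re \<tau> < \<mu> * (s0 / 2)" using \<mu>_pos by simp
    have "\<bar>x\<bar> * \<bar>Im z\<bar> \<le> (\<bar>x\<bar> + 1) * (4 * d)" using that(1) by (intro mult_mono) (auto simp: P_def)
    also have "\<dots> = - (\<mu> * s0 / 4)"
    proof -
      have "(\<bar>x\<bar> + 1) * d = \<mu> * (- s0) / 16" unfolding d_def by (simp add: field_simps add_nonneg_eq_0_iff)
      then show ?thesis by simp
    qed
    finally have "\<bar>x\<bar> * \<bar>Im z\<bar> \<le> - (\<mu> * s0 / 4)" .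
    moreover have "\<mu> * s0 < 0" using \<mu>_pos assms by (simp add: mult_pos_neg)
    ultimately show ?thesis using 1 unfolding \<Omega>_def by simp
  qed
  let ?f = "\<lambda>p. - curv p * ev (ddtheta G) p"
  obtain K where K: "bnd 0 (ddtheta G) K" using l1_G(3) by blast
  define M where "M = 2 * K + 1"
  have M: "0 < M" using bnd_nonneg[OF K] by (simp add: M_def)
  have bound: "norm (?f p) \<le> M" if "p \<in> P \<times> ball ?t0 \<eta>'" for p
  proof -
    have p: "p \<in> \<Omega>" using P\<Omega> that by (cases p) auto
    have "norm (curv p) \<le> 1 + 4 * \<eta>"
      using norm_triangle_ineq[of 1 "ev E p"] norm_ev_le[OF bnd_lower[OF bnd_E, of 0] p] by simp
    then have "norm (curv p) \<le> 2" using \<eta>_le(1) by simp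
    then have "norm (curv p) * norm (ev (ddtheta G) p) \<le> 2 * K"
      using norm_ev_le[OF K p] by (intro mult_mono) auto
    then show ?thesis by (simp add: norm_mult M_def del: minus_add_distrib)
  qed
  have hol: "hol2 ?f (P \<times> ball ?t0 \<eta>')"
    by (rule hol2_subset[of _ \<Omega>]) (use P\<Omega> in \<open>auto intro!: hol2_intros hol2_ev l1_G l1_E simp del: minus_add_distrib\<close>)
  have sub: "cball z (2 * d) \<subseteq> P" if "z \<in> X" for z
  proof
    fix w assume "w \<in> cball z (2 * d)"
    then have "\<bar>Im (w - z)\<bar> \<le> 2 * d" using abs_Im_le_cmod[of "w - z"] by (simp add: dist_norm norm_minus_commute)
    then show "w \<in> P" using that unfolding X_def P_def by simp
  qed
  obtain \<delta> \<phi> where \<delta>: "0 < \<delta>" "\<delta> \<le> \<eta>'" and h\<phi>: "hol2 \<phi> (X \<times> ball ?t0 \<delta>)"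
    and "\<And>z. z \<in> X \<Longrightarrow> \<phi> (z, ?t0) = z"
    and dist: "\<And>z \<tau>. z \<in> X \<Longrightarrow> \<tau> \<in> ball ?t0 \<delta> \<Longrightarrow> norm (\<phi> (z, \<tau>) - z) \<le> M * norm (\<tau> - ?t0)"
    and inb: "\<And>z \<tau>. z \<in> X \<Longrightarrow> \<tau> \<in> ball ?t0 \<delta> \<Longrightarrow> \<phi> (z, \<tau>) \<in> cball z d"
    and ode: "\<And>z \<tau>. z \<in> X \<Longrightarrow> \<tau> \<in> ball ?t0 \<delta> \<Longrightarrow> ((\<lambda>s. \<phi> (z, s)) has_field_derivative ?f (\<phi> (z, \<tau>), \<tau>)) (at \<tau>)"
    and per: "\<And>q z \<tau>. (\<And>z \<tau>. z \<in> P \<Longrightarrow> \<tau> \<in> ball ?t0 \<eta>' \<Longrightarrow> ?f (z + q, \<tau>) = ?f (z, \<tau>)) \<Longrightarrow>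
        z \<in> X \<Longrightarrow> z + q \<in> X \<Longrightarrow> \<tau> \<in> ball ?t0 \<delta> \<Longrightarrow> \<phi> (z + q, \<tau>) = \<phi> (z, \<tau>) + q"
    and real: "\<And>z \<tau>. (\<And>z \<tau>. z \<in> P \<Longrightarrow> \<tau> \<in> ball ?t0 \<eta>' \<Longrightarrow> z \<in> \<real> \<Longrightarrow> \<tau> \<in> \<real> \<Longrightarrow> ?f (z, \<tau>) \<in> \<real>) \<Longrightarrow>
        ?t0 \<in> \<real> \<Longrightarrow> z \<in> X \<Longrightarrow> z \<in> \<real> \<Longrightarrow> \<tau> \<in> ball ?t0 \<delta> \<Longrightarrow> \<tau> \<in> \<real> \<Longrightarrow> \<phi> (z, \<tau>) \<in> \<real>"
  proof (rule hol2_picard[OF open_strip[of "4 * d", folded P_def] open_strip[of "2 * d", folded X_def] hol \<eta>' d M sub bound], goal_cases)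
    case (3 \<delta> \<phi>)
    show ?case by (rule 3(1)[of \<delta> \<phi>]) (fact 3)+
  qed
  define \<delta>' where "\<delta>' = min \<delta> (d / M)"
  have \<delta>': "0 < \<delta>'" "\<delta>' \<le> \<delta>" "\<delta>' \<le> d / M" using \<delta> d M by (auto simp: \<delta>'_def)
  have sm: "\<tau> \<in> ball ?t0 \<delta>" "\<tau> \<in> ball ?t0 \<eta>'" if "\<tau> \<in> ball ?t0 \<delta>'" for \<tau> using that \<delta> \<delta>' by auto
  have RX: "complex_of_real u \<in> X" for u using d by (simp add: X_def)
  have in\<Omega>: "(\<phi> (z, \<tau>), \<tau>) \<in> \<Omega>" if "z \<in> X" "\<tau> \<in> ball ?t0 \<delta>'" for z \<tau>
  proof (rule P\<Omega>[OF _ sm(2)[OF that(2)]])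
    have "cball z d \<subseteq> cball z (2 * d)" using d by auto
    then show "\<phi> (z, \<tau>) \<in> P" using inb[OF that(1) sm(1)[OF that(2)]] sub[OF that(1)] by blast
  qed
  show ?thesis
  proof (rule that[of \<delta>' X \<phi>])
    show "hol2 \<phi> (X \<times> ball ?t0 \<delta>')" by (rule hol2_subset[OF h\<phi>]) (use sm in auto)
    show "pd2 \<phi> (z, \<tau>) = - curv (\<phi> (z, \<tau>), \<tau>) * pd1 (ev G) (\<phi> (z, \<tau>), \<tau>)" if "z \<in> X" "\<tau> \<in> ball ?t0 \<delta>'" for z \<tau>
      unfolding pd2_def[of \<phi>] fst_conv snd_conv pd1_ev[OF l1_G(1) in\<Omega>[OF that]]
      by (rule DERIV_imp_deriv[OF ode[OF that(1) sm(1)[OF that(2)]]])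
    show "\<phi> (of_real (u + 2 * pi * of_int \<omega>), \<tau>) = \<phi> (of_real u, \<tau>) + of_real (2 * pi * of_int \<omega>)" if "\<tau> \<in> ball ?t0 \<delta>'" for u \<tau>
      unfolding of_real_add[of u]
      by (rule per) (use RX[of u] RX[of "u + 2 * pi * of_int \<omega>"] sm(1)[OF that] in \<open>simp_all add: ev_period del: of_real_mult\<close>)
    show "\<phi> (of_real u, of_real s) \<in> \<real>" if "of_real s \<in> ball ?t0 \<delta>'" for u s
      by (rule real) (use RX sm(1)[OF that] in \<open>auto intro!: Reals_mult Reals_minus Reals_add ev_real hermitian_UE hermitian_ddtheta hermitian_G simp del: minus_add_distrib\<close>)
    show "0 < Re (pd1 \<phi> (of_real u, \<tau>))" if \<tau>: "\<tau> \<in> ball ?t0 \<delta>'" for u \<tau>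
    proof -
      let ?z = "complex_of_real u"
      have subX: "cball ?z d \<subseteq> X"
      proof
        fix w assume "w \<in> cball ?z d"
        then have "\<bar>Im (w - ?z)\<bar> \<le> d" using abs_Im_le_cmod[of "w - ?z"] by (simp add: dist_norm norm_minus_commute)
        then show "w \<in> X" using d unfolding X_def by simp
      qed
      have d1: "((\<lambda>z. \<phi> (z, \<tau>) - z) has_field_derivative pd1 \<phi> (z, \<tau>) - 1) (at z)" if "z \<in> X" for z
        by (intro DERIV_diff DERIV_ident hol2_has_pd1[OF h\<phi>]) (use that sm(1)[OF \<tau>] in auto)
      have holo: "(\<lambda>z. \<phi> (z, \<tau>) - z) holomorphic_on cball ?z d"
        unfolding holomorphic_on_def field_differentiable_def using d1 subX by (blast intro: has_field_derivative_at_within)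
      have "norm ((deriv ^^ 1) (\<lambda>z. \<phi> (z, \<tau>) - z) ?z) \<le> fact 1 * (M * norm (\<tau> - ?t0)) / d ^ 1"
      proof (rule Cauchy_inequality)
        show "norm (\<phi> (w, \<tau>) - w) \<le> M * norm (\<tau> - ?t0)" if "norm (?z - w) = d" for w
          by (rule dist[OF _ sm(1)[OF \<tau>]]) (use that subX in \<open>auto simp: dist_norm subset_iff\<close>)
      qed (use holo holomorphic_on_imp_continuous_on[OF holo] holomorphic_on_subset[OF holo ball_subset_cball] d in auto)
      then have "norm (pd1 \<phi> (?z, \<tau>) - 1) \<le> M * norm (\<tau> - ?t0) / d"
        using DERIV_imp_deriv[OF d1[OF RX]] by simp
      also have "\<dots> < 1"
      proof -
        have "norm (\<tau> - ?t0) < d / M" using \<tau> \<delta>'(3) by (simp add: dist_norm norm_minus_commute)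
        then show ?thesis using M d by (simp add: field_simps)
      qed
      finally have "norm (pd1 \<phi> (?z, \<tau>) - 1) < 1" .
      then show ?thesis using abs_Re_le_cmod[of "pd1 \<phi> (?z, \<tau>) - 1"] by simp
    qed
  qed (use \<delta>' RX in\<Omega> open_strip in \<open>auto simp: X_def\<close>)
qed

text \<open>
  The rescaled time as a function of the physical time: the flow scales like length to the fourth power.
\<close>

lemma clock:
  fixes s0 \<rho> :: real
  assumes "s0 < 0" "0 < \<rho>"
  obtains \<epsilon> T where "0 < \<epsilon>" "T holomorphic_on ball 0 \<epsilon>" "T 0 = of_real s0"
    "\<And>t. t \<in> ball 0 \<epsilon> \<Longrightarrow> T t \<in> ball (of_real s0) \<rho>"
    "\<And>t. t \<in> ball 0 \<epsilon> \<Longrightarrow> (T has_field_derivative scale (0, T t) ^ 4) (at t)"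
    "\<And>t. t \<in> ball 0 \<epsilon> \<Longrightarrow> t \<in> \<real> \<Longrightarrow> T t \<in> \<real>"
proof -
  let ?t0 = "complex_of_real s0"
  define r where "r = - s0 / 8"
  have r: "0 < r" using assms by (simp add: r_def)
  have \<Omega>0: "(0, \<tau>) \<in> \<Omega>" if "\<tau> \<in> cball ?t0 (4 * r)" for \<tau>
  proof -
    have "\<bar>Re (\<tau> - ?t0)\<bar> \<le> 4 * r" using that abs_Re_le_cmod[of "\<tau> - ?t0"] by (simp add: dist_norm norm_minus_commute)
    then have "Re \<tau> < 0" using assms unfolding r_def by simp
    then show ?thesis using \<mu>_pos by (simp add: \<Omega>_def mult_pos_neg)
  qed
  have "continuous_on \<Omega> scale" using hol2_scale by (simp add: hol2_def)
  then have "continuous_on (cball ?t0 (4 * r)) (\<lambda>\<tau>. scale (0, \<tau>))"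
    by (rule continuous_on_compose2) (use \<Omega>0 in \<open>auto intro!: continuous_on_Pair continuous_on_const continuous_on_id\<close>)
  then have "compact ((\<lambda>\<tau>. scale (0, \<tau>) ^ 4) ` cball ?t0 (4 * r))"
    by (intro compact_continuous_image continuous_on_power compact_cball)
  from compact_imp_bounded[OF this] obtain M where M: "0 < M" "\<And>\<tau>. \<tau> \<in> cball ?t0 (4 * r) \<Longrightarrow> norm (scale (0, \<tau>) ^ 4) \<le> M"
    unfolding bounded_pos by auto
  let ?f = "\<lambda>p :: complex \<times> complex. scale (0, fst p) ^ 4"
  have "hol2 (\<lambda>p. scale (0, fst p)) (ball ?t0 (4 * r) \<times> ball 0 1)"
    by (rule hol2_compose[OF open_\<Omega> hol2_scale]) (use \<Omega>0 in \<open>auto intro!: hol2_intros\<close>)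
  then have hol: "hol2 ?f (ball ?t0 (4 * r) \<times> ball 0 1)"
    unfolding power4_eq_xxxx by (intro hol2_intros)
  have sub: "cball z (2 * r) \<subseteq> ball ?t0 (4 * r)" if "z \<in> ball ?t0 r" for z
  proof
    fix w assume "w \<in> cball z (2 * r)"
    then show "w \<in> ball ?t0 (4 * r)" using that dist_triangle[of ?t0 w z] r by auto
  qed
  have bound: "norm (?f p) \<le> M" if "p \<in> ball ?t0 (4 * r) \<times> ball 0 1" for p
    using that by (intro M(2)) auto
  obtain \<delta> \<psi> where \<delta>: "0 < \<delta>" "\<delta> \<le> 1" and "hol2 \<psi> (ball ?t0 r \<times> ball 0 \<delta>)" and init: "\<And>z. z \<in> ball ?t0 r \<Longrightarrow> \<psi> (z, 0) = z"
    and dist: "\<And>z t. z \<in> ball ?t0 r \<Longrightarrow> t \<in> ball 0 \<delta> \<Longrightarrow> norm (\<psi> (z, t) - z) \<le> M * norm (t - 0)"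
    and "\<And>z t. z \<in> ball ?t0 r \<Longrightarrow> t \<in> ball 0 \<delta> \<Longrightarrow> \<psi> (z, t) \<in> cball z r"
    and ode: "\<And>z t. z \<in> ball ?t0 r \<Longrightarrow> t \<in> ball 0 \<delta> \<Longrightarrow> ((\<lambda>s. \<psi> (z, s)) has_field_derivative ?f (\<psi> (z, t), t)) (at t)"
    and "\<And>q z t. (\<And>z t. z \<in> ball ?t0 (4 * r) \<Longrightarrow> t \<in> ball 0 1 \<Longrightarrow> ?f (z + q, t) = ?f (z, t)) \<Longrightarrow>
        z \<in> ball ?t0 r \<Longrightarrow> z + q \<in> ball ?t0 r \<Longrightarrow> t \<in> ball 0 \<delta> \<Longrightarrow> \<psi> (z + q, t) = \<psi> (z, t) + q"
    and real: "\<And>z t. (\<And>z t. z \<in> ball ?t0 (4 * r) \<Longrightarrow> t \<in> ball 0 1 \<Longrightarrow> z \<in> \<real> \<Longrightarrow> t \<in> \<real> \<Longrightarrow> ?f (z, t) \<in> \<real>) \<Longrightarrow>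
        0 \<in> (\<real> :: complex set) \<Longrightarrow> z \<in> ball ?t0 r \<Longrightarrow> z \<in> \<real> \<Longrightarrow> t \<in> ball 0 \<delta> \<Longrightarrow> t \<in> \<real> \<Longrightarrow> \<psi> (z, t) \<in> \<real>"
  proof (rule hol2_picard[OF open_ball[of ?t0 "4 * r"] open_ball[of ?t0 r] hol zero_less_one r M(1) sub bound], goal_cases)
    case (3 \<delta> \<psi>)
    show ?case by (rule 3(1)[of \<delta> \<psi>]) (fact 3)+
  qed
  have t0: "?t0 \<in> ball ?t0 r" using r by simp
  define \<epsilon> where "\<epsilon> = min \<delta> (\<rho> / M)"
  have \<epsilon>: "0 < \<epsilon>" "\<epsilon> \<le> \<delta>" "\<epsilon> \<le> \<rho> / M" using \<delta> assms M by (auto simp: \<epsilon>_def)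
  have sm: "t \<in> ball 0 \<delta>" if "t \<in> ball 0 \<epsilon>" for t :: complex using that \<epsilon> by auto
  have der: "((\<lambda>t. \<psi> (?t0, t)) has_field_derivative scale (0, \<psi> (?t0, t)) ^ 4) (at t)" if "t \<in> ball 0 \<epsilon>" for t
    using ode[OF t0 sm[OF that]] by simp
  show ?thesis
  proof (rule that[of \<epsilon> "\<lambda>t. \<psi> (?t0, t)"])
    show "(\<lambda>t. \<psi> (?t0, t)) holomorphic_on ball 0 \<epsilon>"
      unfolding holomorphic_on_open[OF open_ball] using der by blast
    show "\<psi> (?t0, t) \<in> ball ?t0 \<rho>" if "t \<in> ball 0 \<epsilon>" for t
    proof -
      have "norm t < \<rho> / M" using that \<epsilon> by simp
      then have "M * norm t < \<rho>" using M by (simp add: field_simps)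
      then show ?thesis using dist[OF t0 sm[OF that]] by (simp add: dist_norm norm_minus_commute)
    qed
    show "\<psi> (?t0, t) \<in> \<real>" if "t \<in> ball 0 \<epsilon>" "t \<in> \<real>" for t
      by (rule real) (use sm[OF that(1)] that(2) r in \<open>auto simp: scale_def power4_eq_xxxx intro!: Reals_mult Reals_minus Reals_diff exp_in_Reals ev_real hermitian_log_scale\<close>)
  qed (use der \<epsilon> init[OF t0] in auto)
qed

end

section \<open>The oscillation of the curvature\<close>

context unstable_rational_mode
begin

abbreviation mean_E :: "real \<Rightarrow> real" where "mean_E s \<equiv> Re (ev (mean E) (0, of_real s))"

lemma real_point: "s < 0 \<Longrightarrow> (of_real v, of_real s) \<in> \<Omega>"
  using \<mu>_pos by (simp add: \<Omega>_def mult_pos_neg)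

text \<open>
  The zero frequency part only has the indices \<open>(j, j)\<close>, so it is a power series in \<open>exp (2 \<mu> s)\<close>.
\<close>

lemma mean_E_powser:
  assumes "s < 0"
  shows "(\<lambda>j. Re (E (j, j)) * exp (2 * \<mu> * s) ^ j) sums mean_E s"
proof -
  let ?p = "(0, complex_of_real s)"
  have p: "?p \<in> \<Omega>" using real_point[OF assms, of 0] by simp
  have fr: "frq (j, k) = 0 \<longleftrightarrow> j = k" for j k using x_generic by (simp add: frq_def)
  have "((\<lambda>i. mean E i * wave i ?p) has_sum ev (mean E) ?p) UNIV"
    by (rule ev_has_sum[OF l1_mean[OF l1_E] p])
  also have "((\<lambda>i. mean E i * wave i ?p) has_sum ev (mean E) ?p) UNIV \<longleftrightarrow>
      ((\<lambda>i. mean E i * wave i ?p) has_sum ev (mean E) ?p) (range (\<lambda>j. (j, j)))"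
    by (rule has_sum_cong_neutral) (auto simp: mean_def fr)
  also have "\<dots> \<longleftrightarrow> (((\<lambda>i. mean E i * wave i ?p) \<circ> (\<lambda>j. (j, j))) has_sum ev (mean E) ?p) UNIV"
    by (rule has_sum_reindex) (auto simp: inj_on_def)
  finally have "(\<lambda>j. mean E (j, j) * wave (j, j) ?p) sums ev (mean E) ?p"
    by (intro has_sum_imp_sums) (simp add: o_def)
  then have "(\<lambda>j. Re (mean E (j, j) * wave (j, j) ?p)) sums mean_E s" by (rule sums_Re)
  moreover have "Re (mean E (j, j) * wave (j, j) ?p) = Re (E (j, j)) * exp (2 * \<mu> * s) ^ j" for j
  proof -
    have "wave (j, j) ?p = of_real (exp (of_nat j * (2 * \<mu> * s)))"
      unfolding exp_of_real[symmetric] wave_def by (simp add: deg_def fr algebra_simps)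
    then show ?thesis by (simp add: mean_def fr exp_of_nat_mult)
  qed
  ultimately show ?thesis by simp
qed

text \<open>
  The power series of the mean has no constant term and a positive first coefficient. Hence, far enough in the past,
  it is small and increasing.
\<close>

lemma mean_E_increasing:
  assumes "0 < e"
  obtains s1 where "s1 < 0" "strict_mono_on {..s1} mean_E" "mean_E s1 < e"
proof -
  let ?c = "\<lambda>j. Re (E (j, j))"
  define f where "f w = (\<Sum>j. ?c j * w ^ j)" for w
  have sm: "summable (\<lambda>j. ?c j * r ^ j)" if "norm r < 1" for r :: real
  proof (rule summable_comparison_test')
    show "summable (\<lambda>j. (4 * \<eta>) * norm r ^ j)" using that by (intro summable_mult summable_geometric) simp
    fix j :: nat assume "0 \<le> j"
    have "norm (E (j, j)) \<le> 4 * \<eta>"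
      using bndD[OF bnd_lower[OF bnd_E, of 0], of "{(j, j)}"] by simp
    then have "\<bar>?c j\<bar> \<le> 4 * \<eta>" using abs_Re_le_cmod order_trans by blast
    then show "norm (?c j * r ^ j) \<le> (4 * \<eta>) * norm r ^ j"
      by (simp add: abs_mult power_abs mult_right_mono)
  qed
  have sm': "summable (\<lambda>j. diffs ?c j * r ^ j)" if "norm r < 1" for r :: real
    by (rule termdiff_converges[OF that sm])
  have der: "(f has_real_derivative (\<Sum>j. diffs ?c j * w ^ j)) (at w)" if w: "norm w < 1" for w
  proof -
    obtain K where "norm w < K" "K < 1" using dense[OF w] by blast
    then show ?thesis unfolding f_def by (intro termdiffs_strong[of _ K] sm) auto
  qed
  have "isCont (\<lambda>w. \<Sum>j. diffs ?c j * w ^ j) 0"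
    by (rule isCont_powser[of _ "1/2"]) (auto intro!: sm')
  moreover have "(\<Sum>j. diffs ?c j * 0 ^ j) = 2 * amp\<^sup>2"
    by (simp add: diffs_def E_11[unfolded One_nat_def])
  ultimately have "\<forall>\<^sub>F w in at 0. 0 < (\<Sum>j. diffs ?c j * w ^ j)"
    unfolding isCont_def using amp_pos by (intro order_tendstoD(1)[of _ "2 * amp\<^sup>2"]) auto
  moreover have "f 0 = 0" using UE_0(2) by (simp add: f_def zero_prod_def)
  then have "\<forall>\<^sub>F w in at 0. f w < e"
    using DERIV_isCont[OF der[of 0]] assms unfolding isCont_def by (intro order_tendstoD(2)[of _ 0]) auto
  ultimately have "\<forall>\<^sub>F w in at 0. 0 < (\<Sum>j. diffs ?c j * w ^ j) \<and> f w < e"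
    by (rule eventually_conj)
  then obtain \<rho> where \<rho>: "0 < \<rho>" "\<And>w. w \<noteq> 0 \<Longrightarrow> \<bar>w\<bar> < \<rho> \<Longrightarrow> 0 < (\<Sum>j. diffs ?c j * w ^ j) \<and> f w < e"
    unfolding eventually_at by (auto simp: dist_real_def)
  define w0 where "w0 = min \<rho> 1 / 2"
  have w0: "0 < w0" "w0 < 1" "w0 < \<rho>" using \<rho> by (auto simp: w0_def)
  define s1 where "s1 = ln w0 / (2 * \<mu>)"
  have w_le: "exp (2 * \<mu> * s) \<le> w0" if "s \<le> s1" for s
  proof -
    have "2 * \<mu> * s \<le> ln w0" using that \<mu>_pos by (simp add: s1_def field_simps)
    then show ?thesis using w0 by (metis exp_le_cancel_iff exp_ln)
  qed
  have s1: "s1 < 0" using w0 \<mu>_pos by (simp add: s1_def divide_neg_pos)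
  have mf: "mean_E s = f (exp (2 * \<mu> * s))" if "s < 0" for s
    using sums_unique[OF mean_E_powser[OF that]] by (simp add: f_def)
  show ?thesis
  proof (rule that[OF s1])
    show "strict_mono_on {..s1} mean_E"
    proof (rule strict_mono_onI)
      fix r s assume rs: "r \<in> {..s1}" "s \<in> {..s1}" "r < s"
      have "f (exp (2 * \<mu> * r)) < f (exp (2 * \<mu> * s))"
      proof (rule DERIV_pos_imp_increasing[where f = f])
        show "exp (2 * \<mu> * r) < exp (2 * \<mu> * s)" using rs \<mu>_pos by simp
        fix w assume "exp (2 * \<mu> * r) \<le> w" "w \<le> exp (2 * \<mu> * s)"
        then have w: "0 < w" "w \<le> w0"
          using less_le_trans[OF exp_gt_zero, of "2 * \<mu> * r" w] w_le[of s] rs(2) by auto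
        then have "0 < (\<Sum>j. diffs ?c j * w ^ j)" "norm w < 1" using \<rho>(2)[of w] w0 by auto
        then show "\<exists>y. (f has_real_derivative y) (at w) \<and> 0 < y" using der by blast
      qed
      then show "mean_E r < mean_E s" using mf[of r] mf[of s] rs s1 by simp
    qed
    have "exp (2 * \<mu> * s1) \<le> w0" by (rule w_le) simp
    then show "mean_E s1 < e" using \<rho>(2)[of "exp (2 * \<mu> * s1)"] w0 mf[OF s1] by auto
  qed
qed

text \<open>
  The periodic part of the primitive in \<open>\<theta>\<close>.
\<close>

definition primitive :: "series \<Rightarrow> series" where
  "primitive a i = (if frq i = 0 then 0 else a i / (\<i> * of_real (frq i)))"

lemma frq_ge: "frq i \<noteq> 0 \<Longrightarrow> \<bar>x\<bar> \<le> \<bar>frq i\<bar>"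
proof -
  assume "frq i \<noteq> 0"
  then have "int (fst i) - int (snd i) \<noteq> 0" by (auto simp: frq_def)
  then have "1 \<le> \<bar>real_of_int (int (fst i) - int (snd i))\<bar>" by linarith
  then have "1 * \<bar>x\<bar> \<le> \<bar>real_of_int (int (fst i) - int (snd i))\<bar> * \<bar>x\<bar>" by (rule mult_right_mono) simp
  then show ?thesis by (simp add: frq_def abs_mult)
qed

lemma l1_primitive:
  assumes "l1 a"
  shows "l1 (primitive a)"
proof (rule l1_le[OF assms])
  fix i
  show "norm (primitive a i) \<le> (1 / \<bar>x\<bar>) * norm (a i)"
  proof (cases "frq i = 0")
    case False
    then have "norm (a i) * (1 / \<bar>frq i\<bar>) \<le> norm (a i) * (1 / \<bar>x\<bar>)"
      using frq_ge[of i] x_generic by (intro mult_left_mono divide_left_mono) auto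
    then show ?thesis using False by (simp add: primitive_def norm_divide norm_mult)
  qed (simp add: primitive_def)
qed

lemma pd1_primitive:
  assumes "l1 a" "p \<in> \<Omega>"
  shows "pd1 (ev (primitive a)) p = ev a p - ev (mean a) p"
proof -
  have dprim: "ddtheta (primitive a) = (\<lambda>i. a i + (-1) * mean a i)" by (auto simp: ddtheta_def primitive_def mean_def fun_eq_iff)
  show ?thesis
    unfolding pd1_ev[OF l1_primitive[OF assms(1)] assms(2)] dprim
      ev_add[OF assms(1) l1_cmult[OF l1_mean[OF assms(1)]] assms(2)] ev_cmult by simp
qed

lemma ev_mean_U: "ev (mean U) p = 0"
proof -
  have "mean U = (\<lambda>i. 0)" using U_excluded by (auto simp: mean_def fun_eq_iff)
  then show ?thesis by (simp add: ev_def)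
qed

lemma scale_real: "\<exists>A>0. \<forall>v. scale (v, of_real s) = of_real A"
proof -
  have "ev log_scale (0, of_real s) \<in> \<real>" by (rule ev_real[OF hermitian_log_scale]) auto
  then obtain a where "ev log_scale (0, of_real s) = of_real a" by (auto elim: Reals_cases)
  then have "scale (v, of_real s) = of_real (exp (- (c * s) + - a))" for v
    unfolding scale_indep[of v] by (simp add: scale_def exp_of_real[symmetric])
  then show ?thesis by (intro exI[of _ "exp (- (c * s) + - a)"]) simp
qed

text \<open>
  At a fixed time the curve has curvature \<open>A k\<close> at the tangent angle \<open>\<theta>\<close>. Its length is \<open>2 \<pi> \<omega> / A\<close> because \<open>r\<close> has mean \<open>1\<close>,
  the integral of the squared curvature is \<open>2 \<pi> \<omega> A\<close> times the mean of \<open>1 + E\<close>, and the scale drops out of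
  the product: the oscillation is \<open>(2 \<pi> \<omega>)\<^sup>2\<close> times the mean of \<open>E\<close>.
\<close>

lemma slice_geometry:
  fixes s :: real and \<theta> \<theta>' :: "real \<Rightarrow> real"
  assumes s: "s < 0" and \<theta>: "\<And>u. (\<theta> has_real_derivative \<theta>' u) (at u)" and \<theta>': "\<And>u. 0 < \<theta>' u"
    and per: "\<theta> (2 * pi) = \<theta> 0 + 2 * pi * of_int \<omega>"
    and hol: "hol2 \<Gamma> \<Omega>" and pd: "\<And>p. p \<in> \<Omega> \<Longrightarrow> pd1 \<Gamma> p = exp (\<i> * fst p) * radius p / scale p"
  defines "\<gamma> \<equiv> \<lambda>u. \<Gamma> (of_real (\<theta> u), of_real s)"
  shows "vector_derivative \<gamma> (at u) \<noteq> 0" "turning_number \<gamma> = of_int \<omega>"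
    "K_osc \<gamma> = (2 * pi * of_int \<omega>)\<^sup>2 * mean_E s"
    "(arc_deriv \<gamma> (arc_deriv \<gamma> (curvature \<gamma>)) u + c * curvature \<gamma> u ^ 3) *\<^sub>R unit_normal \<gamma> u =
       scale (0, of_real s) ^ 3 * ev G (of_real (\<theta> u), of_real s) * (\<i> * exp (\<i> * of_real (\<theta> u)))"
proof -
  let ?p = "\<lambda>v :: real. (complex_of_real v, complex_of_real s)"
  have p: "?p v \<in> \<Omega>" for v by (rule real_point[OF s])
  obtain A where A: "0 < A" "\<And>v. scale (v, of_real s) = of_real A" using scale_real[of s] by blast
  define k where "k v = Re (curv (?p v))" for v
  define r where "r v = Re (radius (?p v))" for v
  have curv: "curv (?p v) = of_real (k v)" and radius: "radius (?p v) = of_real (r v)" for v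
    unfolding k_def r_def by (auto simp: complex_is_Real_iff[symmetric] complex_eq_iff ev_real[OF hermitian_UE(1)] ev_real[OF hermitian_UE(2)])
  have rk: "r v * k v = 1" for v
    using radius_curv[OF p[of v]] unfolding curv radius of_real_mult[symmetric] by (simp del: of_real_mult)
  \<comment> \<open>\<open>U\<close> is bounded by \<open>1/2\<close>, so the curve is locally convex\<close>
  have r: "0 < r v" for v
  proof -
    have "norm (ev U (?p v)) \<le> 2 * \<eta>" by (rule norm_ev_le[OF bnd_lower[OF bnd_U] p]) simp
    then have "norm (ev U (?p v)) \<le> 1 / 2" using \<eta>_le(1) by simp
    then have "- (1 / 2) \<le> Re (ev U (?p v))" using abs_Re_le_cmod[of "ev U (?p v)"] by linarith
    then show ?thesis by (simp add: r_def)
  qed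
  have k: "0 < k v" for v using rk[of v] r[of v] by (metis zero_less_mult_pos zero_less_one)
  have r_eq: "r v = 1 / k v" for v using rk[of v] k[of v] by (simp add: field_simps)
  define K where "K v = A * k v" for v
  define K1 where "K1 v = A * Re (pd1 (ev E) (?p v))" for v
  define W2 where "W2 v = A\<^sup>2 * Re (pd1 (pd1 (ev Q)) (?p v)) / 2" for v
  note dd = Re_has_real_derivative[OF hol2_has_pd1[OF _ p]]
  have Q1: "pd1 (ev Q) (?p v) = 2 * curv (?p v) * pd1 (ev E) (?p v)" for v
  proof -
    have "pd1 (ev Q) (?p v) = pd1 (\<lambda>p. curv p * curv p) (?p v)"
      by (rule pd_cong(1)[OF open_\<Omega> ev_Q p])
    also have "\<dots> = pd1 (ev E) (?p v) * curv (?p v) + pd1 (ev E) (?p v) * curv (?p v)"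
    proof -
      have e: "((\<lambda>z. curv (z, of_real s)) has_field_derivative 0 + pd1 (ev E) (?p v)) (at (of_real v))"
        by (intro DERIV_add DERIV_const hol2_has_pd1[OF hol2_ev[OF l1_E] p])
      show ?thesis
        using DERIV_imp_deriv[OF DERIV_mult[OF e e]] by (simp add: pd1_def[of "\<lambda>p. curv p * curv p"])
    qed
    finally show ?thesis by (simp add: mult_ac)
  qed
  have dK: "(K has_real_derivative K1 v) (at v)" for v
  proof -
    have "((\<lambda>v. A * (1 + Re (ev E (?p v)))) has_real_derivative A * (0 + Re (pd1 (ev E) (?p v)))) (at v)"
      by (intro DERIV_cmult DERIV_add DERIV_const dd hol2_ev l1_E)
    then show ?thesis by (simp add: K_def[abs_def] k_def[abs_def] K1_def)
  qed
  have KK1: "K v * K1 v = A\<^sup>2 / 2 * Re (pd1 (ev Q) (?p v))" for v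
    unfolding Q1 curv by (simp add: K_def K1_def power2_eq_square)
  have dW: "((\<lambda>v. K v * K1 v) has_real_derivative W2 v) (at v)" for v
  proof -
    have "((\<lambda>v. A\<^sup>2 / 2 * Re (pd1 (ev Q) (?p v))) has_real_derivative A\<^sup>2 / 2 * Re (pd1 (pd1 (ev Q)) (?p v))) (at v)"
      by (intro DERIV_cmult dd hol2_pd1[OF open_\<Omega>] hol2_ev l1_Q)
    then show ?thesis by (simp add: KK1 W2_def)
  qed
  have d\<gamma>: "(\<gamma> has_vector_derivative (\<theta>' u / K (\<theta> u)) *\<^sub>R cis (\<theta> u)) (at u)" for u
  proof -
    have "((\<lambda>v. \<Gamma> (?p v)) has_vector_derivative pd1 \<Gamma> (?p (\<theta> u))) (at (\<theta> u))"
      by (rule has_field_derivative_of_real_within[OF hol2_has_pd1[OF hol p]])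
    from vector_diff_chain_at[OF \<theta>[unfolded has_real_derivative_iff_has_vector_derivative] this]
    have "(\<gamma> has_vector_derivative \<theta>' u *\<^sub>R pd1 \<Gamma> (?p (\<theta> u))) (at u)" by (simp add: o_def \<gamma>_def)
    moreover have "\<theta>' u *\<^sub>R pd1 \<Gamma> (?p (\<theta> u)) = (\<theta>' u / K (\<theta> u)) *\<^sub>R cis (\<theta> u)"
      unfolding pd[OF p] radius A(2) r_eq K_def using A(1) k[of "\<theta> u"]
      by (simp add: scaleR_conv_of_real cis_conv_exp)
    ultimately show ?thesis by simp
  qed
  interpret angle_parametrized \<gamma> \<theta> \<theta>' K K1 W2
    by unfold_locales (use \<theta> \<theta>' d\<gamma> dK dW A k in \<open>auto simp: K_def\<close>)
  show "vector_derivative \<gamma> (at u) \<noteq> 0" using speed_pos[of u] by (auto simp: speed_def)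
  let ?m = "mean_E s"
  define FL where "FL v = (v + Re (ev (primitive U) (?p v))) / A" for v
  define FK where "FK v = A * ((1 + ?m) * v + Re (ev (primitive E) (?p v)))" for v
  have shift: "?p (v + 2 * pi * of_int \<omega>) = (of_real v + of_real (2 * pi * of_int \<omega>), of_real s)" for v
    by simp
  have FL1: "(FL has_real_derivative 1 / K v) (at v)" for v
  proof -
    have "((\<lambda>v. (v + Re (ev (primitive U) (?p v))) / A) has_real_derivative (1 + Re (pd1 (ev (primitive U)) (?p v))) / A) (at v)"
      by (intro DERIV_cdivide DERIV_add DERIV_ident dd hol2_ev l1_primitive l1_U l1_E)
    moreover have "(1 + Re (pd1 (ev (primitive U)) (?p v))) / A = 1 / K v"
      using r_eq[of v] unfolding pd1_primitive[OF l1_U p] ev_mean_U by (simp add: r_def K_def)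
    ultimately show ?thesis by (simp add: FL_def[abs_def])
  qed
  have FK1: "(FK has_real_derivative K v) (at v)" for v
  proof -
    have "((\<lambda>v. A * ((1 + ?m) * v + Re (ev (primitive E) (?p v)))) has_real_derivative A * ((1 + ?m) * 1 + Re (pd1 (ev (primitive E)) (?p v)))) (at v)"
      by (intro DERIV_cmult DERIV_add DERIV_ident dd hol2_ev l1_primitive l1_U l1_E)
    moreover have "ev (mean E) (?p v) = ev (mean E) (0, of_real s)"
      by (rule ev_zero_frequency) (simp add: mean_def)
    then have "(1 + ?m) * 1 + Re (pd1 (ev (primitive E)) (?p v)) = k v"
      unfolding pd1_primitive[OF l1_E p] by (simp add: k_def)
    ultimately show ?thesis by (simp add: FK_def[abs_def] K_def)
  qed
  have FL2: "FL (v + 2 * pi * of_int \<omega>) = FL v + 2 * pi * of_int \<omega> / A" for v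
    unfolding FL_def shift ev_period by (simp add: add_divide_distrib)
  have FK2: "FK (v + 2 * pi * of_int \<omega>) = FK v + A * ((1 + ?m) * (2 * pi * of_int \<omega>))" for v
    unfolding FK_def shift ev_period by (simp add: algebra_simps)
  have L: "2 * pi * of_int \<omega> / A \<noteq> 0" using A(1) \<omega>_pos by simp
  note glob = global_quantities[OF per FL1 FL2 FK1 FK2 L]
  show "turning_number \<gamma> = of_int \<omega>" by (rule glob(1))
  show "K_osc \<gamma> = (2 * pi * of_int \<omega>)\<^sup>2 * mean_E s"
    unfolding glob(2) using A(1) by (simp add: field_simps power2_eq_square)
  have "ev G (?p v) = of_real (Re (ev G (?p v)))" for v
    using ev_real[OF hermitian_G, of "?p v"] by (simp add: complex_is_Real_iff complex_eq_iff)
  moreover have "A ^ 3 * Re (ev G (?p v)) = K v * W2 v + c * K v ^ 3" for v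
    unfolding ev_G[OF p] ev_Q[OF p] curv
    by (simp add: K_def W2_def power2_eq_square power3_eq_cube algebra_simps)
  ultimately have G: "of_real A ^ 3 * ev G (?p v) = of_real (K v * W2 v + c * K v ^ 3)" for v
    by (metis of_real_mult of_real_power)
  show "(arc_deriv \<gamma> (arc_deriv \<gamma> (curvature \<gamma>)) u + c * curvature \<gamma> u ^ 3) *\<^sub>R unit_normal \<gamma> u =
       scale (0, of_real s) ^ 3 * ev G (?p (\<theta> u)) * (\<i> * exp (\<i> * of_real (\<theta> u)))"
    unfolding curvature_ss unfolding curvature normal A(2) G by (simp add: scaleR_conv_of_real cis_conv_exp)
qed

end

section \<open>The growing solution\<close>

context unstable_rational_mode
begin

text \<open>
  Start at a time \<open>s0\<close> so early that the mean of \<open>E\<close> is small and increasing up to \<open>s1 = s0 + 1\<close>; the clock is then run for so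
  short a time that the rescaled time stays below \<open>s1\<close>.
\<close>

lemma growing_solution:
  assumes "0 < \<epsilon>"
  shows "\<exists>(T :: ereal) (\<gamma>\<^sub>0 :: real \<Rightarrow> complex) (\<gamma> :: real \<Rightarrow> real \<Rightarrow> complex).
    flow_solution c T \<gamma>\<^sub>0 \<gamma> \<and>
    (\<forall>t\<in>time_interval T. turning_number (\<lambda>u. \<gamma> u t) = real_of_int \<omega>) \<and>
    K_osc \<gamma>\<^sub>0 \<le> \<epsilon> \<and>
    (\<exists>t\<^sub>0 :: ereal. 0 < t\<^sub>0 \<and> t\<^sub>0 \<le> T \<and>
       strict_mono_on (time_interval t\<^sub>0) (\<lambda>t. K_osc (\<lambda>u. \<gamma> u t)))"
proof -
  define w where "w = real_of_int \<omega>"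
  have w: "0 < w" using \<omega>_pos by (simp add: w_def)
  have W: "0 < (2 * pi * w)\<^sup>2" using w by simp
  then have "0 < \<epsilon> / (2 * pi * w)\<^sup>2" using assms by simp
  then obtain s1 where s1: "s1 < 0" "strict_mono_on {..s1} mean_E" "mean_E s1 < \<epsilon> / (2 * pi * w)\<^sup>2"
    by (rule mean_E_increasing)
  define s0 where "s0 = s1 - 1"
  have s0: "s0 < 0" using s1 by (simp add: s0_def)
  obtain \<delta> X \<phi> where \<delta>: "0 < \<delta>" and X: "open X" "\<And>u. complex_of_real u \<in> X"
    and h\<phi>: "hol2 \<phi> (X \<times> ball (of_real s0) \<delta>)"
    and \<phi>\<Omega>: "\<And>z \<tau>. z \<in> X \<Longrightarrow> \<tau> \<in> ball (of_real s0) \<delta> \<Longrightarrow> (\<phi> (z, \<tau>), \<tau>) \<in> \<Omega>"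
    and \<phi>2: "\<And>z \<tau>. z \<in> X \<Longrightarrow> \<tau> \<in> ball (of_real s0) \<delta> \<Longrightarrow>
        pd2 \<phi> (z, \<tau>) = - curv (\<phi> (z, \<tau>), \<tau>) * pd1 (ev G) (\<phi> (z, \<tau>), \<tau>)"
    and \<phi>per: "\<And>u \<tau>. \<tau> \<in> ball (of_real s0) \<delta> \<Longrightarrow> \<phi> (of_real (u + 2 * pi * of_int \<omega>), \<tau>) = \<phi> (of_real u, \<tau>) + of_real (2 * pi * of_int \<omega>)"
    and \<phi>real: "\<And>u s. of_real s \<in> ball (complex_of_real s0) \<delta> \<Longrightarrow> \<phi> (of_real u, of_real s) \<in> \<real>"
    and \<phi>1: "\<And>u \<tau>. \<tau> \<in> ball (of_real s0) \<delta> \<Longrightarrow> 0 < Re (pd1 \<phi> (of_real u, \<tau>))"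
  proof (rule angle_flow[OF s0], goal_cases)
    case (1 \<delta> X \<phi>)
    show ?case by (rule 1(1)[of \<delta> X \<phi>]) (fact 1)+
  qed
  obtain \<epsilon>0 Tc where \<epsilon>0: "0 < \<epsilon>0" and Thol: "Tc holomorphic_on ball 0 \<epsilon>0" and T0: "Tc 0 = of_real s0"
    and Tball: "\<And>t. t \<in> ball 0 \<epsilon>0 \<Longrightarrow> Tc t \<in> ball (of_real s0) (min \<delta> 1)"
    and dT: "\<And>t. t \<in> ball 0 \<epsilon>0 \<Longrightarrow> (Tc has_field_derivative scale (0, Tc t) ^ 4) (at t)"
    and Treal: "\<And>t. t \<in> ball 0 \<epsilon>0 \<Longrightarrow> t \<in> \<real> \<Longrightarrow> Tc t \<in> \<real>"
    using clock[OF s0, of "min \<delta> 1"] \<delta> by auto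
  have T\<delta>: "Tc t \<in> ball (of_real s0) \<delta>" if "t \<in> ball 0 \<epsilon>0" for t using Tball[OF that] by auto
  obtain \<Gamma> where h\<Gamma>: "hol2 \<Gamma> \<Omega>"
    and \<Gamma>1: "\<And>p. p \<in> \<Omega> \<Longrightarrow> pd1 \<Gamma> p = exp (\<i> * fst p) * radius p / scale p"
    and \<Gamma>2: "\<And>p. p \<in> \<Omega> \<Longrightarrow> pd2 \<Gamma> p = exp (\<i> * fst p) * (pd1 (ev G) p - \<i> * ev G p) / scale p"
    and \<Gamma>per: "\<And>\<theta> \<tau>. \<Gamma> (\<theta> + of_real (2 * pi * of_int \<omega>), \<tau>) = \<Gamma> (\<theta>, \<tau>)"
    using base_curve by blast
  define S where "S = {p. of_real w * fst p \<in> X \<and> snd p \<in> ball (0 :: complex) \<epsilon>0}"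
  have S: "open S"
  proof -
    have "S = (\<lambda>p :: complex \<times> complex. of_real w * fst p) -` X \<inter> snd -` ball 0 \<epsilon>0" by (auto simp: S_def)
    moreover have "open ((\<lambda>p :: complex \<times> complex. of_real w * fst p) -` X)"
      by (rule open_vimage[OF X(1)]) (intro continuous_intros)
    moreover have "open (snd -` ball (0 :: complex) \<epsilon>0 :: (complex \<times> complex) set)"
      by (rule open_vimage) (auto intro: continuous_intros)
    ultimately show ?thesis by (simp add: open_Int)
  qed
  define \<Phi> where "\<Phi> p = \<phi> (of_real w * fst p, Tc (snd p))" for p
  have hT: "hol2 (\<lambda>p. Tc (snd p)) S"
    by (rule hol2_holomorphic_compose[OF open_ball Thol hol2_snd]) (auto simp: S_def)
  have opX: "open (X \<times> ball (complex_of_real s0) \<delta>)" using X(1) by (intro open_Times) auto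
  have h\<Phi>: "hol2 \<Phi> S"
    unfolding \<Phi>_def
    by (rule hol2_compose[OF opX h\<phi> _ hT]) (use T\<delta> in \<open>auto simp: S_def intro!: hol2_intros\<close>)
  define g where "g p = \<Gamma> (\<Phi> p, Tc (snd p))" for p
  have \<Phi>\<Omega>: "(\<Phi> p, Tc (snd p)) \<in> \<Omega>" if "p \<in> S" for p
    using that T\<delta> unfolding \<Phi>_def S_def by (auto intro!: \<phi>\<Omega>)
  have hg: "hol2 g S"
    unfolding g_def by (rule hol2_compose[OF open_\<Omega> h\<Gamma> h\<Phi> hT \<Phi>\<Omega>])
  define \<gamma> where "\<gamma> u t = g (of_real u, of_real t)" for u t :: real
  let ?T = "ereal \<epsilon>0"
  have ti: "t \<in> time_interval ?T \<longleftrightarrow> 0 \<le> t \<and> t < \<epsilon>0" for t by (simp add: time_interval_def)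
  define \<sigma> where "\<sigma> t = Re (Tc (of_real t))" for t :: real
  have tb: "complex_of_real t \<in> ball 0 \<epsilon>0" if "t \<in> time_interval ?T" for t using that by (simp add: ti)
  have \<sigma>: "Tc (of_real t) = of_real (\<sigma> t)" if "t \<in> time_interval ?T" for t
    using Treal[OF tb[OF that]] by (simp add: \<sigma>_def)
  have \<sigma>_less: "\<sigma> t < s1" if "t \<in> time_interval ?T" for t
  proof -
    have "norm (Tc (of_real t) - of_real s0) < 1" using Tball[OF tb[OF that]] by (simp add: dist_norm norm_minus_commute)
    then have "\<bar>\<sigma> t - s0\<bar> < 1" unfolding \<sigma>[OF that] of_real_diff[symmetric] norm_of_real .
    then show ?thesis by (simp add: s0_def)
  qed
  have inS: "(complex_of_real u, complex_of_real t) \<in> S" if "t \<in> time_interval ?T" for u t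
    using X(2)[of "w * u"] tb[OF that] by (simp add: S_def)
  define \<theta> where "\<theta> t u = Re (\<phi> (of_real (w * u), of_real (\<sigma> t)))" for t u
  define \<theta>' where "\<theta>' t u = w * Re (pd1 \<phi> (of_real (w * u), of_real (\<sigma> t)))" for t u
  have \<sigma>b: "of_real (\<sigma> t) \<in> ball (complex_of_real s0) \<delta>" if "t \<in> time_interval ?T" for t
    using T\<delta>[OF tb[OF that]] \<sigma>[OF that] by simp
  have \<phi>\<theta>: "\<phi> (of_real (w * u), of_real (\<sigma> t)) = of_real (\<theta> t u)" if "t \<in> time_interval ?T" for t u
    using \<phi>real[OF \<sigma>b[OF that], of "w * u"] by (simp add: \<theta>_def)
  have \<gamma>_eq: "(\<lambda>u. \<gamma> u t) = (\<lambda>u. \<Gamma> (of_real (\<theta> t u), of_real (\<sigma> t)))" if "t \<in> time_interval ?T" for t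
    using \<phi>\<theta>[OF that] \<sigma>[OF that] by (auto simp: \<gamma>_def g_def \<Phi>_def fun_eq_iff)
  have d\<theta>: "(\<theta> t has_real_derivative \<theta>' t u) (at u)" if "t \<in> time_interval ?T" for t u
  proof -
    have "((\<lambda>z. \<phi> (of_real w * z, of_real (\<sigma> t))) has_field_derivative pd1 \<phi> (of_real (w * u), of_real (\<sigma> t)) * of_real w) (at (of_real u))"
      by (rule DERIV_chain2[where f = "\<lambda>z. \<phi> (z, of_real (\<sigma> t))" and g = "\<lambda>z. of_real w * z"])
        (use hol2_has_pd1[OF h\<phi>, of "of_real (w * u)" "of_real (\<sigma> t)"] X(2)[of "w * u"] \<sigma>b[OF that] in \<open>auto intro!: derivative_eq_intros\<close>)
    from Re_has_real_derivative[OF this] show ?thesis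
      by (simp add: \<theta>_def[abs_def] \<theta>'_def mult.commute)
  qed
  have \<theta>'_pos: "0 < \<theta>' t u" if "t \<in> time_interval ?T" for t u
    using \<phi>1[OF \<sigma>b[OF that], of "w * u"] w by (simp add: \<theta>'_def)
  have \<theta>per: "\<theta> t (u + 2 * pi) = \<theta> t u + 2 * pi * of_int \<omega>" if "t \<in> time_interval ?T" for t u
    using \<phi>per[OF \<sigma>b[OF that], of "w * u"] by (simp add: \<theta>_def w_def algebra_simps)
  have \<theta>per0: "\<theta> t (2 * pi) = \<theta> t 0 + 2 * pi * of_int \<omega>" if "t \<in> time_interval ?T" for t
    using \<theta>per[OF that, of 0] by simp
  have slice: "vector_derivative (\<lambda>u. \<gamma> u t) (at u) \<noteq> 0" "turning_number (\<lambda>u. \<gamma> u t) = of_int \<omega>"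
    "K_osc (\<lambda>u. \<gamma> u t) = (2 * pi * w)\<^sup>2 * mean_E (\<sigma> t)"
    "(arc_deriv (\<lambda>u. \<gamma> u t) (arc_deriv (\<lambda>u. \<gamma> u t) (curvature (\<lambda>u. \<gamma> u t))) u + c * curvature (\<lambda>u. \<gamma> u t) u ^ 3) *\<^sub>R unit_normal (\<lambda>u. \<gamma> u t) u =
       scale (0, of_real (\<sigma> t)) ^ 3 * ev G (of_real (\<theta> t u), of_real (\<sigma> t)) * (\<i> * exp (\<i> * of_real (\<theta> t u)))"
    if t: "t \<in> time_interval ?T" for t u
    unfolding \<gamma>_eq[OF t] w_def
    using slice_geometry[OF less_trans[OF \<sigma>_less[OF t] s1(1)] d\<theta>[OF t] \<theta>'_pos[OF t] \<theta>per0[OF t] h\<Gamma> \<Gamma>1] by blast+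
  have flow: "((\<lambda>r. \<gamma> u r) has_vector_derivative
      - (scale (0, of_real (\<sigma> t)) ^ 3 * ev G (of_real (\<theta> t u), of_real (\<sigma> t)) * (\<i> * exp (\<i> * of_real (\<theta> t u)))))
      (at t within time_interval ?T)" if t: "t \<in> time_interval ?T" for u t
  proof -
    let ?z = "complex_of_real (w * u)" and ?s = "complex_of_real (\<sigma> t)"
    let ?p = "(complex_of_real (\<theta> t u), ?s)"
    have p: "?p \<in> \<Omega>" using \<phi>\<Omega>[OF X(2) \<sigma>b[OF t], of "w * u"] \<phi>\<theta>[OF t] by simp
    have "((\<lambda>r. \<phi> (?z, Tc r)) has_field_derivative pd2 \<phi> (?z, Tc (of_real t)) * scale (0, Tc (of_real t)) ^ 4) (at (of_real t))"
      by (rule DERIV_chain2[where f = "\<lambda>s. \<phi> (?z, s)" and g = Tc, OF hol2_has_pd2[OF h\<phi>] dT[OF tb[OF t]]])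
        (use X(2)[of "w * u"] T\<delta>[OF tb[OF t]] in auto)
    then have dd: "((\<lambda>r. \<phi> (?z, Tc r)) has_field_derivative (- curv ?p * pd1 (ev G) ?p) * scale (0, ?s) ^ 4) (at (of_real t))"
      unfolding \<sigma>[OF t] \<phi>2[OF X(2) \<sigma>b[OF t]] \<phi>\<theta>[OF t] .
    have "((\<lambda>r. \<Gamma> (\<phi> (?z, Tc r), Tc r)) has_field_derivative
        pd1 \<Gamma> ?p * ((- curv ?p * pd1 (ev G) ?p) * scale (0, ?s) ^ 4) + pd2 \<Gamma> ?p * scale (0, ?s) ^ 4) (at (of_real t))"
      using hol2_chain[OF open_\<Omega> h\<Gamma> _ dd dT[OF tb[OF t]]] p unfolding \<sigma>[OF t] \<phi>\<theta>[OF t] by blast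
    \<comment> \<open>the tangential velocities cancel by \<open>r k = 1\<close>\<close>
    also have "pd1 \<Gamma> ?p * ((- curv ?p * pd1 (ev G) ?p) * scale (0, ?s) ^ 4) + pd2 \<Gamma> ?p * scale (0, ?s) ^ 4
      = - (scale (0, ?s) ^ 3 * ev G ?p * (\<i> * exp (\<i> * of_real (\<theta> t u))))"
    proof -
      let ?A = "scale (0, ?s)" and ?e = "exp (\<i> * complex_of_real (\<theta> t u))"
      have "pd1 \<Gamma> ?p * ((- curv ?p * pd1 (ev G) ?p) * ?A ^ 4) + pd2 \<Gamma> ?p * ?A ^ 4
        = ?e * (?A ^ 4 / ?A) * (- (radius ?p * curv ?p) * pd1 (ev G) ?p + pd1 (ev G) ?p - \<i> * ev G ?p)"
        unfolding \<Gamma>1[OF p] \<Gamma>2[OF p] scale_indep[of "complex_of_real (\<theta> t u)"] fst_conv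
        by (simp add: field_simps add_divide_distrib diff_divide_distrib)
      also have "?A ^ 4 / ?A = ?A ^ 3" using scale_nz[of "(0, ?s)"] by (simp add: power4_eq_xxxx power3_eq_cube)
      finally show ?thesis unfolding radius_curv[OF p] by (simp add: algebra_simps)
    qed
    finally have "((\<lambda>r. \<Gamma> (\<phi> (?z, Tc r), Tc r)) has_field_derivative
       - (scale (0, ?s) ^ 3 * ev G ?p * (\<i> * exp (\<i> * of_real (\<theta> t u))))) (at (of_real t))" .
    from has_field_derivative_of_real_within[OF this]
    show ?thesis by (simp add: \<gamma>_def[abs_def] g_def \<Phi>_def)
  qed
  have sol: "flow_solution c ?T (\<lambda>u. \<gamma> u 0) \<gamma>"
    unfolding flow_solution_def immersed_closed_family_def Let_def
  proof (intro conjI allI ballI)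
    show "0 < ?T" using \<epsilon>0 by simp
    show "smooth_family ?T \<gamma>"
      using hol2_smooth_family[OF S hg inS] by (simp add: \<gamma>_def[abs_def])
    fix u t assume t: "t \<in> time_interval ?T"
    show "\<gamma> (u + 2 * pi) t = \<gamma> u t"
      using fun_cong[OF \<gamma>_eq[OF t], of u] fun_cong[OF \<gamma>_eq[OF t], of "u + 2 * pi"]
      by (simp only: \<theta>per[OF t] of_real_add[of "\<theta> t u"] \<Gamma>per)
    show "vector_derivative (\<lambda>v. \<gamma> v t) (at u) \<noteq> 0" by (rule slice(1)[OF t])
    show "((\<lambda>r. \<gamma> u r) has_vector_derivative
       - ((arc_deriv (\<lambda>v. \<gamma> v t) (arc_deriv (\<lambda>v. \<gamma> v t) (curvature (\<lambda>v. \<gamma> v t))) u + c * curvature (\<lambda>v. \<gamma> v t) u ^ 3) *\<^sub>R unit_normal (\<lambda>v. \<gamma> v t) u))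
      (at t within time_interval ?T)"
      unfolding slice(4)[OF t] by (rule flow[OF t])
  qed simp
  have t0: "0 \<in> time_interval ?T" using \<epsilon>0 by (simp add: ti)
  have "mean_E (\<sigma> 0) \<le> mean_E s1"
    using strict_mono_onD[OF s1(2), of "\<sigma> 0" s1] \<sigma>_less[OF t0] by simp
  then have "mean_E (\<sigma> 0) \<le> \<epsilon> / (2 * pi * w)\<^sup>2" using s1(3) by linarith
  then have small: "K_osc (\<lambda>u. \<gamma> u 0) \<le> \<epsilon>"
    unfolding slice(3)[OF t0] using W by (simp add: pos_le_divide_eq mult.commute)
  have \<sigma>_mono: "\<sigma> r < \<sigma> t" if "r \<in> time_interval ?T" "t \<in> time_interval ?T" "r < t" for r t
  proof (rule DERIV_pos_imp_increasing[where f = \<sigma>, OF that(3)])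
    fix v assume "r \<le> v" "v \<le> t"
    then have v: "v \<in> time_interval ?T" using that by (simp add: ti)
    obtain A where A: "0 < A" "\<And>z. scale (z, of_real (\<sigma> v)) = of_real A" using scale_real[of "\<sigma> v"] by blast
    have "(\<sigma> has_real_derivative Re (scale (0, Tc (of_real v)) ^ 4)) (at v)"
      unfolding \<sigma>_def[abs_def] by (rule Re_has_real_derivative[OF dT[OF tb[OF v]]])
    moreover have "Re (scale (0, Tc (of_real v)) ^ 4) = A ^ 4"
      unfolding \<sigma>[OF v] A(2) of_real_power[symmetric] by simp
    ultimately show "\<exists>y. (\<sigma> has_real_derivative y) (at v) \<and> 0 < y" using A(1) by auto
  qed
  have mono: "strict_mono_on (time_interval ?T) (\<lambda>t. K_osc (\<lambda>u. \<gamma> u t))"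
  proof (rule strict_mono_onI)
    fix r t assume rt: "r \<in> time_interval ?T" "t \<in> time_interval ?T" "r < t"
    have "mean_E (\<sigma> r) < mean_E (\<sigma> t)"
      using strict_mono_onD[OF s1(2) _ _ \<sigma>_mono[OF rt]] \<sigma>_less[OF rt(1)] \<sigma>_less[OF rt(2)] by simp
    then show "K_osc (\<lambda>u. \<gamma> u r) < K_osc (\<lambda>u. \<gamma> u t)"
      unfolding slice(3)[OF rt(1)] slice(3)[OF rt(2)] using W by (rule mult_strict_left_mono)
  qed
  have "0 < ?T" using \<epsilon>0 by simp
  then have "\<exists>t\<^sub>0. 0 < t\<^sub>0 \<and> t\<^sub>0 \<le> ?T \<and> strict_mono_on (time_interval t\<^sub>0) (\<lambda>t. K_osc (\<lambda>u. \<gamma> u t))"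
    using mono by blast
  then show ?thesis using sol slice(2) small by blast
qed

end

text \<open>
  Interpolate between the bounds \<open>2 \<mu> - growth \<ge> \<mu>\<close> and \<open>2 \<mu> - growth \<ge> y\<^sup>4 / 2 - D\<close>.
\<close>

lemma spectral_gap:
  assumes "0 < \<mu>"
  obtains \<kappa> where "0 < \<kappa>" "\<And>y. growth c y \<le> \<mu> \<Longrightarrow> \<kappa> * (1 + \<bar>y\<bar>) ^ 4 \<le> 2 * \<mu> - growth c y"
proof -
  define b where "b = 3 * c + 1"
  define D where "D = b\<^sup>2 / 2 + 4 * \<bar>c\<bar>"
  \<comment> \<open>the weight \<open>q\<close> is such that the loss \<open>q (\<mu> + D)\<close> uses up half of \<open>\<mu>\<close>\<close>
  define q where "q = \<mu> / (2 * (\<mu> + D))"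
  have D: "0 \<le> D" by (simp add: D_def)
  have q: "0 < q" "q \<le> 1" using assms D by (auto simp: q_def field_simps)
  have "0 < \<mu> + D" using assms D by linarith
  then have qD: "q * (\<mu> + D) = \<mu> / 2" unfolding q_def by (simp add: divide_simps)
  define \<kappa> where "\<kappa> = min (\<mu> / 2) (q / 2) / 8"
  have \<kappa>: "0 < \<kappa>" "8 * \<kappa> \<le> \<mu> / 2" "8 * \<kappa> \<le> q / 2" using q assms by (auto simp: \<kappa>_def)
  show ?thesis
  proof (rule that[OF \<kappa>(1)])
    fix y assume y: "growth c y \<le> \<mu>"
    define Y where "Y = y ^ 4"
    have Y: "0 \<le> Y" by (simp add: Y_def)
    have "0 \<le> (y\<^sup>2 - b)\<^sup>2" by simp
    then have "b * y\<^sup>2 \<le> Y / 2 + b\<^sup>2 / 2" by (simp add: Y_def power2_eq_square power4_eq_xxxx algebra_simps)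
    then have "Y / 2 - D \<le> - growth c y" unfolding growth_def D_def b_def[symmetric] Y_def[symmetric] by linarith
    then have 1: "Y / 2 - D \<le> 2 * \<mu> - growth c y" using assms by linarith
    have 2: "\<mu> \<le> 2 * \<mu> - growth c y" using y by linarith
    have "(1 - q) * \<mu> + q * (Y / 2 - D) \<le> (1 - q) * (2 * \<mu> - growth c y) + q * (2 * \<mu> - growth c y)"
      using 1 2 q by (intro add_mono mult_left_mono) auto
    also have "(1 - q) * \<mu> + q * (Y / 2 - D) = \<mu> - q * (\<mu> + D) + q / 2 * Y" by (simp add: algebra_simps)
    finally have 3: "\<mu> / 2 + q / 2 * Y \<le> 2 * \<mu> - growth c y" unfolding qD by (simp add: algebra_simps)
    have four: "(1 + \<bar>y\<bar>) ^ 4 \<le> 8 * (1 + Y)"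
    proof -
      have a: "(u + v)\<^sup>2 \<le> 2 * (u\<^sup>2 + v\<^sup>2)" for u v :: real
        using zero_le_power2[of "u - v"] by (simp add: power2_eq_square algebra_simps)
      have "(1 + \<bar>y\<bar>) ^ 4 = ((1 + \<bar>y\<bar>)\<^sup>2)\<^sup>2" by simp
      also have "\<dots> \<le> (2 * (1\<^sup>2 + \<bar>y\<bar>\<^sup>2))\<^sup>2" by (rule power_mono[OF a]) simp
      also have "\<dots> = 4 * (1 + y\<^sup>2)\<^sup>2" by (simp add: power2_eq_square algebra_simps)
      also have "\<dots> \<le> 4 * (2 * (1\<^sup>2 + (y\<^sup>2)\<^sup>2))" using a[of 1 "y\<^sup>2"] by simp
      finally show ?thesis by (simp add: Y_def)
    qed
    have "\<kappa> * (1 + \<bar>y\<bar>) ^ 4 \<le> \<kappa> * (8 * (1 + Y))" using four \<kappa>(1) by (intro mult_left_mono) auto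
    also have "\<dots> = 8 * \<kappa> + (8 * \<kappa>) * Y" by (simp add: algebra_simps)
    also have "\<dots> \<le> \<mu> / 2 + q / 2 * Y" using \<kappa> Y by (intro add_mono mult_right_mono) auto
    finally show "\<kappa> * (1 + \<bar>y\<bar>) ^ 4 \<le> 2 * \<mu> - growth c y" using 3 by linarith
  qed
qed

lemma growth_p_poly: "growth c y = - p_poly c y / 2"
  by (simp add: growth_def p_poly_def algebra_simps)

theorem theorem1p5:
  fixes c \<epsilon> :: real and \<omega> :: int
  assumes "\<omega> \<ge> 1"
    and "lambda_hat c \<omega> < 0"
    and "\<epsilon> > 0"
  shows "\<exists>(T :: ereal) (\<gamma>\<^sub>0 :: real \<Rightarrow> complex) (\<gamma> :: real \<Rightarrow> real \<Rightarrow> complex).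
    flow_solution c T \<gamma>\<^sub>0 \<gamma> \<and>
    (\<forall>t\<in>time_interval T. turning_number (\<lambda>u. \<gamma> u t) = real_of_int \<omega>) \<and>
    K_osc \<gamma>\<^sub>0 \<le> \<epsilon> \<and>
    (\<exists>t\<^sub>0 :: ereal. 0 < t\<^sub>0 \<and> t\<^sub>0 \<le> T \<and>
       strict_mono_on (time_interval t\<^sub>0) (\<lambda>t. K_osc (\<lambda>u. \<gamma> u t)))"
proof -
  \<comment> \<open>the fastest growing mode, so that no multiple of its frequency is resonant\<close>
  obtain n where n: "n \<in> UNIV - {0, \<omega>, - \<omega>}" "lambda_hat c \<omega> = p_poly c (of_int n / of_int \<omega>)"
    using lambda_hat_minimum(1)[OF assms(1), of c] by blast
  define x where "x = real_of_int n / real_of_int \<omega>"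
  define \<mu> where "\<mu> = growth c x"
  have \<mu>: "0 < \<mu>" using assms(2) n(2) by (simp add: \<mu>_def growth_p_poly x_def)
  obtain \<kappa> where \<kappa>: "0 < \<kappa>" "\<And>y. growth c y \<le> \<mu> \<Longrightarrow> \<kappa> * (1 + \<bar>y\<bar>) ^ 4 \<le> 2 * \<mu> - growth c y"
    using spectral_gap[OF \<mu>, of c] by blast
  have freq: "of_int l / of_int \<omega> \<in> {0, 1, -1 :: real} \<longleftrightarrow> l \<in> {0, \<omega>, - \<omega>}" for l
    using assms(1) by (auto simp: field_simps)
  interpret unstable_rational_mode c x \<mu> \<kappa> n \<omega>
  proof
    show "x \<notin> {0, 1, -1}" using freq[of n] n(1) by (auto simp: x_def)
    fix j k :: nat assume jk: "2 \<le> j + k" "(real j - real k) * x \<notin> {0, 1, -1}"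
    let ?y = "(real j - real k) * x"
    have y: "?y = of_int ((int j - int k) * n) / of_int \<omega>" by (simp add: x_def)
    have "(int j - int k) * n \<in> UNIV - {0, \<omega>, - \<omega>}" using jk(2) freq[of "(int j - int k) * n"] unfolding y by blast
    from lambda_hat_minimum(2)[OF assms(1) this, of c] have "growth c ?y \<le> \<mu>"
      unfolding y n(2) \<mu>_def growth_p_poly x_def by simp
    from \<kappa>(2)[OF this] have "\<kappa> * (1 + \<bar>?y\<bar>) ^ 4 \<le> 2 * \<mu> - growth c ?y" .
    also have "2 * \<mu> \<le> real (j + k) * \<mu>" using jk(1) \<mu> by (intro mult_right_mono) auto
    finally show "\<kappa> * (1 + \<bar>?y\<bar>) ^ 4 \<le> real (j + k) * \<mu> - growth c ?y" by simp
  qed (use \<mu>_def \<mu> \<kappa> x_def assms in auto)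
  show ?thesis using growing_solution[OF assms(3)] .
qed

end
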